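(* Let $W$ be a Weyl group with standard set of generators $S$, $\mathbf I=\{w\in W; w^2=1\}$, $\mathcal A=\mathbb Z[u,u^{-1}]$, and let $M$ be the free $\mathcal A$-module with basis $(a_w)_{w\in\mathbf I}$. Let $\mathfrak H'$ be the Hecke algebra of $W$ over $\mathcal A$ with parameter $u^2$, and let $\bar{\ }:\mathfrak H'\to\mathfrak H'$ be its bar involution (both described in the context). (a) Consider for any $s\in S$ the $\mathcal A$-linear map $T_s:M\to M$ given by (i) $(T_s+1)(a_w)=(u+1)(a_w+a_{sw})$ if $w\in\mathbf I$, $sw=ws>w$; (ii) $(T_s+1)(a_w)=(u^2-u)(a_w+a_{sw})$ if $w\in\mathbf I$, $sw=ws<w$; (iii) $(T_s+1)(a_w)=a_w+a_{sws}$ if $w\in\mathbf I$, $sw\ne ws$ and $ws>w$; (iv) $(T_s+1)(a_w)=u^2(a_w+a_{sws})$ if $w\in\mathbf I$, $sw\neq ws$ and $ws<w$. The maps $T_s$ ($s\in S$) define an $\mathfrak H'$-module structure on $M$. (b) There exists a unique $\mathbb Z$-linear map $\bar{\ }:M\to M$ such that $\overline{u^nm}=u^{-n}\overline m$ for all $m\in M$, $n\in\mathbb Z$, $\overline{a_1}=a_1$, and $\overline{(T_s+1)m}=u^{-2}(T_s+1)\overline m$ for all $m\in M$, $s\in S$. For any $w\in\mathbf I$ we have $\overline{a_w}=\sum_{y\in\mathbf I;\,y\le w}r_{y,w}a_y$ where $r_{y,w}\in\mathcal A$ and $r_{w,w}=u^{-l(w)}$. For any $h\in\mathfrak H'$ and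 $m\in M$ we have $\overline{hm}=\overline h\,\overline m$. For any $m\in M$ we have $\overline{\overline m}=m$.
   Context: $W$ is a (finite) Weyl group with standard generating set $S$ of simple reflections, $l:W\to\mathbb N$ is the length function and $\le$ is the Bruhat order. $u$ is an indeterminate. $\mathfrak H'$ is the free $\mathcal A$-module with basis $(T_w)_{w\in W}$ with the unique $\mathcal A$-algebra structure with unit $T_1$ such that $T_wT_{w'}=T_{ww'}$ whenever $l(ww')=l(w)+l(w')$, and $(T_s+1)(T_s-u^2)=0$ for all $s\in S$. The map $\bar{\ }:\mathfrak H'\to\mathfrak H'$ is the ring involution such that $\overline{u^nT_w}=u^{-n}T_{w^{-1}}^{-1}$ for all $w\in W$, $n\in\mathbb Z$. In cases (iii) and (iv) one automatically has $sw>w$, respectively $sw<w$. *)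

theory Defs
  imports "HOL-Analysis.Analysis" "HOL-Library.Poly_Mapping"
begin

section \<open>Root systems and Weyl groups\<close>

definition refl :: "'a::euclidean_space \<Rightarrow> 'a \<Rightarrow> 'a" where
  "refl \<alpha> x = x - (2 * (x \<bullet> \<alpha>) / (\<alpha> \<bullet> \<alpha>)) *\<^sub>R \<alpha>"

text \<open>
  Reduced crystallographic root systems. The roots are not required to span the ambient space
  (they are a root system in their span); this does not change the Weyl groups that occur, and
  the empty root system gives the trivial group.
\<close>
definition root_system :: "'a::euclidean_space set \<Rightarrow> bool" where
  "root_system \<Phi> \<longleftrightarrow>
     finite \<Phi> \<and> 0 \<notin> \<Phi> \<and>
     (\<forall>\<alpha>\<in>\<Phi>. refl \<alpha> ` \<Phi> = \<Phi>) \<and>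
     (\<forall>\<alpha>\<in>\<Phi>. \<forall>\<beta>\<in>\<Phi>. 2 * (\<beta> \<bullet> \<alpha>) / (\<alpha> \<bullet> \<alpha>) \<in> \<int>) \<and>
     (\<forall>\<alpha>\<in>\<Phi>. \<forall>c::real. c *\<^sub>R \<alpha> \<in> \<Phi> \<longrightarrow> c = 1 \<or> c = - 1)"

definition root_base :: "'a::euclidean_space set \<Rightarrow> 'a set \<Rightarrow> bool" where
  "root_base \<Phi> \<Delta> \<longleftrightarrow>
     \<Delta> \<subseteq> \<Phi> \<and> independent \<Delta> \<and>
     (\<forall>\<beta>\<in>\<Phi>. \<exists>c::'a \<Rightarrow> nat.
        \<beta> = (\<Sum>\<alpha>\<in>\<Delta>. real (c \<alpha>) *\<^sub>R \<alpha>) \<or> \<beta> = - (\<Sum>\<alpha>\<in>\<Delta>. real (c \<alpha>) *\<^sub>R \<alpha>))"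

text \<open>
  The Weyl group as a group of maps under composition. Reflections are involutions, so closure
  under inverses is automatic.
\<close>
inductive_set weyl_group :: "'a::euclidean_space set \<Rightarrow> ('a \<Rightarrow> 'a) set" for \<Phi> where
  one: "id \<in> weyl_group \<Phi>"
| step: "w \<in> weyl_group \<Phi> \<Longrightarrow> \<alpha> \<in> \<Phi> \<Longrightarrow> refl \<alpha> \<circ> w \<in> weyl_group \<Phi>"

definition simple_refls :: "'a::euclidean_space set \<Rightarrow> ('a \<Rightarrow> 'a) set" where
  "simple_refls \<Delta> = refl ` \<Delta>"

definition len :: "'a::euclidean_space set \<Rightarrow> ('a \<Rightarrow> 'a) \<Rightarrow> nat" where
  "len \<Delta> w = (LEAST n. \<exists>ss. set ss \<subseteq> simple_refls \<Delta> \<and> length ss = n \<and> w = foldr (\<circ>) ss id)"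

text \<open>
  Bruhat order: the reflexive-transitive closure of the relations \<open>y < t y\<close> for \<open>t\<close> a reflection
  with \<open>l(y) < l(t y)\<close>. The reflections of the Weyl group (the conjugates of the simple ones) are
  exactly the reflections in roots. Multiplying by \<open>t\<close> on the other side gives the same relation,
  since \<open>t y = y (y\<^sup>-\<^sup>1 t y)\<close>.
\<close>
definition bruhat_step :: "'a::euclidean_space set \<Rightarrow> 'a set \<Rightarrow> ('a \<Rightarrow> 'a) \<Rightarrow> ('a \<Rightarrow> 'a) \<Rightarrow> bool" where
  "bruhat_step \<Phi> \<Delta> y w \<longleftrightarrow>
     y \<in> weyl_group \<Phi> \<and> (\<exists>\<alpha>\<in>\<Phi>. w = refl \<alpha> \<circ> y) \<and> len \<Delta> y < len \<Delta> w"

definition bruhat_le :: "'a::euclidean_space set \<Rightarrow> 'a set \<Rightarrow> ('a \<Rightarrow> 'a) \<Rightarrow> ('a \<Rightarrow> 'a) \<Rightarrow> bool" where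
  "bruhat_le \<Phi> \<Delta> = (bruhat_step \<Phi> \<Delta>)\<^sup>*\<^sup>*"

definition bruhat_less :: "'a::euclidean_space set \<Rightarrow> 'a set \<Rightarrow> ('a \<Rightarrow> 'a) \<Rightarrow> ('a \<Rightarrow> 'a) \<Rightarrow> bool" where
  "bruhat_less \<Phi> \<Delta> y w \<longleftrightarrow> bruhat_le \<Phi> \<Delta> y w \<and> y \<noteq> w"

definition involutions :: "'a::euclidean_space set \<Rightarrow> ('a \<Rightarrow> 'a) set" where
  "involutions \<Phi> = {w \<in> weyl_group \<Phi>. w \<circ> w = id}"


section \<open>Laurent polynomials and free modules\<close>

text \<open>
  Integer-valued finitely supported functions on the integers with the convolution product: this
  is the group ring of the additive group of integers, i.e. \<open>\<int>[u,u\<^sup>-\<^sup>1]\<close>.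
\<close>
type_synonym laurent = "int \<Rightarrow>\<^sub>0 int"

definition upow :: "int \<Rightarrow> laurent" where
  "upow n = Poly_Mapping.single n 1"

text \<open>
  The free module with basis \<open>X\<close> consists of the finitely supported functions with support in \<open>X\<close>.
  Only the additive structure of \<open>'b \<Rightarrow>\<^sub>0 laurent\<close> is used, not its convolution product.
\<close>
definition free_mod :: "'b set \<Rightarrow> ('b \<Rightarrow>\<^sub>0 laurent) set" where
  "free_mod X = {m. Poly_Mapping.keys m \<subseteq> X}"

definition basis_elt :: "'b \<Rightarrow> ('b \<Rightarrow>\<^sub>0 laurent)" where
  "basis_elt x = Poly_Mapping.single x 1"

definition smul :: "laurent \<Rightarrow> ('b \<Rightarrow>\<^sub>0 laurent) \<Rightarrow> ('b \<Rightarrow>\<^sub>0 laurent)"  (infixr "\<cdot>\<^sub>A" 75) where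
  "c \<cdot>\<^sub>A m = Poly_Mapping.map (\<lambda>x. c * x) m"


section \<open>The Hecke algebra and its bar involution\<close>

abbreviation hecke_carrier :: "'a::euclidean_space set \<Rightarrow> (('a \<Rightarrow> 'a) \<Rightarrow>\<^sub>0 laurent) set" where
  "hecke_carrier \<Phi> \<equiv> free_mod (weyl_group \<Phi>)"

text \<open>
  \<open>mul\<close> is the product of the (unique) algebra structure with unit \<open>T\<^sub>1\<close> on the free module with
  basis \<open>T\<^sub>w = basis_elt w\<close> that satisfies the defining relations with parameter \<open>u\<^sup>2\<close>. The values
  of \<open>mul\<close> outside the carrier are unconstrained.
\<close>
definition hecke_product ::
  "'a::euclidean_space set \<Rightarrow> 'a set \<Rightarrow>
   ((('a \<Rightarrow> 'a) \<Rightarrow>\<^sub>0 laurent) \<Rightarrow> (('a \<Rightarrow> 'a) \<Rightarrow>\<^sub>0 laurent) \<Rightarrow> (('a \<Rightarrow> 'a) \<Rightarrow>\<^sub>0 laurent)) \<Rightarrow> bool" where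
  "hecke_product \<Phi> \<Delta> mul \<longleftrightarrow>
     (let H = hecke_carrier \<Phi>; W = weyl_group \<Phi>; T = basis_elt in
       (\<forall>x\<in>H. \<forall>y\<in>H. mul x y \<in> H) \<and>
       (\<forall>x\<in>H. \<forall>y\<in>H. \<forall>z\<in>H. mul (mul x y) z = mul x (mul y z)) \<and>
       (\<forall>x\<in>H. mul (T id) x = x \<and> mul x (T id) = x) \<and>
       (\<forall>x\<in>H. \<forall>y\<in>H. \<forall>z\<in>H. mul (x + y) z = mul x z + mul y z \<and> mul x (y + z) = mul x y + mul x z) \<and>
       (\<forall>c. \<forall>x\<in>H. \<forall>y\<in>H. mul (c \<cdot>\<^sub>A x) y = c \<cdot>\<^sub>A mul x y \<and> mul x (c \<cdot>\<^sub>A y) = c \<cdot>\<^sub>A mul x y) \<and>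
       (\<forall>w\<in>W. \<forall>w'\<in>W. len \<Delta> (w \<circ> w') = len \<Delta> w + len \<Delta> w' \<longrightarrow> mul (T w) (T w') = T (w \<circ> w')) \<and>
       (\<forall>s\<in>simple_refls \<Delta>. mul (T s + T id) (T s - upow 2 \<cdot>\<^sub>A T id) = 0))"

text \<open>
  In the last clause \<open>x\<close> is the (unique) two-sided inverse of \<open>T\<^bsub>w\<^sup>-\<^sup>1\<^esub>\<close>; \<open>inv w\<close> is the inverse map.
\<close>
definition hecke_bar ::
  "'a::euclidean_space set \<Rightarrow>
   ((('a \<Rightarrow> 'a) \<Rightarrow>\<^sub>0 laurent) \<Rightarrow> (('a \<Rightarrow> 'a) \<Rightarrow>\<^sub>0 laurent) \<Rightarrow> (('a \<Rightarrow> 'a) \<Rightarrow>\<^sub>0 laurent)) \<Rightarrow>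
   ((('a \<Rightarrow> 'a) \<Rightarrow>\<^sub>0 laurent) \<Rightarrow> (('a \<Rightarrow> 'a) \<Rightarrow>\<^sub>0 laurent)) \<Rightarrow> bool" where
  "hecke_bar \<Phi> mul hbar \<longleftrightarrow>
     (let H = hecke_carrier \<Phi>; W = weyl_group \<Phi>; T = basis_elt in
       (\<forall>x\<in>H. hbar x \<in> H) \<and>
       (\<forall>x\<in>H. \<forall>y\<in>H. hbar (x + y) = hbar x + hbar y \<and> hbar (mul x y) = mul (hbar x) (hbar y)) \<and>
       hbar (T id) = T id \<and>
       (\<forall>x\<in>H. hbar (hbar x) = x) \<and>
       (\<forall>w\<in>W. \<forall>n. \<exists>x\<in>H. mul x (T (inv w)) = T id \<and> mul (T (inv w)) x = T id \<and>
           hbar (upow n \<cdot>\<^sub>A T w) = upow (- n) \<cdot>\<^sub>A x))"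


section \<open>The module on involutions\<close>

abbreviation inv_mod :: "'a::euclidean_space set \<Rightarrow> (('a \<Rightarrow> 'a) \<Rightarrow>\<^sub>0 laurent) set" where
  "inv_mod \<Phi> \<equiv> free_mod (involutions \<Phi>)"

text \<open>
  The value of \<open>T\<^sub>s + 1\<close> on the basis element \<open>a\<^sub>w\<close>. As \<open>w\<close> is always comparable with, and
  different from, \<open>s w\<close> and \<open>w s\<close>, the two \<open>else\<close> branches of the inner conditionals are the cases
  \<open>s w < w\<close> and \<open>w s < w\<close>.
\<close>
definition Ts_plus_one_basis ::
  "'a::euclidean_space set \<Rightarrow> 'a set \<Rightarrow> ('a \<Rightarrow> 'a) \<Rightarrow> ('a \<Rightarrow> 'a) \<Rightarrow> (('a \<Rightarrow> 'a) \<Rightarrow>\<^sub>0 laurent)" where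
  "Ts_plus_one_basis \<Phi> \<Delta> s w =
     (let a = basis_elt in
      if s \<circ> w = w \<circ> s then
        (if bruhat_less \<Phi> \<Delta> w (s \<circ> w)
         then (upow 1 + 1) \<cdot>\<^sub>A (a w + a (s \<circ> w))
         else (upow 2 - upow 1) \<cdot>\<^sub>A (a w + a (s \<circ> w)))
      else
        (if bruhat_less \<Phi> \<Delta> w (w \<circ> s)
         then a w + a (s \<circ> w \<circ> s)
         else upow 2 \<cdot>\<^sub>A (a w + a (s \<circ> w \<circ> s))))"

text \<open>The linear map \<open>T\<^sub>s\<close>, obtained by linear extension of \<open>T\<^sub>s + 1\<close> and subtraction of the identity.\<close>
definition Ts ::
  "'a::euclidean_space set \<Rightarrow> 'a set \<Rightarrow> ('a \<Rightarrow> 'a) \<Rightarrow>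
   (('a \<Rightarrow> 'a) \<Rightarrow>\<^sub>0 laurent) \<Rightarrow> (('a \<Rightarrow> 'a) \<Rightarrow>\<^sub>0 laurent)" where
  "Ts \<Phi> \<Delta> s m =
     (\<Sum>w\<in>Poly_Mapping.keys m. Poly_Mapping.lookup m w \<cdot>\<^sub>A Ts_plus_one_basis \<Phi> \<Delta> s w) - m"

text \<open>
  \<open>act\<close> is a (left) module structure over the algebra \<open>(H, mul)\<close> on the module \<open>M\<close>, extending the
  given scalar multiplication of \<open>M\<close>.
\<close>
definition hecke_module ::
  "'a::euclidean_space set \<Rightarrow>
   ((('a \<Rightarrow> 'a) \<Rightarrow>\<^sub>0 laurent) \<Rightarrow> (('a \<Rightarrow> 'a) \<Rightarrow>\<^sub>0 laurent) \<Rightarrow> (('a \<Rightarrow> 'a) \<Rightarrow>\<^sub>0 laurent)) \<Rightarrow>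
   ((('a \<Rightarrow> 'a) \<Rightarrow>\<^sub>0 laurent) \<Rightarrow> (('a \<Rightarrow> 'a) \<Rightarrow>\<^sub>0 laurent) \<Rightarrow> (('a \<Rightarrow> 'a) \<Rightarrow>\<^sub>0 laurent)) \<Rightarrow> bool" where
  "hecke_module \<Phi> mul act \<longleftrightarrow>
     (let H = hecke_carrier \<Phi>; M = inv_mod \<Phi> in
       (\<forall>h\<in>H. \<forall>m\<in>M. act h m \<in> M) \<and>
       (\<forall>h\<in>H. \<forall>m\<in>M. \<forall>m'\<in>M. act h (m + m') = act h m + act h m') \<and>
       (\<forall>h\<in>H. \<forall>h'\<in>H. \<forall>m\<in>M. act (h + h') m = act h m + act h' m) \<and>
       (\<forall>c. \<forall>h\<in>H. \<forall>m\<in>M. act (c \<cdot>\<^sub>A h) m = c \<cdot>\<^sub>A act h m \<and> act h (c \<cdot>\<^sub>A m) = c \<cdot>\<^sub>A act h m) \<and>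
       (\<forall>m\<in>M. act (basis_elt id) m = m) \<and>
       (\<forall>h\<in>H. \<forall>h'\<in>H. \<forall>m\<in>M. act (mul h h') m = act h (act h' m)))"

text \<open>The conditions that characterize the bar map of \<open>M\<close>; being linear over the integers means being additive.\<close>
definition inv_mod_bar ::
  "'a::euclidean_space set \<Rightarrow> 'a set \<Rightarrow>
   ((('a \<Rightarrow> 'a) \<Rightarrow>\<^sub>0 laurent) \<Rightarrow> (('a \<Rightarrow> 'a) \<Rightarrow>\<^sub>0 laurent)) \<Rightarrow> bool" where
  "inv_mod_bar \<Phi> \<Delta> mbar \<longleftrightarrow>
     (let M = inv_mod \<Phi> in
       (\<forall>m\<in>M. mbar m \<in> M) \<and>
       (\<forall>m\<in>M. \<forall>m'\<in>M. mbar (m + m') = mbar m + mbar m') \<and>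
       (\<forall>m\<in>M. \<forall>n. mbar (upow n \<cdot>\<^sub>A m) = upow (- n) \<cdot>\<^sub>A mbar m) \<and>
       mbar (basis_elt id) = basis_elt id \<and>
       (\<forall>m\<in>M. \<forall>s\<in>simple_refls \<Delta>.
          mbar (Ts \<Phi> \<Delta> s m + m) = upow (- 2) \<cdot>\<^sub>A (Ts \<Phi> \<Delta> s (mbar m) + mbar m)))"

end

theory Submission
  imports Defs
begin

text \<open>
  For part (a), Matsumoto's theorem reduces the claim to the quadratic and the braid relations. For
  simple reflections \<open>s \<noteq> t\<close> with product of order \<open>m\<close>, the difference of the two alternating products
  of \<open>m\<close> factors \<open>T\<^sub>s\<close>, \<open>T\<^sub>t\<close> commutes with \<open>T\<^sub>s\<close> and \<open>T\<^sub>t\<close> up to exchanging \<open>T\<close> with \<open>u\<^sup>2 - 1 - T\<close>.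
  As \<open>T\<^sub>s a\<^sub>w\<close> involves the next involution with coefficient \<open>1\<close> or \<open>u + 1\<close>, which can be cancelled,
  it suffices that this difference kills \<open>a\<^sub>d\<close> for the involutions \<open>d\<close> with \<open>sd > d\<close> and \<open>td > d\<close>.
  Such a \<open>d\<close> fixes both simple roots, exchanges them, or maps the rank two subsystem out of itself, with
  the possible exception of one simple root, which it then fixes. In the last case both products are
  computed going up. In the first two, \<open>D k = (\<dots> T\<^sub>t T\<^sub>s) a\<^sub>d - (\<dots> T\<^sub>s T\<^sub>t) a\<^sub>d\<close> (\<open>k\<close> factors) obeys
  \<open>(T\<^sub>s + T\<^sub>t - u\<^sup>2 + 1) D (k+1) = D (k+2) + u\<^sup>2 D k\<close>, and at half way \<open>D\<close> is symmetric up to a scalar,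
  so that \<open>D m\<close> is a multiple of \<open>D 0 = 0\<close>.

  For part (b), the bar operator is given by \<open>a\<^sub>w \<mapsto> (-1)\<^bsup>l(w)\<^esup> T\<^sub>w\<^sup>-\<^sup>1 a\<^sub>w\<close>. All its properties follow by
  induction along the steps \<open>w \<mapsto> sw\<close> or \<open>w \<mapsto> sws\<close>, again cancelling \<open>u + 1\<close>.
\<close>

section \<open>Root systems and the length function\<close>

text \<open>The obstacle in (a) is that a \<open>d\<close> fixing or exchanging the simple roots
  reaches the top of its orbit after about half of the \<open>m\<close> factors; the others run down
  again, with ever more terms. Only the ascent is ever computed. The recurrence needs no formula for
  the descent: of \<open>T s\<close> and \<open>T t\<close>, one lengthens an alternating product
  and the other repeats its outer factor, which the quadratic relation removes, so their sum treats
  both roots alike. \<open>M\<close> is in general not generated by \<open>a_1\<close>: a commuting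
  step yields the next basis element only with the factor \<open>u + 1\<close>, which is not a unit.
  Claims on \<open>M\<close> are therefore phrased as membership in a submodule closed under
  division by \<open>u + 1\<close>; the Laurent ring has no zero divisors. The bar operator
  presupposes (a), since it uses the action of the inverses of the \<open>T_w\<close>. Its sign is
  forced at \<open>w = s\<close>: applying \<open>T_s^-1\<close> to case (i) for
  \<open>w = 1\<close> gives \<open>(1 + u^-1) T_s^-1 a_s = u^-1 a_1 - T_s^-1 a_1\<close>, the
  negative of \<open>1 + u^-1\<close> times the bar of \<open>a_s\<close>.\<close>

lemma refl_root [simp]: "\<alpha> \<noteq> 0 \<Longrightarrow> refl \<alpha> \<alpha> = - \<alpha>"
  by (simp add: refl_def scaleR_2)

lemma linear_refl: "linear (refl \<alpha>)"
  by (rule linearI) (simp_all add: refl_def inner_add_left inner_scaleR_left algebra_simps add_divide_distrib)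

lemma refl_refl [simp]: "refl \<alpha> (refl \<alpha> x) = x"
  by (cases "\<alpha> = 0") (simp_all add: refl_def inner_diff_left algebra_simps)

lemma refl_comp_refl [simp]: "refl \<alpha> \<circ> refl \<alpha> = id"
  by (simp add: fun_eq_iff)

lemma refl_comp_refl_comp [simp]: "refl \<alpha> \<circ> (refl \<alpha> \<circ> f) = f" "f \<circ> refl \<alpha> \<circ> refl \<alpha> = f"
  by (simp_all add: fun_eq_iff)

lemma comp_refl_eq_iff: "f \<circ> refl \<alpha> = g \<longleftrightarrow> f = g \<circ> refl \<alpha>"
  by auto

lemma bij_refl: "bij (refl \<alpha>)"
  by (rule o_bij[of "refl \<alpha>"]) simp_all

lemma inner_refl_refl [simp]: "refl \<alpha> x \<bullet> refl \<alpha> y = x \<bullet> y"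
  by (cases "\<alpha> = 0") (simp_all add: refl_def inner_diff_left inner_diff_right field_simps inner_commute)

lemma refl_uminus [simp]: "refl (- \<alpha>) = refl \<alpha>"
  by (simp add: refl_def fun_eq_iff)

text \<open>A reflection moves a vector only along its own root, so comparing both maps at
  \<open>\<alpha>\<close> exhibits twice \<open>\<alpha>\<close> as a multiple of
  \<open>\<beta>\<close>.\<close>

lemma refl_eqD:
  assumes "refl \<alpha> = refl \<beta>" "\<alpha> \<noteq> 0"
  shows "\<exists>c. \<alpha> = c *\<^sub>R \<beta>"
proof -
  have "refl \<beta> \<alpha> = - \<alpha>" using assms by (metis refl_root)
  hence "2 *\<^sub>R \<alpha> = (2 * (\<alpha> \<bullet> \<beta>) / (\<beta> \<bullet> \<beta>)) *\<^sub>R \<beta>"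
    by (simp add: refl_def algebra_simps scaleR_2)
  hence "\<alpha> = (\<alpha> \<bullet> \<beta> / (\<beta> \<bullet> \<beta>)) *\<^sub>R \<beta>"
    by (metis (no_types, lifting) scaleR_scaleR scaleR_half_double scaleR_2 times_divide_eq_right scaleR_left_imp_eq zero_neq_numeral)
  thus ?thesis by blast
qed

lemma refl_conj:
  assumes "linear f" "bij f" "\<And>x y. f x \<bullet> f y = x \<bullet> y"
  shows "refl (f \<alpha>) \<circ> f = f \<circ> refl \<alpha>"
  using assms by (simp add: fun_eq_iff refl_def linear_diff linear_scale)

lemma refl_conj_refl: "refl (refl \<alpha> \<beta>) \<circ> refl \<alpha> = refl \<alpha> \<circ> refl \<beta>"
  by (rule refl_conj[OF linear_refl bij_refl inner_refl_refl])

text \<open>The type is left general: products are taken both of reflections and of operators such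
  as \<open>T s\<close> on \<open>M\<close>.\<close>

definition word_prod :: "('a \<Rightarrow> 'a) list \<Rightarrow> 'a \<Rightarrow> 'a" where
  "word_prod ss = foldr (\<circ>) ss id"

lemma word_prod_Nil [simp]: "word_prod [] = id"
  by (simp add: word_prod_def id_def)

lemma word_prod_Cons [simp]: "word_prod (s # ss) = s \<circ> word_prod ss"
  by (simp add: word_prod_def comp_def)

lemma word_prod_append [simp]: "word_prod (xs @ ys) = word_prod xs \<circ> word_prod ys"
  by (induction xs) (simp_all add: o_assoc)

lemma W_induct [consumes 1, case_names one step]:
  assumes "w \<in> weyl_group \<Phi>" and "P id"
    and "\<And>w \<alpha>. w \<in> weyl_group \<Phi> \<Longrightarrow> \<alpha> \<in> \<Phi> \<Longrightarrow> P w \<Longrightarrow> P (refl \<alpha> \<circ> w)"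
  shows "P w"
  using assms by (rule weyl_group.induct)

section \<open>Coordinates along the base and signs of roots\<close>

locale based_root_system =
  fixes \<Phi> \<Delta> :: "'a::euclidean_space set"
  assumes root_system: "root_system \<Phi>" and root_base: "root_base \<Phi> \<Delta>"
begin

abbreviation "W \<equiv> weyl_group \<Phi>"
abbreviation "S \<equiv> simple_refls \<Delta>"
abbreviation "l \<equiv> len \<Delta>"

lemma finite_roots: "finite \<Phi>" and zero_notin: "0 \<notin> \<Phi>"
  using root_system by (auto simp: root_system_def)

lemma refl_in: "\<alpha> \<in> \<Phi> \<Longrightarrow> \<beta> \<in> \<Phi> \<Longrightarrow> refl \<alpha> \<beta> \<in> \<Phi>"
  using root_system unfolding root_system_def by blast

lemma uminus_in [simp]: "- \<alpha> \<in> \<Phi> \<longleftrightarrow> \<alpha> \<in> \<Phi>"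
  by (metis add.inverse_inverse refl_in refl_root zero_notin neg_equal_zero neg_0_equal_iff_equal)

lemma reduced: "\<alpha> \<in> \<Phi> \<Longrightarrow> c *\<^sub>R \<alpha> \<in> \<Phi> \<Longrightarrow> c = 1 \<or> c = - 1"
  using root_system unfolding root_system_def by blast

lemma integral: "\<alpha> \<in> \<Phi> \<Longrightarrow> \<beta> \<in> \<Phi> \<Longrightarrow> 2 * (\<beta> \<bullet> \<alpha>) / (\<alpha> \<bullet> \<alpha>) \<in> \<int>"
  using root_system unfolding root_system_def by blast

lemma base_subset: "\<Delta> \<subseteq> \<Phi>" and base_indep: "independent \<Delta>"
  using root_base by (auto simp: root_base_def)

lemma base_in [simp]: "\<alpha> \<in> \<Delta> \<Longrightarrow> \<alpha> \<in> \<Phi>" using base_subset by blast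

lemma root_nonzero [simp]: "\<alpha> \<in> \<Phi> \<Longrightarrow> \<alpha> \<noteq> 0" using zero_notin by metis

lemma finite_base: "finite \<Delta>" using base_subset finite_roots finite_subset by blast

text \<open>The coordinate along \<open>\<alpha>\<close>, extended to the ambient space, which the base need not span.\<close>
definition cf :: "'a \<Rightarrow> 'a \<Rightarrow> real" where
  "cf \<alpha> = (SOME f. linear f \<and> (\<forall>x\<in>\<Delta>. f x = (if x = \<alpha> then 1 else 0)))"

lemma cf_ex: "linear (cf \<alpha>) \<and> (\<forall>x\<in>\<Delta>. cf \<alpha> x = (if x = \<alpha> then 1 else 0))"
  unfolding cf_def
  by (rule someI_ex[of "\<lambda>f. linear f \<and> (\<forall>x\<in>\<Delta>. f x = (if x = \<alpha> then 1 else 0))"])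
    (rule linear_independent_extend[OF base_indep])

lemma linear_cf: "linear (cf \<alpha>)" using cf_ex by blast

lemma cf_base [simp]: "x \<in> \<Delta> \<Longrightarrow> cf \<alpha> x = (if x = \<alpha> then 1 else 0)" using cf_ex by blast

lemmas cf_simps [simp] = linear_add[OF linear_cf] linear_diff[OF linear_cf] linear_neg[OF linear_cf]
  linear_cmul[OF linear_cf] linear_0[OF linear_cf]

lemma cf_sum: "\<alpha> \<in> \<Delta> \<Longrightarrow> cf \<alpha> (\<Sum>x\<in>\<Delta>. c x *\<^sub>R x) = c \<alpha>"
  using finite_base by (simp add: linear_sum[OF linear_cf] sum.delta if_distrib cong: if_cong)

lemma root_cf: assumes "\<beta> \<in> \<Phi>"
  shows "\<beta> = (\<Sum>\<alpha>\<in>\<Delta>. cf \<alpha> \<beta> *\<^sub>R \<alpha>) \<and> ((\<forall>\<alpha>\<in>\<Delta>. cf \<alpha> \<beta> \<in> \<nat>) \<or> (\<forall>\<alpha>\<in>\<Delta>. - cf \<alpha> \<beta> \<in> \<nat>))"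
proof -
  obtain c :: "'a \<Rightarrow> nat" where
    c: "\<beta> = (\<Sum>\<alpha>\<in>\<Delta>. real (c \<alpha>) *\<^sub>R \<alpha>) \<or> \<beta> = - (\<Sum>\<alpha>\<in>\<Delta>. real (c \<alpha>) *\<^sub>R \<alpha>)"
    using root_base assms unfolding root_base_def by blast
  thus ?thesis
  proof
    assume b: "\<beta> = (\<Sum>\<alpha>\<in>\<Delta>. real (c \<alpha>) *\<^sub>R \<alpha>)"
    have "cf \<alpha> \<beta> = real (c \<alpha>)" if "\<alpha> \<in> \<Delta>" for \<alpha> using b cf_sum[OF that, of "\<lambda>x. real (c x)"] by simp
    thus ?thesis using b by simp
  next
    assume b: "\<beta> = - (\<Sum>\<alpha>\<in>\<Delta>. real (c \<alpha>) *\<^sub>R \<alpha>)"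
    have "cf \<alpha> \<beta> = - real (c \<alpha>)" if "\<alpha> \<in> \<Delta>" for \<alpha> using b cf_sum[OF that, of "\<lambda>x. real (c x)"] by simp
    thus ?thesis using b by (simp add: sum_negf)
  qed
qed

lemma root_expand: "\<beta> \<in> \<Phi> \<Longrightarrow> \<beta> = (\<Sum>\<alpha>\<in>\<Delta>. cf \<alpha> \<beta> *\<^sub>R \<alpha>)"
  using root_cf by blast

definition pos :: "'a \<Rightarrow> bool" where
  "pos \<beta> \<longleftrightarrow> \<beta> \<in> \<Phi> \<and> (\<forall>\<alpha>\<in>\<Delta>. cf \<alpha> \<beta> \<ge> 0)"

lemma pos_in [simp]: "pos \<beta> \<Longrightarrow> \<beta> \<in> \<Phi>" by (simp add: pos_def)

lemma pos_or_neg: "\<beta> \<in> \<Phi> \<Longrightarrow> pos \<beta> \<or> pos (- \<beta>)"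
  using root_cf[of \<beta>] by (force simp: pos_def Nats_def)

lemma pos_uminus: assumes "\<beta> \<in> \<Phi>" shows "pos (- \<beta>) \<longleftrightarrow> \<not> pos \<beta>"
proof -
  have "\<not> (pos \<beta> \<and> pos (- \<beta>))"
  proof
    assume "pos \<beta> \<and> pos (- \<beta>)"
    hence "cf \<alpha> \<beta> = 0" if "\<alpha> \<in> \<Delta>" for \<alpha> using that by (force simp: pos_def)
    hence "\<beta> = 0" using root_expand[OF assms] by (metis (no_types, lifting) scaleR_eq_0_iff sum.neutral)
    thus False using assms zero_notin by simp
  qed
  thus ?thesis using pos_or_neg[OF assms] by blast
qed

lemma pos_cf: "pos \<beta> \<Longrightarrow> \<alpha> \<in> \<Delta> \<Longrightarrow> cf \<alpha> \<beta> \<ge> 0" by (simp add: pos_def)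

lemma pos_if_cf_pos: "\<beta> \<in> \<Phi> \<Longrightarrow> \<alpha> \<in> \<Delta> \<Longrightarrow> cf \<alpha> \<beta> > 0 \<Longrightarrow> pos \<beta>"
  using pos_or_neg[of \<beta>] pos_cf[of "-\<beta>" \<alpha>] by force

lemma pos_base [simp]: "\<alpha> \<in> \<Delta> \<Longrightarrow> pos \<alpha>"
  by (simp add: pos_def)

lemma not_pos_uminus_base [simp]: "\<alpha> \<in> \<Delta> \<Longrightarrow> \<not> pos (- \<alpha>)"
  by (simp add: pos_uminus)

text \<open>Only the coordinate along \<open>\<alpha>\<close> survives, so \<open>\<beta>\<close> is
  a multiple of \<open>\<alpha>\<close>; reducedness leaves two multiples and the sign decides.
  Later this is how roots are recognised as simple.\<close>

lemma simple_unique: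
  assumes "pos \<beta>" "\<alpha> \<in> \<Delta>" "\<And>\<delta>. \<delta> \<in> \<Delta> \<Longrightarrow> \<delta> \<noteq> \<alpha> \<Longrightarrow> cf \<delta> \<beta> = 0"
  shows "\<beta> = \<alpha>"
proof -
  have "\<beta> = (\<Sum>\<delta>\<in>\<Delta>. cf \<delta> \<beta> *\<^sub>R \<delta>)" using assms root_expand by simp
  also have "\<dots> = (\<Sum>\<delta>\<in>\<Delta>. if \<delta> = \<alpha> then cf \<alpha> \<beta> *\<^sub>R \<alpha> else 0)"
    by (rule sum.cong) (use assms in auto)
  also have "\<dots> = cf \<alpha> \<beta> *\<^sub>R \<alpha>" using assms finite_base by simp
  finally have b: "\<beta> = cf \<alpha> \<beta> *\<^sub>R \<alpha>" .
  hence "cf \<alpha> \<beta> = 1 \<or> cf \<alpha> \<beta> = -1" using reduced[of \<alpha>] assms by (metis base_in pos_in)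
  moreover have "cf \<alpha> \<beta> \<ge> 0" using assms pos_cf by blast
  ultimately show ?thesis using b by simp
qed

lemma cf_refl_other: "\<alpha> \<in> \<Delta> \<Longrightarrow> \<delta> \<in> \<Delta> \<Longrightarrow> \<delta> \<noteq> \<alpha> \<Longrightarrow> cf \<delta> (refl \<alpha> \<beta>) = cf \<delta> \<beta>"
  by (simp add: refl_def)

text \<open>A positive root other than \<open>\<alpha>\<close> has a positive coordinate elsewhere,
  which the reflection does not touch, and a single positive coordinate decides the sign of a
  root.\<close>

lemma pos_refl_simple:
  assumes "\<alpha> \<in> \<Delta>" "pos \<beta>" "\<beta> \<noteq> \<alpha>"
  shows "pos (refl \<alpha> \<beta>)"
proof -
  obtain \<delta> where d: "\<delta> \<in> \<Delta>" "\<delta> \<noteq> \<alpha>" "cf \<delta> \<beta> \<noteq> 0" using simple_unique[OF assms(2,1)] assms(3) by blast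
  hence "cf \<delta> (refl \<alpha> \<beta>) > 0" using pos_cf[OF assms(2) d(1)] cf_refl_other assms by auto
  thus ?thesis using pos_if_cf_pos d refl_in assms by simp
qed

lemma pos_refl_simple_iff:
  assumes "\<alpha> \<in> \<Delta>" "\<beta> \<in> \<Phi>" "\<beta> \<noteq> \<alpha>" "\<beta> \<noteq> - \<alpha>"
  shows "pos (refl \<alpha> \<beta>) \<longleftrightarrow> pos \<beta>"
proof
  show "pos (refl \<alpha> \<beta>)" if "pos \<beta>" using pos_refl_simple assms that by blast
next
  assume "pos (refl \<alpha> \<beta>)"
  moreover have "refl \<alpha> \<beta> \<noteq> \<alpha>"
  proof
    assume "refl \<alpha> \<beta> = \<alpha>"
    hence "refl \<alpha> (refl \<alpha> \<beta>) = refl \<alpha> \<alpha>" by simp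
    thus False using assms by simp
  qed
  ultimately show "pos \<beta>" using pos_refl_simple[OF assms(1), of "refl \<alpha> \<beta>"] by simp
qed

lemma refl_simple_inj: "\<alpha> \<in> \<Delta> \<Longrightarrow> \<beta> \<in> \<Delta> \<Longrightarrow> refl \<alpha> = refl \<beta> \<Longrightarrow> \<alpha> = \<beta>"
proof (rule simple_unique[of \<alpha> \<beta>])
  fix \<delta> assume *: "\<alpha> \<in> \<Delta>" "\<beta> \<in> \<Delta>" "refl \<alpha> = refl \<beta>" "\<delta> \<in> \<Delta>" "\<delta> \<noteq> \<beta>"
  then obtain c where "\<alpha> = c *\<^sub>R \<beta>" using refl_eqD[of \<alpha> \<beta>] by auto
  hence "cf \<delta> \<alpha> = c * cf \<delta> \<beta>" by simp
  thus "cf \<delta> \<alpha> = 0" using * by simp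
qed auto

section \<open>The Weyl group as a group of isometries permuting the roots\<close>

lemma refl_in_W: "\<alpha> \<in> \<Phi> \<Longrightarrow> refl \<alpha> \<in> W"
  using weyl_group.step[OF weyl_group.one] by fastforce

lemma comp_in_W: "v \<in> W \<Longrightarrow> w \<in> W \<Longrightarrow> v \<circ> w \<in> W"
  by (induction v rule: W_induct) (auto simp: o_assoc[symmetric] intro: weyl_group.intros)

lemma W_isom: assumes "w \<in> W"
  shows "linear w" "bij w" "w x \<bullet> w y = x \<bullet> y" "w ` \<Phi> = \<Phi>"
  using assms
proof (induction w arbitrary: x y rule: W_induct)
  case one
  { case 1 show "linear (id :: 'a \<Rightarrow> 'a)" by (simp add: linear_iff)
    next case 2 show "bij (id :: 'a \<Rightarrow> 'a)" by simp
    next case 3 show "id x \<bullet> id y = x \<bullet> y" by simp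
    next case 4 show "id ` \<Phi> = \<Phi>" by simp }
next
  case (step w \<alpha>)
  { case 1 thus ?case using step linear_refl linear_compose by blast
    next case 2 thus ?case using step bij_refl bij_comp by blast
    next case 3 thus ?case using step by simp
    next case 4
      have "refl \<alpha> ` \<Phi> = \<Phi>" using root_system step unfolding root_system_def by blast
      thus ?case using step by (metis image_comp) }
qed

lemma W_root [simp]: "w \<in> W \<Longrightarrow> w \<beta> \<in> \<Phi> \<longleftrightarrow> \<beta> \<in> \<Phi>"
  using W_isom(2,4) by (metis bij_is_inj image_iff inj_image_mem_iff)

lemma W_uminus: "w \<in> W \<Longrightarrow> w (- \<beta>) = - w \<beta>"
  using W_isom(1) linear_neg by blast

lemma inv_in_W: "w \<in> W \<Longrightarrow> inv w \<in> W"
proof (induction w rule: W_induct)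
  case (step w \<alpha>)
  have "inv (refl \<alpha> \<circ> w) = inv w \<circ> refl \<alpha>"
    using step W_isom(2) bij_refl by (metis o_inv_distrib inv_unique_comp refl_comp_refl)
  thus "inv (refl \<alpha> \<circ> w) \<in> W" using step comp_in_W refl_in_W by simp
next
  case one show "inv id \<in> W" by (simp add: weyl_group.one)
qed

lemma W_inv [simp]: assumes "w \<in> W"
  shows "inv w (w x) = x" "w (inv w x) = x" "inv w \<circ> w = id" "w \<circ> inv w = id"
    "inv w \<circ> (w \<circ> f) = f" "w \<circ> (inv w \<circ> f) = f" "inv (inv w) = w"
  using W_isom(2)[OF assms] by (auto simp: bij_is_inj bij_is_surj surj_f_inv_f inv_inv_eq fun_eq_iff)

lemma inv_comp_W: "v \<in> W \<Longrightarrow> w \<in> W \<Longrightarrow> inv (v \<circ> w) = inv w \<circ> inv v"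
  using W_isom(2) o_inv_distrib by blast

lemma inv_refl [simp]: "inv (refl \<alpha>) = refl \<alpha>"
  by (rule inv_unique_comp) simp_all

lemma refl_W_conj: "w \<in> W \<Longrightarrow> refl (w \<alpha>) \<circ> w = w \<circ> refl \<alpha>"
  using refl_conj W_isom by blast

lemma simple_in_W: "s \<in> S \<Longrightarrow> s \<in> W"
  using refl_in_W by (auto simp: simple_refls_def)

lemma prod_in_W: "set ss \<subseteq> S \<Longrightarrow> word_prod ss \<in> W"
  by (induction ss) (auto intro: comp_in_W simple_in_W weyl_group.one)

lemma inv_prod: "set ss \<subseteq> S \<Longrightarrow> inv (word_prod ss) = word_prod (rev ss)"
proof (induction ss)
  case (Cons s ss)
  hence "inv (word_prod (s # ss)) = inv (word_prod ss) \<circ> inv s"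
    using inv_comp_W[of s] simple_in_W prod_in_W by simp
  moreover have "inv s = s" using Cons by (auto simp: simple_refls_def)
  ultimately show "inv (word_prod (s # ss)) = word_prod (rev (s # ss))" using Cons by simp
qed simp

text \<open>Induction on the height: reflecting at a simple root with positive inner product lowers it.\<close>
lemma refl_pos_is_prod:
  assumes "pos \<beta>"
  shows "\<exists>ss. set ss \<subseteq> S \<and> refl \<beta> = word_prod ss"
proof -
  define ht where "ht = (\<lambda>\<beta>. nat \<lfloor>\<Sum>\<alpha>\<in>\<Delta>. cf \<alpha> \<beta>\<rfloor>)"
  show ?thesis using assms
  proof (induction "ht \<beta>" arbitrary: \<beta> rule: less_induct)
    case less
    show ?case
    proof (cases "\<beta> \<in> \<Delta>")
      case True
      thus ?thesis by (intro exI[of _ "[refl \<beta>]"]) (auto simp: simple_refls_def)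
    next
      case False
      have b: "\<beta> \<in> \<Phi>" using less by simp
      have "0 < \<beta> \<bullet> \<beta>" using b by simp
      also have "\<beta> \<bullet> \<beta> = \<beta> \<bullet> (\<Sum>\<alpha>\<in>\<Delta>. cf \<alpha> \<beta> *\<^sub>R \<alpha>)"
        using root_expand[OF b] by simp
      also have "\<dots> = (\<Sum>\<alpha>\<in>\<Delta>. cf \<alpha> \<beta> * (\<beta> \<bullet> \<alpha>))" by (simp add: inner_sum_right)
      finally obtain \<alpha> where a: "\<alpha> \<in> \<Delta>" "cf \<alpha> \<beta> * (\<beta> \<bullet> \<alpha>) > 0"
        by (meson linorder_not_less sum_nonpos)
      hence ip: "\<beta> \<bullet> \<alpha> > 0" using pos_cf[OF less.prems a(1)] by (simp add: zero_less_mult_iff)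
      define n where "n = 2 * (\<beta> \<bullet> \<alpha>) / (\<alpha> \<bullet> \<alpha>)"
      have "n \<in> \<int>" "n > 0" using integral a b ip by (auto simp: n_def)
      \<comment> \<open>Integrality raises a positive coefficient to at least 1, which is what makes
        the rounded sum \<open>ht\<close> drop.\<close>
      hence n1: "n \<ge> 1" by (auto elim!: Ints_cases)
      have r: "refl \<alpha> \<beta> = \<beta> - n *\<^sub>R \<alpha>" by (simp add: refl_def n_def)
      have p: "pos (refl \<alpha> \<beta>)" using pos_refl_simple a less False by metis
      have nn: "(\<Sum>\<delta>\<in>\<Delta>. cf \<delta> \<gamma>) \<ge> 0" if "pos \<gamma>" for \<gamma> using pos_cf[OF that] by (simp add: sum_nonneg)
      have "(\<Sum>\<delta>\<in>\<Delta>. cf \<delta> (refl \<alpha> \<beta>)) = (\<Sum>\<delta>\<in>\<Delta>. cf \<delta> \<beta>) - n * (\<Sum>\<delta>\<in>\<Delta>. cf \<delta> \<alpha>)"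
        by (simp add: r sum_subtractf sum_distrib_left)
      moreover have "(\<Sum>\<delta>\<in>\<Delta>. cf \<delta> \<alpha>) = 1" using a finite_base by simp
      ultimately have "(\<Sum>\<delta>\<in>\<Delta>. cf \<delta> (refl \<alpha> \<beta>)) \<le> (\<Sum>\<delta>\<in>\<Delta>. cf \<delta> \<beta>) - 1" using n1 by simp
      hence "ht (refl \<alpha> \<beta>) < ht \<beta>" using nn[OF p] unfolding ht_def by linarith
      then obtain ss where ss: "set ss \<subseteq> S" "refl (refl \<alpha> \<beta>) = word_prod ss" using less p by blast
      have "refl \<beta> = refl \<alpha> \<circ> refl (refl \<alpha> \<beta>) \<circ> refl \<alpha>"
        by (metis o_assoc refl_comp_refl_comp refl_conj_refl)
      hence "refl \<beta> = word_prod ([refl \<alpha>] @ ss @ [refl \<alpha>])"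
        using ss by (simp add: o_assoc)
      thus ?thesis using ss a by (intro exI[of _ "[refl \<alpha>] @ ss @ [refl \<alpha>]"]) (auto simp: simple_refls_def)
    qed
  qed
qed

lemma W_is_prod: "w \<in> W \<Longrightarrow> \<exists>ss. set ss \<subseteq> S \<and> w = word_prod ss"
proof (induction w rule: W_induct)
  case one thus ?case by (intro exI[of _ "[]"]) simp
next
  case (step w \<alpha>)
  obtain ts where "set ts \<subseteq> S" "refl \<alpha> = word_prod ts"
    using refl_pos_is_prod[of \<alpha>] refl_pos_is_prod[of "-\<alpha>"] pos_or_neg[OF step(2)] by auto
  moreover obtain ss where "set ss \<subseteq> S" "w = word_prod ss" using step by blast
  ultimately show ?case by (intro exI[of _ "ts @ ss"]) simp
qed

section \<open>Lengths, exchange and descents\<close>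

definition reduced_word :: "('a \<Rightarrow> 'a) list \<Rightarrow> bool" where
  "reduced_word ss \<longleftrightarrow> set ss \<subseteq> S \<and> length ss = l (word_prod ss)"

lemma len_word_prod: "l w = (LEAST n. \<exists>ss. set ss \<subseteq> S \<and> length ss = n \<and> w = word_prod ss)"
  by (simp add: len_def word_prod_def)

lemma len_le: "set ss \<subseteq> S \<Longrightarrow> l (word_prod ss) \<le> length ss"
  unfolding len_word_prod by (rule Least_le) blast

lemma reduced_word_ex: assumes "w \<in> W" shows "\<exists>ss. reduced_word ss \<and> w = word_prod ss"
proof -
  let ?P = "\<lambda>n. \<exists>ss. set ss \<subseteq> S \<and> length ss = n \<and> w = word_prod ss"
  have "\<exists>n. ?P n" using W_is_prod[OF assms] by blast
  hence "?P (l w)" unfolding len_word_prod by (rule LeastI_ex)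
  thus ?thesis unfolding reduced_word_def by metis
qed

lemma len_id [simp]: "l id = 0" using len_le[of "[]"] by simp

lemma len_inv: assumes "w \<in> W" shows "l (inv w) = l w"
proof -
  have le: "l (inv w) \<le> l w" if "w \<in> W" for w
  proof -
    obtain ss where "reduced_word ss" "w = word_prod ss" using reduced_word_ex \<open>w \<in> W\<close> by metis
    thus ?thesis using inv_prod[of ss] len_le[of "rev ss"] by (simp add: reduced_word_def)
  qed
  show ?thesis using le[OF assms] le[OF inv_in_W[OF assms]] assms by simp
qed

lemma len_comp_le: assumes "v \<in> W" "w \<in> W" shows "l (v \<circ> w) \<le> l v + l w"
proof -
  obtain ss ts where "reduced_word ss" "v = word_prod ss" "reduced_word ts" "w = word_prod ts"
    using reduced_word_ex assms by meson
  thus ?thesis using len_le[of "ss @ ts"] by (auto simp: reduced_word_def)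
qed

lemma len_simple_le: "s \<in> S \<Longrightarrow> l s \<le> 1"
  using len_le[of "[s]"] by simp

text \<open>The strong exchange property: the letter at which the root turns negative can be deleted.\<close>
lemma exchange_word:
  assumes "set ss \<subseteq> S" "pos \<gamma>" "\<not> pos (word_prod (rev ss) \<gamma>)"
  shows "\<exists>ts. set ts \<subseteq> S \<and> length ts < length ss \<and> refl \<gamma> \<circ> word_prod ss = word_prod ts"
  using assms
proof (induction ss arbitrary: \<gamma>)
  case (Cons s ss)
  then obtain \<alpha> where a: "\<alpha> \<in> \<Delta>" "s = refl \<alpha>" by (auto simp: simple_refls_def)
  show ?case
  proof (cases "\<gamma> = \<alpha>")
    case True
    thus ?thesis using Cons a by (intro exI[of _ ss]) simp
  next
    case False
    hence p: "pos (refl \<alpha> \<gamma>)" using pos_refl_simple a Cons by blast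
    have "\<not> pos (word_prod (rev ss) (refl \<alpha> \<gamma>))"
      using Cons.prems(3) a by simp
    then obtain ts where ts: "set ts \<subseteq> S" "length ts < length ss"
      "refl (refl \<alpha> \<gamma>) \<circ> word_prod ss = word_prod ts"
      using Cons.IH[OF _ p] Cons.prems by (metis set_subset_Cons order_trans)
    have "refl \<gamma> \<circ> refl \<alpha> = refl \<alpha> \<circ> refl (refl \<alpha> \<gamma>)"
      using refl_conj_refl[of \<alpha> "refl \<alpha> \<gamma>"] by simp
    hence "refl \<gamma> \<circ> word_prod (s # ss) = word_prod (s # ts)"
      using a ts(3) by (simp add: o_assoc) (simp add: o_assoc[symmetric])
    moreover have "set (s # ts) \<subseteq> S" "length (s # ts) < length (s # ss)" using ts Cons.prems by auto
    ultimately show ?thesis by metis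
  qed
qed simp

lemma len_refl_less:
  assumes "w \<in> W" "pos \<gamma>" "\<not> pos (inv w \<gamma>)"
  shows "l (refl \<gamma> \<circ> w) < l w"
proof -
  obtain ss where ss: "reduced_word ss" "w = word_prod ss" using reduced_word_ex assms by metis
  thus ?thesis
    using exchange_word[of ss \<gamma>] inv_prod[of ss] assms len_le unfolding reduced_word_def by fastforce
qed

text \<open>The direction not covered by \<open>len_refl_less\<close> is the same lemma for
  \<open>refl \<gamma> \<circ> w\<close>, whose inverse sends \<open>\<gamma>\<close> to the
  negative of its former image.\<close>

lemma len_refl_iff:
  assumes "w \<in> W" "pos \<gamma>"
  shows "l w < l (refl \<gamma> \<circ> w) \<longleftrightarrow> pos (inv w \<gamma>)"
proof -
  have "l w < l (refl \<gamma> \<circ> w)" if p: "pos (inv w \<gamma>)"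
  proof -
    have rw: "refl \<gamma> \<circ> w \<in> W" using assms comp_in_W refl_in_W by simp
    have "inv (refl \<gamma> \<circ> w) \<gamma> = - inv w \<gamma>"
      using assms inv_comp_W refl_in_W W_uminus inv_in_W by simp
    hence "\<not> pos (inv (refl \<gamma> \<circ> w) \<gamma>)" using p pos_uminus[of "inv w \<gamma>"] by simp
    thus ?thesis using len_refl_less[OF rw assms(2)] by simp
  qed
  thus ?thesis using len_refl_less[OF assms] by force
qed

text \<open>The exchange property gives the sign of the change, subadditivity its size. The second
  claim guards the truncated subtraction in the first.\<close>

lemma len_simple:
  assumes "w \<in> W" "\<alpha> \<in> \<Delta>"
  shows "l (refl \<alpha> \<circ> w) = (if pos (inv w \<alpha>) then l w + 1 else l w - 1)"
    "\<not> pos (inv w \<alpha>) \<Longrightarrow> l w > 0"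
proof -
  have s: "refl \<alpha> \<in> S" "refl \<alpha> \<in> W" using assms refl_in_W by (auto simp: simple_refls_def)
  have le: "l (refl \<alpha> \<circ> v) \<le> l v + 1" if "v \<in> W" for v
    using len_comp_le[OF s(2) that] len_simple_le[OF s(1)] by simp
  have "l w \<le> l (refl \<alpha> \<circ> w) + 1" using le[of "refl \<alpha> \<circ> w"] assms s comp_in_W by simp
  thus "l (refl \<alpha> \<circ> w) = (if pos (inv w \<alpha>) then l w + 1 else l w - 1)"
    using len_refl_iff[OF assms(1), of \<alpha>] len_refl_less[OF assms(1), of \<alpha>] le[OF assms(1)] assms
    by (cases "pos (inv w \<alpha>)") auto
  show "\<not> pos (inv w \<alpha>) \<Longrightarrow> l w > 0" using len_refl_less[OF assms(1), of \<alpha>] assms by force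
qed

lemma len_simple_right:
  assumes "w \<in> W" "\<alpha> \<in> \<Delta>"
  shows "l (w \<circ> refl \<alpha>) = (if pos (w \<alpha>) then l w + 1 else l w - 1)"
    "\<not> pos (w \<alpha>) \<Longrightarrow> l w > 0"
proof -
  have r: "refl \<alpha> \<in> W" using assms refl_in_W by simp
  have "l (w \<circ> refl \<alpha>) = l (refl \<alpha> \<circ> inv w)"
    using len_inv[of "w \<circ> refl \<alpha>"] comp_in_W inv_comp_W r assms by simp
  thus "l (w \<circ> refl \<alpha>) = (if pos (w \<alpha>) then l w + 1 else l w - 1)" "\<not> pos (w \<alpha>) \<Longrightarrow> l w > 0"
    using len_simple[OF inv_in_W[OF assms(1)] assms(2)] assms len_inv by simp_all
qed

lemma simple_refls_E: assumes "s \<in> S" obtains \<alpha> where "\<alpha> \<in> \<Delta>" "s = refl \<alpha>"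
  using assms by (auto simp: simple_refls_def)

text \<open>The last letter of a nonempty reduced word shortens the element from the right, and so
  sends a simple root to a negative one.\<close>

lemma W_eq_id:
  assumes "w \<in> W" "\<And>\<alpha>. \<alpha> \<in> \<Delta> \<Longrightarrow> pos (w \<alpha>)"
  shows "w = id"
proof (rule ccontr)
  assume "w \<noteq> id"
  obtain ss where ss: "reduced_word ss" "w = word_prod ss" using reduced_word_ex assms by metis
  with \<open>w \<noteq> id\<close> obtain ts s where ts: "ss = ts @ [s]" by (cases ss rule: rev_cases) auto
  then obtain \<alpha> where a: "\<alpha> \<in> \<Delta>" "s = refl \<alpha>" using ss by (auto simp: reduced_word_def elim: simple_refls_E)
  have "w \<circ> refl \<alpha> = word_prod ts"
    using ss ts a by (auto simp: comp_refl_eq_iff)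
  hence "l (w \<circ> refl \<alpha>) \<le> length ts" using len_le[of ts] ss ts by (simp add: reduced_word_def)
  thus False using len_simple_right[OF assms(1) a(1)] assms(2)[OF a(1)] ss ts by (simp add: reduced_word_def)
qed

text \<open>An element is determined by its values on the roots. Linearity alone would not show
  this, since the roots need not span the space; \<open>W_eq_id\<close> does.\<close>

lemma finite_W: "finite W"
proof -
  have "inj_on (\<lambda>w. restrict w \<Phi>) W"
  proof (rule inj_onI)
    fix v w assume vw: "v \<in> W" "w \<in> W" "restrict v \<Phi> = restrict w \<Phi>"
    hence "v \<alpha> = w \<alpha>" if "\<alpha> \<in> \<Delta>" for \<alpha> using that by (metis base_in restrict_apply')
    hence "inv v \<circ> w = id"
      using vw by (intro W_eq_id) (simp_all add: comp_in_W inv_in_W flip: \<open>\<And>\<alpha>. \<alpha> \<in> \<Delta> \<Longrightarrow> v \<alpha> = w \<alpha>\<close>)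
    thus "v = w" using vw W_inv(6)[of v w] by simp
  qed
  moreover have "(\<lambda>w. restrict w \<Phi>) ` W \<subseteq> \<Phi> \<rightarrow>\<^sub>E \<Phi>" by auto
  ultimately show ?thesis using finite_roots finite_PiE by (metis finite_subset finite_imageD)
qed

text \<open>Proper chains of steps increase the length, so the comparison that selects the cases of
  \<open>Ts_plus_one_basis\<close> reduces to the sign of one root.\<close>

lemma bruhat_less_left:
  assumes "w \<in> W" "\<alpha> \<in> \<Delta>"
  shows "bruhat_less \<Phi> \<Delta> w (refl \<alpha> \<circ> w) \<longleftrightarrow> pos (inv w \<alpha>)"
proof -
  have le: "y = z \<or> l y < l z" if "bruhat_le \<Phi> \<Delta> y z" for y z
    using that unfolding bruhat_le_def by (induction rule: rtranclp_induct) (auto simp: bruhat_step_def)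
  show ?thesis
  proof
    assume "bruhat_less \<Phi> \<Delta> w (refl \<alpha> \<circ> w)"
    thus "pos (inv w \<alpha>)" using le len_refl_iff[OF assms(1), of \<alpha>] assms(2) by (auto simp: bruhat_less_def)
  next
    assume "pos (inv w \<alpha>)"
    hence "l w < l (refl \<alpha> \<circ> w)" using len_refl_iff assms by simp
    thus "bruhat_less \<Phi> \<Delta> w (refl \<alpha> \<circ> w)"
      using assms unfolding bruhat_less_def bruhat_le_def
      by (auto simp: bruhat_step_def intro!: r_into_rtranclp bexI[of _ \<alpha>])
  qed
qed

text \<open>Steps multiply on the left only, so \<open>w \<circ> refl \<alpha>\<close> is rewritten
  as \<open>refl (w \<alpha>) \<circ> w\<close>, a step at a root that need not be simple.\<close>

lemma bruhat_less_right:
  assumes "w \<in> W" "\<alpha> \<in> \<Delta>"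
  shows "bruhat_less \<Phi> \<Delta> w (w \<circ> refl \<alpha>) \<longleftrightarrow> pos (w \<alpha>)"
proof -
  have le: "y = z \<or> l y < l z" if "bruhat_le \<Phi> \<Delta> y z" for y z
    using that unfolding bruhat_le_def by (induction rule: rtranclp_induct) (auto simp: bruhat_step_def)
  have c: "w \<circ> refl \<alpha> = refl (w \<alpha>) \<circ> w" using refl_W_conj assms by simp
  show ?thesis
  proof
    assume "bruhat_less \<Phi> \<Delta> w (w \<circ> refl \<alpha>)"
    thus "pos (w \<alpha>)" using le[of w "w \<circ> refl \<alpha>"] len_simple_right[OF assms]
      by (auto simp: bruhat_less_def split: if_splits)
  next
    assume "pos (w \<alpha>)"
    hence "l w < l (w \<circ> refl \<alpha>)" using len_simple_right assms by simp
    thus "bruhat_less \<Phi> \<Delta> w (w \<circ> refl \<alpha>)"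
      using assms unfolding bruhat_less_def bruhat_le_def
      by (auto simp: bruhat_step_def c intro!: r_into_rtranclp bexI[of _ "w \<alpha>"])
  qed
qed

end


section \<open>Rank two subsystems and reduced words\<close>

text \<open>Anchored at the right end: \<open>f\<close> is applied first, and further factors act on
  a vector already computed. The variant \<open>altl\<close> is anchored at the left end, which
  suits words and inverses.\<close>

primrec alt :: "('b \<Rightarrow> 'b) \<Rightarrow> ('b \<Rightarrow> 'b) \<Rightarrow> nat \<Rightarrow> 'b \<Rightarrow> 'b" where
  "alt f g 0 = id"
| "alt f g (Suc k) = alt g f k \<circ> f"

primrec altl :: "('b \<Rightarrow> 'b) \<Rightarrow> ('b \<Rightarrow> 'b) \<Rightarrow> nat \<Rightarrow> 'b \<Rightarrow> 'b" where
  "altl f g 0 = id"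
| "altl f g (Suc k) = f \<circ> altl g f k"

text \<open>The right end of \<open>alt f g k\<close> is \<open>f\<close> and the left end of
  \<open>altl g f j\<close> is \<open>g\<close>, so the alternation continues across the seam; the
  parity of \<open>k\<close> tells which factor ends up leftmost.\<close>

lemma alt_altl: "alt f g k \<circ> altl g f j = (if even k then altl g f (k + j) else altl f g (k + j))"
proof (induction k arbitrary: f g j)
  case (Suc k)
  have ih: "alt g f k \<circ> altl f g (Suc j)
      = (if even k then altl f g (k + Suc j) else altl g f (k + Suc j))" by (rule Suc)
  have "alt f g (Suc k) \<circ> altl g f j = alt g f k \<circ> altl f g (Suc j)" by (simp add: o_assoc)
  thus "alt f g (Suc k) \<circ> altl g f j
      = (if even (Suc k) then altl g f (Suc k + j) else altl f g (Suc k + j))"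
    using ih by (simp del: altl.simps)
qed simp

lemma alt_eq_altl: "alt f g k = (if even k then altl g f k else altl f g k)"
  using alt_altl[of f g k 0] by simp

lemma altl_eq_alt: "altl f g k = (if even k then alt g f k else alt f g k)"
  by (simp add: alt_eq_altl)

lemma alt_Suc_left: "alt f g (Suc k) = (if even k then f else g) \<circ> alt f g k"
  unfolding alt_eq_altl by (cases k) simp_all

lemma altl_alt_inverse:
  assumes "\<And>x. f (f x) = x" "\<And>x. g (g x) = x"
  shows "altl f g k (alt f g k x) = x" "alt f g k (altl f g k x) = x"
  using assms
proof (induction k arbitrary: f g x)
  case (Suc k)
  {
    case 1 thus ?case using Suc(1)[of g f "f x"] by simp
  next
    case 2 thus ?case using Suc(2)[of g f x] by simp
  }
qed simp_all

fun altw :: "'b \<Rightarrow> 'b \<Rightarrow> nat \<Rightarrow> 'b list" where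
  "altw s t 0 = []"
| "altw s t (Suc k) = s # altw t s k"

lemma length_altw [simp]: "length (altw s t k) = k"
  by (induction s t k rule: altw.induct) simp_all

lemma set_altw: "set (altw s t k) \<subseteq> {s, t}"
  by (induction s t k rule: altw.induct) auto

lemma word_prod_altw: "word_prod (map F (altw s t k)) = altl (F s) (F t) k"
  by (induction s t k rule: altw.induct) simp_all

lemma word_prod_altw_id: "word_prod (altw s t k) = altl s t k"
  using word_prod_altw[of id s t k] by simp

context based_root_system
begin

abbreviation inv_alt :: "'a \<Rightarrow> 'a \<Rightarrow> nat \<Rightarrow> 'a \<Rightarrow> 'a" where
  "inv_alt \<alpha> \<beta> k \<equiv> altl (refl \<alpha>) (refl \<beta>) k"

abbreviation x_alt :: "'a \<Rightarrow> 'a \<Rightarrow> nat \<Rightarrow> 'a \<Rightarrow> 'a" where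
  "x_alt \<alpha> \<beta> k \<equiv> alt (refl \<alpha>) (refl \<beta>) k"

lemma altl_in_W [simp]: "\<alpha> \<in> \<Phi> \<Longrightarrow> \<beta> \<in> \<Phi> \<Longrightarrow> inv_alt \<alpha> \<beta> k \<in> W"
  by (induction k arbitrary: \<alpha> \<beta>) (auto simp del: o_apply id_apply intro!: comp_in_W refl_in_W weyl_group.one)

lemma alt_in_W [simp]: "\<alpha> \<in> \<Phi> \<Longrightarrow> \<beta> \<in> \<Phi> \<Longrightarrow> x_alt \<alpha> \<beta> k \<in> W"
  by (simp add: alt_eq_altl)

lemma inv_x_alt [simp]: "inv (x_alt \<alpha> \<beta> k) = inv_alt \<alpha> \<beta> k"
  by (rule inv_unique_comp) (simp_all add: fun_eq_iff altl_alt_inverse)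

lemma inv_inv_alt [simp]: "inv (inv_alt \<alpha> \<beta> k) = x_alt \<alpha> \<beta> k"
  by (rule inv_unique_comp) (simp_all add: fun_eq_iff altl_alt_inverse)

section \<open>Rank two subsystems of roots\<close>

definition rank2_pos :: "'a \<Rightarrow> 'a \<Rightarrow> 'a set" where
  "rank2_pos \<alpha> \<beta> = {\<gamma>. pos \<gamma> \<and> (\<forall>\<delta>\<in>\<Delta> - {\<alpha>, \<beta>}. cf \<delta> \<gamma> = 0)}"

text \<open>A convenient substitute for the parabolic subgroup generated by the two reflections.\<close>
definition rank2_group :: "'a \<Rightarrow> 'a \<Rightarrow> ('a \<Rightarrow> 'a) set" where
  "rank2_group \<alpha> \<beta> = {w \<in> W. \<forall>\<gamma>. \<forall>\<delta>\<in>\<Delta> - {\<alpha>, \<beta>}. cf \<delta> (w \<gamma>) = cf \<delta> \<gamma>}"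

lemma rank2_pos_commute: "rank2_pos \<alpha> \<beta> = rank2_pos \<beta> \<alpha>" by (simp add: rank2_pos_def insert_commute)

lemma rank2_group_commute: "rank2_group \<alpha> \<beta> = rank2_group \<beta> \<alpha>" by (simp add: rank2_group_def insert_commute)

lemma rank2_pos_pos: "\<gamma> \<in> rank2_pos \<alpha> \<beta> \<Longrightarrow> pos \<gamma>" by (simp add: rank2_pos_def)

lemma rank2_pos_base: "\<alpha> \<in> \<Delta> \<Longrightarrow> \<alpha> \<in> rank2_pos \<alpha> \<beta>" "\<beta> \<in> \<Delta> \<Longrightarrow> \<beta> \<in> rank2_pos \<alpha> \<beta>"
  by (auto simp: rank2_pos_def)

lemma rank2_group_comp: "v \<in> rank2_group \<alpha> \<beta> \<Longrightarrow> w \<in> rank2_group \<alpha> \<beta> \<Longrightarrow> v \<circ> w \<in> rank2_group \<alpha> \<beta>"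
  by (simp add: rank2_group_def comp_in_W)

lemma rank2_group_refl: "\<alpha> \<in> \<Delta> \<Longrightarrow> refl \<alpha> \<in> rank2_group \<alpha> \<beta>" "\<beta> \<in> \<Delta> \<Longrightarrow> refl \<beta> \<in> rank2_group \<alpha> \<beta>"
  by (auto simp: rank2_group_def refl_in_W cf_refl_other)

lemma rank2_group_id: "id \<in> rank2_group \<alpha> \<beta>" by (simp add: rank2_group_def weyl_group.one)

lemma rank2_group_altl: "\<alpha> \<in> \<Delta> \<Longrightarrow> \<beta> \<in> \<Delta> \<Longrightarrow> inv_alt \<alpha> \<beta> k \<in> rank2_group \<alpha> \<beta>"
proof (induction k arbitrary: \<alpha> \<beta>)
  case 0 thus ?case using rank2_group_id by (simp only: altl.simps)
next
  case (Suc k)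
  thus ?case unfolding altl.simps using rank2_group_comp rank2_group_refl(1) rank2_group_commute by metis
qed

lemma rank2_group_alt: "\<alpha> \<in> \<Delta> \<Longrightarrow> \<beta> \<in> \<Delta> \<Longrightarrow> x_alt \<alpha> \<beta> k \<in> rank2_group \<alpha> \<beta>"
  using rank2_group_altl rank2_group_commute by (metis alt_eq_altl)

lemma rank2_group_in_W: "w \<in> rank2_group \<alpha> \<beta> \<Longrightarrow> w \<in> W" by (simp add: rank2_group_def)

lemma rank2_pos_expand:
  assumes "\<gamma> \<in> \<Phi>" "\<forall>\<delta>\<in>\<Delta> - {\<alpha>, \<beta>}. cf \<delta> \<gamma> = 0" "\<alpha> \<in> \<Delta>" "\<beta> \<in> \<Delta>" "\<alpha> \<noteq> \<beta>"
  shows "\<gamma> = cf \<alpha> \<gamma> *\<^sub>R \<alpha> + cf \<beta> \<gamma> *\<^sub>R \<beta>"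
proof -
  have "\<gamma> = (\<Sum>\<delta>\<in>\<Delta>. cf \<delta> \<gamma> *\<^sub>R \<delta>)" using root_expand assms by simp
  also have "\<dots> = (\<Sum>\<delta>\<in>{\<alpha>, \<beta>}. cf \<delta> \<gamma> *\<^sub>R \<delta>)"
    by (rule sum.mono_neutral_right) (use assms finite_base in auto)
  finally show ?thesis using assms by simp
qed

lemma rank2_pos_W_image:
  assumes "\<gamma> \<in> rank2_pos \<alpha> \<beta>" "w \<in> W" "\<alpha> \<in> \<Delta>" "\<beta> \<in> \<Delta>" "\<alpha> \<noteq> \<beta>"
  shows "w \<gamma> = cf \<alpha> \<gamma> *\<^sub>R w \<alpha> + cf \<beta> \<gamma> *\<^sub>R w \<beta>" "cf \<alpha> \<gamma> \<ge> 0" "cf \<beta> \<gamma> \<ge> 0"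
proof -
  have "\<gamma> = cf \<alpha> \<gamma> *\<^sub>R \<alpha> + cf \<beta> \<gamma> *\<^sub>R \<beta>" using assms by (intro rank2_pos_expand) (auto simp: rank2_pos_def)
  hence "w \<gamma> = w (cf \<alpha> \<gamma> *\<^sub>R \<alpha> + cf \<beta> \<gamma> *\<^sub>R \<beta>)" by simp
  thus "w \<gamma> = cf \<alpha> \<gamma> *\<^sub>R w \<alpha> + cf \<beta> \<gamma> *\<^sub>R w \<beta>"
    using W_isom(1)[OF assms(2)] by (simp add: linear_add linear_cmul)
  show "cf \<alpha> \<gamma> \<ge> 0" "cf \<beta> \<gamma> \<ge> 0" using assms pos_cf rank2_pos_pos by auto
qed

lemma rank2_pos_pos_image:
  assumes "\<gamma> \<in> rank2_pos \<alpha> \<beta>" "w \<in> W" "\<alpha> \<in> \<Delta>" "\<beta> \<in> \<Delta>" "\<alpha> \<noteq> \<beta>" "pos (w \<alpha>)" "pos (w \<beta>)"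
  shows "pos (w \<gamma>)"
proof -
  have "w \<gamma> \<in> \<Phi>" using assms rank2_pos_pos by simp
  thus ?thesis using rank2_pos_W_image[OF assms(1-5)] assms(6,7) unfolding pos_def by simp
qed

lemma rank2_pos_neg_image:
  assumes "\<gamma> \<in> rank2_pos \<alpha> \<beta>" "w \<in> W" "\<alpha> \<in> \<Delta>" "\<beta> \<in> \<Delta>" "\<alpha> \<noteq> \<beta>" "\<not> pos (w \<alpha>)" "\<not> pos (w \<beta>)"
  shows "\<not> pos (w \<gamma>)"
proof -
  have p: "pos (- w \<alpha>)" "pos (- w \<beta>)" using assms pos_uminus by simp_all
  have "cf \<delta> (- w \<gamma>) \<ge> 0" if "\<delta> \<in> \<Delta>" for \<delta>
    using rank2_pos_W_image(1)[OF assms(1-5)] pos_cf[OF p(1) that] pos_cf[OF p(2) that]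
      mult_nonneg_nonneg[OF rank2_pos_W_image(2)[OF assms(1-5)], of "- cf \<delta> (w \<alpha>)"]
      mult_nonneg_nonneg[OF rank2_pos_W_image(3)[OF assms(1-5)], of "- cf \<delta> (w \<beta>)"]
    by simp
  moreover have "- w \<gamma> \<in> \<Phi>" using assms rank2_pos_pos by simp
  ultimately have "pos (- w \<gamma>)" unfolding pos_def by blast
  thus ?thesis using pos_uminus assms rank2_pos_pos by simp
qed

text \<open>The map \<open>- w\<close> sends the finite set
  \<open>rank2_pos \<alpha> \<beta>\<close> injectively into itself, hence onto itself, so its
  inverse preserves the set too.\<close>

lemma rank2_pos_neg_inv:
  assumes "\<gamma> \<in> rank2_pos \<alpha> \<beta>" "w \<in> rank2_group \<alpha> \<beta>" "\<alpha> \<in> \<Delta>" "\<beta> \<in> \<Delta>" "\<alpha> \<noteq> \<beta>" "\<not> pos (w \<alpha>)" "\<not> pos (w \<beta>)"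
  shows "- inv w \<gamma> \<in> rank2_pos \<alpha> \<beta>"
proof -
  have W: "w \<in> W" using assms rank2_group_in_W by blast
  have sub: "(\<lambda>x. - w x) ` rank2_pos \<alpha> \<beta> \<subseteq> rank2_pos \<alpha> \<beta>"
  proof clarify
    fix x assume x: "x \<in> rank2_pos \<alpha> \<beta>"
    hence "pos (- w x)" using rank2_pos_neg_image[OF x W assms(3-7)] pos_uminus W rank2_pos_pos by simp
    thus "- w x \<in> rank2_pos \<alpha> \<beta>" using x assms(2) by (simp add: rank2_pos_def rank2_group_def)
  qed
  have "finite (rank2_pos \<alpha> \<beta>)" by (rule finite_subset[OF _ finite_roots]) (auto simp: rank2_pos_def)
  moreover have "inj_on (\<lambda>x. - w x) (rank2_pos \<alpha> \<beta>)"
    using W_isom(2)[OF W] by (auto simp: inj_on_def bij_def)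
  ultimately have "(\<lambda>x. - w x) ` rank2_pos \<alpha> \<beta> = rank2_pos \<alpha> \<beta>" using sub by (simp add: endo_inj_surj)
  then obtain x where "x \<in> rank2_pos \<alpha> \<beta>" "\<gamma> = - w x" using assms(1) by (metis (no_types, lifting) imageE)
  thus ?thesis using W W_uminus inv_in_W by simp
qed

text \<open>At any other simple root the coordinate along itself stays 1, so that root stays
  positive as well and \<open>W_eq_id\<close> applies.\<close>

lemma rank2_group_eq_id:
  assumes "w \<in> rank2_group \<alpha> \<beta>" "pos (w \<alpha>)" "pos (w \<beta>)"
  shows "w = id"
proof (rule W_eq_id)
  fix \<delta> assume d: "\<delta> \<in> \<Delta>"
  show "pos (w \<delta>)"
  proof (cases "\<delta> \<in> {\<alpha>, \<beta>}")
    case False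
    hence "cf \<delta> (w \<delta>) = 1" using assms(1) d by (simp add: rank2_group_def)
    thus ?thesis using pos_if_cf_pos[of "w \<delta>" \<delta>] d assms rank2_group_in_W by simp
  qed (use assms in auto)
qed (use assms rank2_group_in_W in auto)

text \<open>The simple root whose reflection extends \<open>x_alt \<alpha> \<beta> k\<close> to
  \<open>k + 1\<close> factors on the left; counting starts at 0.\<close>

abbreviation letter :: "'a \<Rightarrow> 'a \<Rightarrow> nat \<Rightarrow> 'a" where
  "letter \<alpha> \<beta> k \<equiv> if even k then \<alpha> else \<beta>"

text \<open>Finiteness of \<open>W\<close> bounds the lengths, so there is a first \<open>m\<close>
  at which the next letter does not lengthen the word. That letter is then a descent, the letter
  just added is another one, and these are the two simple roots.\<close>

lemma alt_max_ex:
  assumes "\<alpha> \<in> \<Delta>" "\<beta> \<in> \<Delta>"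
  shows "\<exists>m\<ge>1. (\<forall>k\<le>m. l (x_alt \<alpha> \<beta> k) = k) \<and>
    \<not> pos (inv_alt \<alpha> \<beta> m \<alpha>) \<and> \<not> pos (inv_alt \<alpha> \<beta> m \<beta>)"
proof -
  have "\<exists>n. l (x_alt \<alpha> \<beta> (Suc n)) \<noteq> Suc n"
  proof (rule ccontr)
    assume "\<not> ?thesis"
    hence "Suc n \<in> l ` W" for n using assms by (metis alt_in_W base_in image_eqI)
    hence "range Suc \<subseteq> l ` W" by blast
    hence "finite (range Suc)" using finite_W finite_subset by blast
    hence "finite (UNIV :: nat set)" by (rule finite_imageD) (rule inj_Suc)
    thus False using infinite_UNIV_nat by blast
  qed
  define m where "m = (LEAST n. l (x_alt \<alpha> \<beta> (Suc n)) \<noteq> Suc n)"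
  have m: "l (x_alt \<alpha> \<beta> (Suc m)) \<noteq> Suc m" unfolding m_def by (rule LeastI_ex) fact
  have less: "l (x_alt \<alpha> \<beta> k) = k" if "k \<le> m" for k
  proof (cases k)
    case (Suc n)
    hence "n < m" using that by simp
    thus ?thesis using Suc not_less_Least unfolding m_def by blast
  qed simp
  have l1: "l (x_alt \<alpha> \<beta> (Suc 0)) = Suc 0"
    using len_simple[OF weyl_group.one assms(1)] assms by simp
  have "m \<noteq> 0" using m l1 by metis
  then obtain n where n: "m = Suc n" by (cases m) auto
  have "l (refl (letter \<alpha> \<beta> m) \<circ> x_alt \<alpha> \<beta> m) \<noteq> Suc m" using m unfolding alt_Suc_left by auto
  hence a: "\<not> pos (inv_alt \<alpha> \<beta> m (letter \<alpha> \<beta> m))"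
    using len_simple(1)[of "x_alt \<alpha> \<beta> m" "letter \<alpha> \<beta> m"] less[of m] assms by (auto split: if_splits)
  have "x_alt \<alpha> \<beta> m = refl (letter \<alpha> \<beta> n) \<circ> x_alt \<alpha> \<beta> n" unfolding n alt_Suc_left by auto
  hence "refl (letter \<alpha> \<beta> n) \<circ> x_alt \<alpha> \<beta> m = x_alt \<alpha> \<beta> n" by simp
  hence lt: "l (refl (letter \<alpha> \<beta> n) \<circ> x_alt \<alpha> \<beta> m) < l (x_alt \<alpha> \<beta> m)"
    using less[of n] less[of m] n by (simp del: alt.simps)
  hence b: "\<not> pos (inv_alt \<alpha> \<beta> m (letter \<alpha> \<beta> n))"
    using len_simple(1)[of "x_alt \<alpha> \<beta> m" "letter \<alpha> \<beta> n"] lt assms by (auto split: if_splits)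
  show ?thesis using a b less n by (intro exI[of _ m]) (auto split: if_splits)
qed

text \<open>For distinct simple roots this is the order of
  \<open>refl \<alpha> \<circ> refl \<beta>\<close>. It is phrased through lengths because
  reducedness of the shorter words is what later arguments use.\<close>

definition braid_length :: "'a \<Rightarrow> 'a \<Rightarrow> nat \<Rightarrow> bool" where
  "braid_length \<alpha> \<beta> m \<longleftrightarrow> m \<ge> 2 \<and> (\<forall>k\<le>m. l (x_alt \<alpha> \<beta> k) = k \<and> l (x_alt \<beta> \<alpha> k) = k) \<and>
     x_alt \<alpha> \<beta> m = x_alt \<beta> \<alpha> m"

lemma braid_length_commute: "braid_length \<alpha> \<beta> m \<longleftrightarrow> braid_length \<beta> \<alpha> m"
  by (auto simp: braid_length_def)

text \<open>The inverses of the two maximal words turn all of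
  \<open>rank2_pos \<alpha> \<beta>\<close> negative, so one of these inverses composed with the
  other word keeps it positive and must be the identity. The words agree, and so do their
  lengths.\<close>

lemma braid_length_ex:
  assumes "\<alpha> \<in> \<Delta>" "\<beta> \<in> \<Delta>" "\<alpha> \<noteq> \<beta>"
  shows "\<exists>m. braid_length \<alpha> \<beta> m"
proof -
  obtain m where m: "m \<ge> 1" "\<And>k. k \<le> m \<Longrightarrow> l (x_alt \<alpha> \<beta> k) = k"
    "\<not> pos (inv_alt \<alpha> \<beta> m \<alpha>)" "\<not> pos (inv_alt \<alpha> \<beta> m \<beta>)"
    using alt_max_ex[OF assms(1,2)] by metis
  obtain n where n: "n \<ge> 1" "\<And>k. k \<le> n \<Longrightarrow> l (x_alt \<beta> \<alpha> k) = k"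
    "\<not> pos (inv_alt \<beta> \<alpha> n \<beta>)" "\<not> pos (inv_alt \<beta> \<alpha> n \<alpha>)"
    using alt_max_ex[OF assms(2,1)] by metis
  let ?z = "inv_alt \<alpha> \<beta> m \<circ> x_alt \<beta> \<alpha> n"
  have z: "?z \<in> rank2_group \<alpha> \<beta>" using rank2_group_comp rank2_group_altl rank2_group_alt rank2_group_commute assms by metis
  have "pos (?z \<gamma>)" if "\<gamma> \<in> rank2_pos \<alpha> \<beta>" for \<gamma>
  proof -
    have "- inv (inv_alt \<beta> \<alpha> n) \<gamma> \<in> rank2_pos \<alpha> \<beta>"
      using rank2_pos_neg_inv[OF that] n(3,4) assms rank2_group_altl rank2_group_commute by metis
    hence c: "- x_alt \<beta> \<alpha> n \<gamma> \<in> rank2_pos \<alpha> \<beta>" by simp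
    have "\<not> pos (inv_alt \<alpha> \<beta> m (- x_alt \<beta> \<alpha> n \<gamma>))"
      using rank2_pos_neg_image[OF c _ assms] m assms by simp
    moreover have "inv_alt \<alpha> \<beta> m (- x_alt \<beta> \<alpha> n \<gamma>) = - ?z \<gamma>" using W_uminus assms by simp
    ultimately show ?thesis using pos_uminus[of "?z \<gamma>"] rank2_pos_pos[OF that] rank2_group_in_W[OF z] assms by simp
  qed
  hence "?z = id" using rank2_group_eq_id[OF z] rank2_pos_base assms by blast
  hence "x_alt \<alpha> \<beta> m \<circ> ?z = x_alt \<alpha> \<beta> m" by simp
  hence eq: "x_alt \<beta> \<alpha> n = x_alt \<alpha> \<beta> m" using assms by (simp add: fun_eq_iff altl_alt_inverse)
  hence mn: "m = n" using m(2)[of m] n(2)[of n] by simp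
  have "m \<noteq> 1"
  proof
    assume "m = 1"
    hence "refl \<alpha> = refl \<beta>" using eq mn by simp
    thus False using refl_simple_inj assms by blast
  qed
  thus ?thesis using m n eq mn unfolding braid_length_def by (intro exI[of _ m]) auto
qed

lemma braid_length_inv: "braid_length \<alpha> \<beta> m \<Longrightarrow> inv_alt \<alpha> \<beta> m = inv_alt \<beta> \<alpha> m"
  unfolding braid_length_def by (metis inv_x_alt)

text \<open>Positivity holds because the next letter still lengthens the word. For
  \<open>k < m\<close> these are the roots that \<open>x_alt \<alpha> \<beta> m\<close> makes
  negative, in the order in which its letters are multiplied on.\<close>

lemma braid_root:
  assumes "braid_length \<alpha> \<beta> m" "\<alpha> \<in> \<Delta>" "\<beta> \<in> \<Delta>" "k < m"
  shows "inv_alt \<alpha> \<beta> k (letter \<alpha> \<beta> k) \<in> rank2_pos \<alpha> \<beta>"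
proof -
  have k: "l (x_alt \<alpha> \<beta> k) = k" "l (x_alt \<alpha> \<beta> (Suc k)) = Suc k"
    using assms unfolding braid_length_def by (auto simp del: alt.simps)
  hence "l (refl (letter \<alpha> \<beta> k) \<circ> x_alt \<alpha> \<beta> k) = Suc k" unfolding alt_Suc_left by auto
  hence "pos (inv_alt \<alpha> \<beta> k (letter \<alpha> \<beta> k))"
    using len_simple(1)[of "x_alt \<alpha> \<beta> k" "letter \<alpha> \<beta> k"] k assms by (auto split: if_splits)
  moreover have "inv_alt \<alpha> \<beta> k \<in> rank2_group \<alpha> \<beta>" using rank2_group_altl assms by blast
  ultimately show ?thesis using assms by (auto simp: rank2_pos_def rank2_group_def)
qed

text \<open>Every root from \<open>braid_root\<close> is a nonnegative combination of two simple
  roots that \<open>inv w\<close> makes negative, so each letter shortens the element. Hence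
  \<open>w\<close> has a reduced word beginning with an alternating word of \<open>m\<close>
  letters.\<close>

lemma len_alt_comp_descents:
  assumes "braid_length \<alpha> \<beta> m" "\<alpha> \<in> \<Delta>" "\<beta> \<in> \<Delta>" "\<alpha> \<noteq> \<beta>" "w \<in> W"
    "\<not> pos (inv w \<alpha>)" "\<not> pos (inv w \<beta>)" "k \<le> m"
  shows "k + l (x_alt \<alpha> \<beta> k \<circ> w) = l w"
  using \<open>k \<le> m\<close>
proof (induction k)
  case (Suc k)
  let ?a = "letter \<alpha> \<beta> k"
  have ih: "k + l (x_alt \<alpha> \<beta> k \<circ> w) = l w" by (rule Suc.IH) (use Suc.prems in simp)
  have b: "inv_alt \<alpha> \<beta> k ?a \<in> rank2_pos \<alpha> \<beta>" using braid_root[OF assms(1-3)] Suc by simp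
  have "\<not> pos (inv w (inv_alt \<alpha> \<beta> k ?a))"
    using rank2_pos_neg_image[OF b inv_in_W[OF assms(5)] assms(2-4,6,7)] by simp
  hence "\<not> pos (inv (x_alt \<alpha> \<beta> k \<circ> w) ?a)" using assms by (simp add: inv_comp_W)
  hence "Suc (l (refl ?a \<circ> (x_alt \<alpha> \<beta> k \<circ> w))) = l (x_alt \<alpha> \<beta> k \<circ> w)"
    using len_simple[of "x_alt \<alpha> \<beta> k \<circ> w" ?a] comp_in_W assms by simp
  thus "Suc k + l (x_alt \<alpha> \<beta> (Suc k) \<circ> w) = l w"
    unfolding alt_Suc_left using ih by (auto simp: o_assoc)
qed simp

section \<open>Matsumoto's theorem\<close>

lemma reduced_word_Cons: "reduced_word (s # ss) \<Longrightarrow> reduced_word ss"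
proof -
  assume r: "reduced_word (s # ss)"
  hence "s \<in> W" "word_prod ss \<in> W" "s \<in> S" using simple_in_W prod_in_W by (auto simp: reduced_word_def)
  hence "l (s \<circ> word_prod ss) \<le> 1 + l (word_prod ss)"
    using len_comp_le[of s "word_prod ss"] len_simple_le[of s] by simp
  thus ?thesis using r len_le[of ss] by (simp add: reduced_word_def)
qed

lemma reduced_word_descent:
  assumes "reduced_word (refl \<alpha> # ss)" "\<alpha> \<in> \<Delta>"
  shows "\<not> pos (inv (word_prod (refl \<alpha> # ss)) \<alpha>)"
proof -
  have w: "word_prod (refl \<alpha> # ss) \<in> W" using prod_in_W[of "refl \<alpha> # ss"] assms by (simp add: reduced_word_def)
  have "l (refl \<alpha> \<circ> word_prod (refl \<alpha> # ss)) < l (word_prod (refl \<alpha> # ss))"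
    using reduced_word_Cons[OF assms(1)] assms(1) by (simp add: reduced_word_def)
  thus ?thesis using len_simple(1)[OF w assms(2)] by (auto split: if_splits)
qed

text \<open>Two reduced words with different first letters are linked by two more: both letters are
  descents, so the element is also either alternating word of \<open>m\<close> letters followed by
  one common tail. Words with equal first letters are compared by induction, and the two new words
  by the braid relation.\<close>

theorem matsumoto:
  fixes F :: "('a \<Rightarrow> 'a) \<Rightarrow> 'b \<Rightarrow> 'b"
  assumes braid: "\<And>\<alpha> \<beta> m. \<alpha> \<in> \<Delta> \<Longrightarrow> \<beta> \<in> \<Delta> \<Longrightarrow> \<alpha> \<noteq> \<beta> \<Longrightarrow> braid_length \<alpha> \<beta> m \<Longrightarrow>
      altl (F (refl \<alpha>)) (F (refl \<beta>)) m = altl (F (refl \<beta>)) (F (refl \<alpha>)) m"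
    and "reduced_word ss" "reduced_word ts" "word_prod ss = word_prod ts"
  shows "word_prod (map F ss) = word_prod (map F ts)"
  using assms(2-4)
proof (induction "length ss" arbitrary: ss ts rule: less_induct)
  case less
  have len: "length ss = length ts" using less.prems by (simp add: reduced_word_def)
  show ?case
  proof (cases ss)
    case Nil thus ?thesis using len by simp
  next
    case (Cons s ss')
    then obtain t ts' where ts: "ts = t # ts'" using len by (cases ts) auto
    obtain \<alpha> \<beta> where ab: "\<alpha> \<in> \<Delta>" "s = refl \<alpha>" "\<beta> \<in> \<Delta>" "t = refl \<beta>"
      using less.prems Cons ts by (auto simp: reduced_word_def elim!: simple_refls_E)
    have r: "reduced_word ss'" "reduced_word ts'" using less.prems Cons ts reduced_word_Cons by blast+
    show ?thesis
    proof (cases "\<alpha> = \<beta>")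
      case True
      have "s \<circ> (s \<circ> word_prod ss') = s \<circ> (s \<circ> word_prod ts')" using less.prems(3) Cons ts ab True by simp
      hence "word_prod ss' = word_prod ts'" using ab by simp
      thus ?thesis using less.hyps[of ss' ts'] r Cons ts ab True by simp
    next
      case False
      let ?w = "word_prod ss"
      obtain m where m: "braid_length \<alpha> \<beta> m" using braid_length_ex ab False by blast
      have w: "?w \<in> W" using less.prems prod_in_W by (auto simp: reduced_word_def)
      have d: "\<not> pos (inv ?w \<alpha>)" "\<not> pos (inv ?w \<beta>)"
        using reduced_word_descent[of \<alpha> ss'] reduced_word_descent[of \<beta> ts'] less.prems Cons ts ab by simp_all
      let ?v = "x_alt \<alpha> \<beta> m \<circ> ?w"
      have v: "?v \<in> W" using comp_in_W w ab by simp
      obtain vs where vs: "reduced_word vs" "?v = word_prod vs" using reduced_word_ex[OF v] by metis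
      have lv: "m + l ?v = l ?w" using len_alt_comp_descents[OF m ab(1,3) False w d] by simp
      have wv: "?w = inv_alt \<alpha> \<beta> m \<circ> word_prod vs" unfolding vs(2)[symmetric]
        by (simp add: fun_eq_iff altl_alt_inverse)
      hence wv': "?w = inv_alt \<beta> \<alpha> m \<circ> word_prod vs" using braid_length_inv[OF m] by simp
      have as: "reduced_word (altw s t m @ vs)" "word_prod (altw s t m @ vs) = ?w"
        using vs lv wv ab set_altw[of s t m] by (auto simp: reduced_word_def word_prod_altw_id simple_refls_def)
      have at: "reduced_word (altw t s m @ vs)" "word_prod (altw t s m @ vs) = ?w"
        using vs lv wv' ab set_altw[of t s m] by (auto simp: reduced_word_def word_prod_altw_id simple_refls_def)
      obtain n where n: "m = Suc n" using m by (cases m) (auto simp: braid_length_def)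
      have step: "word_prod (map F (s # us)) = word_prod (map F (s # us'))"
        if "reduced_word (s # us)" "reduced_word (s # us')" "word_prod (s # us) = word_prod (s # us')" "length us < length ss"
          "s = refl \<gamma>" for s us us' \<gamma>
      proof -
        have "s \<circ> (s \<circ> word_prod us) = s \<circ> (s \<circ> word_prod us')" using that by simp
        hence "word_prod us = word_prod us'" using that by simp
        thus ?thesis using less.hyps[of us us'] that reduced_word_Cons by simp
      qed
      have "word_prod (map F ss) = word_prod (map F (altw s t m @ vs))"
        using step[of s ss' "altw t s n @ vs" \<alpha>] as n Cons less.prems ab by simp
      also have "\<dots> = word_prod (map F (altw t s m @ vs))"
        using braid[OF ab(1,3) False m] ab by (simp add: word_prod_altw)
      also have "\<dots> = word_prod (map F ts)"
        using step[of t ts' "altw s t n @ vs" \<beta>] at n ts less.prems ab len by simp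
      finally show ?thesis .
    qed
  qed
qed

end


section \<open>Laurent polynomials and free modules\<close>

lemma upow_mult [simp]: "upow m * upow n = upow (m + n)"
  by (simp add: upow_def mult_single)

lemma upow_0 [simp]: "upow 0 = 1"
  by (simp add: upow_def)

text \<open>Used for \<open>n = 1\<close> and, after applying the bar, for \<open>n = -1\<close>:
  these are the factors that get cancelled.\<close>

lemma upow_plus_1_nonzero: "n \<noteq> 0 \<Longrightarrow> upow n + 1 \<noteq> 0"
proof
  assume n: "n \<noteq> 0" and "upow n + 1 = 0"
  hence "Poly_Mapping.lookup (upow n + 1) 0 = 0" by simp
  thus False using n by (simp add: upow_def lookup_add lookup_single lookup_one)
qed

text \<open>Additively, Laurent polynomials are the free abelian group on the integers, so induction
  for such groups applies.\<close>

lemma laurent_induct [case_names zero upow diff]: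
  assumes "P 0" "\<And>n. P (upow n)" "\<And>a b. P a \<Longrightarrow> P b \<Longrightarrow> P (a - b)"
  shows "P (c :: laurent)"
proof -
  have "Poly_Mapping.keys c \<subseteq> UNIV" by simp
  thus ?thesis
  proof (induction rule: frag_induction)
    case (one n) thus ?case using assms(2)[of n] by (simp add: upow_def)
  qed (use assms in auto)
qed

text \<open>The ring involution of the Laurent polynomials that inverts \<open>u\<close>.\<close>

definition cbar :: "laurent \<Rightarrow> laurent" where
  "cbar c = Poly_Mapping.map_key uminus c"

lemma lookup_cbar: "Poly_Mapping.lookup (cbar c) n = Poly_Mapping.lookup c (- n)"
  unfolding cbar_def by (subst map_key.rep_eq) (simp_all add: inj_def)

lemma cbar_0 [simp]: "cbar 0 = 0"
  by (rule poly_mapping_eqI) (simp add: lookup_cbar)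

lemma cbar_1 [simp]: "cbar 1 = 1"
  by (rule poly_mapping_eqI) (simp add: lookup_cbar lookup_one when_def)

lemma cbar_add: "cbar (a + b) = cbar a + cbar b"
  by (rule poly_mapping_eqI) (simp add: lookup_cbar lookup_add)

lemma cbar_diff: "cbar (a - b) = cbar a - cbar b"
  by (rule poly_mapping_eqI) (simp add: lookup_cbar lookup_minus)

lemma cbar_upow [simp]: "cbar (upow n) = upow (- n)"
  by (rule poly_mapping_eqI) (auto simp: lookup_cbar upow_def lookup_single when_def)

lemma cbar_mult: "cbar (a * b) = cbar a * cbar b"
proof (induction a rule: laurent_induct)
  case (upow n)
  show ?case
    by (induction b rule: laurent_induct) (simp_all add: right_diff_distrib cbar_diff)
qed (simp_all add: left_diff_distrib cbar_diff)

lemma cbar_cbar [simp]: "cbar (cbar c) = c"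
  by (rule poly_mapping_eqI) (simp add: lookup_cbar)

section \<open>Submodules, linear maps and semilinear extension\<close>

lemma lookup_smul [simp]: "Poly_Mapping.lookup (c \<cdot>\<^sub>A m) k = c * Poly_Mapping.lookup m k"
  unfolding smul_def by (simp add: map.rep_eq when_def)

text \<open>Over this ring \<open>smul.subspace\<close> means submodule. A property that extends
  linearly from the basis is proved by showing that its solutions form a submodule.\<close>

interpretation smul: module smul
  by unfold_locales
    (auto intro!: poly_mapping_eqI simp: lookup_add algebra_simps)

lemma smul_cancel: "c \<noteq> 0 \<Longrightarrow> c \<cdot>\<^sub>A x = c \<cdot>\<^sub>A y \<Longrightarrow> x = y"
  by (metis lookup_smul mult_left_cancel poly_mapping_eqI)

lemma lookup_basis_elt: "Poly_Mapping.lookup (basis_elt x) y = (if x = y then 1 else 0)"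
  by (simp add: basis_elt_def lookup_single when_def)

lemma keys_smul: "Poly_Mapping.keys (c \<cdot>\<^sub>A m) \<subseteq> Poly_Mapping.keys m"
  by (auto simp: in_keys_iff)

lemma subspace_free_mod: "smul.subspace (free_mod X)"
  by (rule smul.subspaceI)
    (auto simp: free_mod_def dest!: subsetD[OF keys_add] subsetD[OF keys_smul])

lemma basis_in_free_mod [simp]: "basis_elt x \<in> free_mod X \<longleftrightarrow> x \<in> X"
  by (simp add: free_mod_def basis_elt_def)

lemma free_mod_closed [simp]:
  "0 \<in> free_mod X"
  "x \<in> free_mod X \<Longrightarrow> y \<in> free_mod X \<Longrightarrow> x + y \<in> free_mod X"
  "x \<in> free_mod X \<Longrightarrow> y \<in> free_mod X \<Longrightarrow> x - y \<in> free_mod X"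
  "x \<in> free_mod X \<Longrightarrow> - x \<in> free_mod X"
  "x \<in> free_mod X \<Longrightarrow> c \<cdot>\<^sub>A x \<in> free_mod X"
proof -
  note f = subspace_free_mod[of X]
  show "0 \<in> free_mod X" by (rule smul.subspace_0[OF f])
  show "x \<in> free_mod X \<Longrightarrow> y \<in> free_mod X \<Longrightarrow> x + y \<in> free_mod X" by (rule smul.subspace_add[OF f])
  show "x \<in> free_mod X \<Longrightarrow> y \<in> free_mod X \<Longrightarrow> x - y \<in> free_mod X" by (rule smul.subspace_diff[OF f])
  show "x \<in> free_mod X \<Longrightarrow> - x \<in> free_mod X" by (rule smul.subspace_neg[OF f])
  show "x \<in> free_mod X \<Longrightarrow> c \<cdot>\<^sub>A x \<in> free_mod X" by (rule smul.subspace_scale[OF f])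
qed

lemma basis_expand: "m = (\<Sum>w\<in>Poly_Mapping.keys m. Poly_Mapping.lookup m w \<cdot>\<^sub>A basis_elt w)"
  by (rule poly_mapping_eqI) (auto simp: lookup_sum lookup_basis_elt if_distrib in_keys_iff cong: if_cong)

lemma free_mod_induct:
  assumes "m \<in> free_mod X" "smul.subspace N" "\<And>x. x \<in> X \<Longrightarrow> basis_elt x \<in> N"
  shows "m \<in> N"
  using assms
  by (subst basis_expand) (auto intro!: smul.subspace_sum smul.subspace_scale simp: free_mod_def)

lemma smul_free_mod_cancel: "c \<noteq> 0 \<Longrightarrow> c \<cdot>\<^sub>A m \<in> free_mod X \<Longrightarrow> m \<in> free_mod X"
  by (auto simp: free_mod_def in_keys_iff subset_iff)

text \<open>Extension from the basis, twisted by \<open>\<sigma>\<close> on the coefficients: the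
  identity gives linear maps, \<open>cbar\<close> the bar operator.\<close>

definition sext :: "(laurent \<Rightarrow> laurent) \<Rightarrow> ('b \<Rightarrow> ('c \<Rightarrow>\<^sub>0 laurent)) \<Rightarrow> ('b \<Rightarrow>\<^sub>0 laurent) \<Rightarrow> ('c \<Rightarrow>\<^sub>0 laurent)" where
  "sext \<sigma> f m = (\<Sum>w\<in>Poly_Mapping.keys m. \<sigma> (Poly_Mapping.lookup m w) \<cdot>\<^sub>A f w)"

lemma sext_eq:
  assumes "\<sigma> 0 = 0" "finite A" "Poly_Mapping.keys m \<subseteq> A"
  shows "sext \<sigma> f m = (\<Sum>w\<in>A. \<sigma> (Poly_Mapping.lookup m w) \<cdot>\<^sub>A f w)"
  unfolding sext_def using assms
  by (intro sum.mono_neutral_left) (auto simp: in_keys_iff)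

lemma sext_add:
  assumes "\<sigma> 0 = 0" "\<And>a b. \<sigma> (a + b) = \<sigma> a + \<sigma> b"
  shows "sext \<sigma> f (m + n) = sext \<sigma> f m + sext \<sigma> f n"
proof -
  let ?A = "Poly_Mapping.keys m \<union> Poly_Mapping.keys n"
  have "sext \<sigma> f x = (\<Sum>w\<in>?A. \<sigma> (Poly_Mapping.lookup x w) \<cdot>\<^sub>A f w)"
    if "Poly_Mapping.keys x \<subseteq> ?A" for x using that assms by (intro sext_eq) auto
  thus ?thesis using keys_add[of m n] assms
    by (simp add: lookup_add smul.scale_left_distrib sum.distrib)
qed

lemma sext_smul:
  assumes "\<sigma> 0 = 0" "\<And>a b. \<sigma> (a * b) = \<sigma> a * \<sigma> b"
  shows "sext \<sigma> f (c \<cdot>\<^sub>A m) = \<sigma> c \<cdot>\<^sub>A sext \<sigma> f m"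
proof -
  have "sext \<sigma> f (c \<cdot>\<^sub>A m) = (\<Sum>w\<in>Poly_Mapping.keys m. \<sigma> (Poly_Mapping.lookup (c \<cdot>\<^sub>A m) w) \<cdot>\<^sub>A f w)"
    using assms keys_smul[of c m] by (intro sext_eq) auto
  thus ?thesis using assms by (simp add: sext_def smul.scale_sum_right)
qed

lemma sext_basis [simp]: "\<sigma> 1 = 1 \<Longrightarrow> sext \<sigma> f (basis_elt w) = f w"
  by (simp add: sext_def basis_elt_def)

lemma sext_closed:
  assumes "m \<in> free_mod X" "smul.subspace N" "\<And>x. x \<in> X \<Longrightarrow> f x \<in> N"
  shows "sext \<sigma> f m \<in> N"
  unfolding sext_def using assms
  by (auto intro!: smul.subspace_sum smul.subspace_scale simp: free_mod_def)

text \<open>Linearity is demanded on the whole type, not just on \<open>free_mod X\<close>. The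
  operators \<open>T s\<close>, \<open>T_of w\<close>, \<open>act h\<close> and \<open>Ti s\<close>
  satisfy it, which spares membership conditions.\<close>

definition linear_A :: "(('b \<Rightarrow>\<^sub>0 laurent) \<Rightarrow> ('c \<Rightarrow>\<^sub>0 laurent)) \<Rightarrow> bool" where
  "linear_A f \<longleftrightarrow> (\<forall>x y. f (x + y) = f x + f y) \<and> (\<forall>c x. f (c \<cdot>\<^sub>A x) = c \<cdot>\<^sub>A f x)"

lemma linD: assumes "linear_A f"
  shows "f (x + y) = f x + f y" "f (c \<cdot>\<^sub>A x) = c \<cdot>\<^sub>A f x" "f 0 = 0" "f (- x) = - f x" "f (x - y) = f x - f y"
proof -
  show a: "f (x + y) = f x + f y" "f (c \<cdot>\<^sub>A x) = c \<cdot>\<^sub>A f x" for x y c using assms by (auto simp: linear_A_def)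
  show 0: "f 0 = 0" using a(1)[of 0 0] by simp
  show n: "f (- x) = - f x" for x using a(1)[of x "-x"] 0 by (simp add: eq_neg_iff_add_eq_0 add.commute)
  show "f (x - y) = f x - f y" using a(1)[of x "-y"] n by simp
qed

lemma lin_sext: "linear_A (sext (\<lambda>x. x) f)"
  by (simp add: linear_A_def sext_add sext_smul)

lemma lin_o: "linear_A f \<Longrightarrow> linear_A g \<Longrightarrow> linear_A (f \<circ> g)"
  by (simp add: linear_A_def)

lemma lin_id: "linear_A id"
  by (simp add: linear_A_def)

lemma lin_diff: "linear_A f \<Longrightarrow> linear_A g \<Longrightarrow> linear_A (\<lambda>x. f x - g x)"
  by (simp add: linear_A_def smul.scale_right_diff_distrib)

lemma lin_word_prod: "(\<And>f. f \<in> set fs \<Longrightarrow> linear_A f) \<Longrightarrow> linear_A (word_prod fs)"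
proof (induction fs)
  case (Cons f fs)
  have "linear_A (f \<circ> word_prod fs)" by (rule lin_o) (use Cons in auto)
  thus ?case by (simp only: word_prod_Cons)
next
  case Nil show ?case by (simp only: word_prod_Nil lin_id)
qed

lemma subspace_eqI: "linear_A f \<Longrightarrow> linear_A g \<Longrightarrow> smul.subspace {x. f x = g x}"
  by (rule smul.subspaceI) (auto simp: linD)

lemma lin_eq_on:
  assumes "linear_A f" "linear_A g" "m \<in> free_mod X" "\<And>x. x \<in> X \<Longrightarrow> f (basis_elt x) = g (basis_elt x)"
  shows "f m = g m"
  using free_mod_induct[OF assms(3) subspace_eqI[OF assms(1,2)]] assms(4) by blast

text \<open>The powers of \<open>u\<close> span the coefficients over the integers, so an additive
  map that inverts them is semilinear. This serves bar maps that are given only by their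
  axioms.\<close>

lemma semilinear_on:
  assumes N: "smul.subspace N" and add: "\<And>x y. x \<in> N \<Longrightarrow> y \<in> N \<Longrightarrow> f (x + y) = f x + f y"
    and upow: "\<And>n x. x \<in> N \<Longrightarrow> f (upow n \<cdot>\<^sub>A x) = upow (- n) \<cdot>\<^sub>A f x"
    and x: "x \<in> N"
  shows "f (c \<cdot>\<^sub>A x) = cbar c \<cdot>\<^sub>A f x"
proof -
  note cl = smul.subspace_0[OF N] smul.subspace_scale[OF N] smul.subspace_diff[OF N]
  have 0: "f 0 = 0" using add[OF cl(1) cl(1)] by simp
  have diff: "f (x - y) = f x - f y" if "x \<in> N" "y \<in> N" for x y
    using add[of "x - y" y] cl(3) that by (simp add: algebra_simps)
  show ?thesis
  proof (induction c rule: laurent_induct)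
    case (diff a b)
    thus ?case using x cl \<open>\<And>y x. x \<in> N \<Longrightarrow> y \<in> N \<Longrightarrow> f (x - y) = f x - f y\<close>
      by (simp add: smul.scale_left_diff_distrib cbar_diff)
  qed (simp_all add: 0 upow x)
qed


section \<open>The operators on the module of involutions\<close>

context based_root_system
begin

abbreviation "I \<equiv> involutions \<Phi>"
abbreviation "M \<equiv> inv_mod \<Phi>"
abbreviation av :: "('a \<Rightarrow> 'a) \<Rightarrow> ('a \<Rightarrow> 'a) \<Rightarrow>\<^sub>0 laurent" where "av \<equiv> basis_elt"
abbreviation "T \<equiv> Ts \<Phi> \<Delta>"
abbreviation "u \<equiv> upow 1"

text \<open>The neighbour of the involution \<open>w\<close> in direction \<open>s\<close>: the only
  index besides \<open>w\<close> that can occur in \<open>T s (av w)\<close>.\<close>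

definition star :: "('a \<Rightarrow> 'a) \<Rightarrow> ('a \<Rightarrow> 'a) \<Rightarrow> ('a \<Rightarrow> 'a)" where
  "star s w = (if s \<circ> w = w \<circ> s then s \<circ> w else s \<circ> w \<circ> s)"

lemma I_in_W: "w \<in> I \<Longrightarrow> w \<in> W" by (simp add: involutions_def)

lemma I_inv: "w \<in> I \<Longrightarrow> inv w = w"
  by (auto simp: involutions_def intro: inv_unique_comp)

lemma I_I: assumes "w \<in> I" shows "w (w x) = x"
proof -
  have "w \<circ> w = id" using assms by (simp add: involutions_def)
  thus ?thesis by (simp add: fun_eq_iff)
qed

lemma id_in_I: "id \<in> I" by (simp add: involutions_def weyl_group.one)

lemma in_I: "w \<in> W \<Longrightarrow> (\<And>x. w (w x) = x) \<Longrightarrow> w \<in> I"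
  by (simp add: involutions_def fun_eq_iff)

text \<open>Conjugation by \<open>w\<close> moves the reflection to the root
  \<open>w \<alpha>\<close>; roots with the same reflection are proportional, and reducedness leaves
  the two signs.\<close>

lemma commutes_iff:
  assumes "w \<in> W" "\<alpha> \<in> \<Delta>"
  shows "refl \<alpha> \<circ> w = w \<circ> refl \<alpha> \<longleftrightarrow> w \<alpha> = \<alpha> \<or> w \<alpha> = - \<alpha>"
proof
  assume "refl \<alpha> \<circ> w = w \<circ> refl \<alpha>"
  hence "refl (w \<alpha>) \<circ> w \<circ> inv w = refl \<alpha> \<circ> w \<circ> inv w" using refl_W_conj assms by metis
  hence "refl (w \<alpha>) = refl \<alpha>" using assms by (simp add: fun_eq_iff)
  then obtain c where c: "w \<alpha> = c *\<^sub>R \<alpha>" using refl_eqD[of "w \<alpha>" \<alpha>] assms by auto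
  hence "c *\<^sub>R \<alpha> \<in> \<Phi>" using assms W_root by (metis base_in)
  thus "w \<alpha> = \<alpha> \<or> w \<alpha> = - \<alpha>" using reduced[of \<alpha> c] c assms by auto
next
  assume "w \<alpha> = \<alpha> \<or> w \<alpha> = - \<alpha>"
  hence "refl (w \<alpha>) = refl \<alpha>" by auto
  thus "refl \<alpha> \<circ> w = w \<circ> refl \<alpha>" using refl_W_conj assms by metis
qed

lemma conj_in_I: assumes "w \<in> I" "x \<in> W" shows "x \<circ> w \<circ> inv x \<in> I"
proof (rule in_I)
  show "x \<circ> w \<circ> inv x \<in> W" using assms comp_in_W inv_in_W I_in_W by metis
  show "(x \<circ> w \<circ> inv x) ((x \<circ> w \<circ> inv x) y) = y" for y using assms by (simp add: I_I)
qed

lemma star_in_I: assumes "w \<in> I" "\<alpha> \<in> \<Delta>" shows "star (refl \<alpha>) w \<in> I"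
proof (cases "refl \<alpha> \<circ> w = w \<circ> refl \<alpha>")
  case True
  hence "refl \<alpha> (w x) = w (refl \<alpha> x)" for x by (simp add: fun_eq_iff)
  hence "refl \<alpha> \<circ> w \<in> I" using assms comp_in_W refl_in_W I_in_W by (intro in_I) (simp_all add: I_I)
  thus ?thesis using True by (simp add: star_def)
next
  case False
  thus ?thesis using conj_in_I[OF assms(1) refl_in_W, of \<alpha>] assms by (simp add: star_def)
qed

text \<open>The direction \<open>s\<close> pairs up the involutions, one member of each pair
  ascending and the other descending, with commutation constant on the pair. Hence
  \<open>T s\<close> consists of blocks of size two.\<close>

lemma star_props:
  assumes "w \<in> I" "\<alpha> \<in> \<Delta>"
  defines "s \<equiv> refl \<alpha>"
  shows "s \<circ> star s w = star s w \<circ> s \<longleftrightarrow> s \<circ> w = w \<circ> s"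
    "star s (star s w) = w"
    "pos (star s w \<alpha>) \<longleftrightarrow> \<not> pos (w \<alpha>)"
    "star s w \<noteq> w"
proof -
  show c: "s \<circ> star s w = star s w \<circ> s \<longleftrightarrow> s \<circ> w = w \<circ> s"
    unfolding star_def s_def by (auto simp: o_assoc[symmetric]) (metis o_assoc refl_comp_refl_comp)
  show "star s (star s w) = w"
  proof (cases "s \<circ> w = w \<circ> s")
    case True
    hence "star s (star s w) = s \<circ> star s w" unfolding star_def[of s "star s w"] using c by (intro if_P) blast
    also have "s \<circ> star s w = s \<circ> (s \<circ> w)"
      by (rule arg_cong[where f = "\<lambda>x. s \<circ> x"]) (use True in \<open>simp add: star_def\<close>)
    also have "s \<circ> (s \<circ> w) = w" by (simp add: s_def)
    finally show ?thesis .
  next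
    case False
    hence "star s (star s w) = s \<circ> star s w \<circ> s" unfolding star_def[of s "star s w"] using c by (intro if_not_P) blast
    also have "\<dots> = w" using False by (simp add: star_def s_def o_assoc[symmetric])
    finally show ?thesis .
  qed
  show p: "pos (star s w \<alpha>) \<longleftrightarrow> \<not> pos (w \<alpha>)"
  proof (cases "s \<circ> w = w \<circ> s")
    case True
    hence "w \<alpha> = \<alpha> \<or> w \<alpha> = - \<alpha>" using commutes_iff assms I_in_W by blast
    moreover have "s (- \<alpha>) = \<alpha>" using linear_neg[OF linear_refl, of \<alpha> \<alpha>] assms by simp
    ultimately show ?thesis
      using True assms W_uminus[OF I_in_W[OF assms(1)], of \<alpha>] by (auto simp: star_def)
  next
    case False
    hence n: "w \<alpha> \<noteq> \<alpha>" "w \<alpha> \<noteq> - \<alpha>" using commutes_iff assms I_in_W by blast+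
    have "star s w \<alpha> = s (w (- \<alpha>))" using False assms by (simp add: star_def)
    also have "\<dots> = - s (w \<alpha>)" by (simp add: W_uminus[OF I_in_W[OF assms(1)]] linear_neg[OF linear_refl] s_def)
    finally show ?thesis
      using pos_refl_simple_iff[of \<alpha> "w \<alpha>"] n assms I_in_W pos_uminus refl_in by simp
  qed
  show "star s w \<noteq> w" using p by metis
qed

lemma len_star:
  assumes "w \<in> I" "\<alpha> \<in> \<Delta>" "pos (w \<alpha>)"
  shows "l (star (refl \<alpha>) w) = (if refl \<alpha> \<circ> w = w \<circ> refl \<alpha> then l w + 1 else l w + 2)"
proof -
  have w: "w \<in> W" "inv w = w" using assms I_in_W I_inv by auto
  have 1: "l (refl \<alpha> \<circ> w) = l w + 1" using len_simple[OF w(1) assms(2)] w assms by simp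
  show ?thesis
  proof (cases "refl \<alpha> \<circ> w = w \<circ> refl \<alpha>")
    case True thus ?thesis using 1 by (simp add: star_def)
  next
    case False
    hence "w \<alpha> \<noteq> \<alpha>" using commutes_iff w assms by blast
    hence "pos ((refl \<alpha> \<circ> w) \<alpha>)" using pos_refl_simple assms by simp
    hence "l (refl \<alpha> \<circ> w \<circ> refl \<alpha>) = l w + 2"
      using len_simple_right[of "refl \<alpha> \<circ> w" \<alpha>] 1 comp_in_W refl_in_W w assms by simp
    thus ?thesis using False by (simp add: star_def)
  qed
qed

lemma lin_T: "linear_A (T s)"
proof -
  have "T s = (\<lambda>m. sext (\<lambda>x. x) (Ts_plus_one_basis \<Phi> \<Delta> s) m - id m)"
    by (rule ext) (simp add: Ts_def sext_def)
  thus ?thesis by (simp only: lin_diff[OF lin_sext lin_id])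
qed

lemma T_basis: "T s (av w) = Ts_plus_one_basis \<Phi> \<Delta> s w - av w"
  by (simp add: Ts_def basis_elt_def)

text \<open>An involution is its own inverse, so left and right comparison both depend on the sign
  of \<open>w \<alpha>\<close>.\<close>

lemma T_up:
  assumes "w \<in> I" "\<alpha> \<in> \<Delta>" "pos (w \<alpha>)"
  shows "T (refl \<alpha>) (av w) = (if refl \<alpha> \<circ> w = w \<circ> refl \<alpha>
    then u \<cdot>\<^sub>A av w + (u + 1) \<cdot>\<^sub>A av (star (refl \<alpha>) w) else av (star (refl \<alpha>) w))"
  using bruhat_less_left[of w \<alpha>] bruhat_less_right[of w \<alpha>] I_in_W[OF assms(1)] I_inv[OF assms(1)] assms
  by (simp add: T_basis Ts_plus_one_basis_def star_def smul.scale_right_distrib smul.scale_left_distrib)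

lemma T_down:
  assumes "w \<in> I" "\<alpha> \<in> \<Delta>" "\<not> pos (w \<alpha>)"
  shows "T (refl \<alpha>) (av w) = (if refl \<alpha> \<circ> w = w \<circ> refl \<alpha>
    then (upow 2 - u - 1) \<cdot>\<^sub>A av w + (upow 2 - u) \<cdot>\<^sub>A av (star (refl \<alpha>) w)
    else (upow 2 - 1) \<cdot>\<^sub>A av w + upow 2 \<cdot>\<^sub>A av (star (refl \<alpha>) w))"
  using bruhat_less_left[of w \<alpha>] bruhat_less_right[of w \<alpha>] I_in_W[OF assms(1)] I_inv[OF assms(1)] assms
  by (simp add: T_basis Ts_plus_one_basis_def star_def smul.scale_right_distrib
      smul.scale_left_distrib smul.scale_left_diff_distrib)

lemma T_in_M:
  assumes "s \<in> S" "m \<in> M"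
  shows "T s m \<in> M"
proof -
  obtain \<alpha> where a: "\<alpha> \<in> \<Delta>" "s = refl \<alpha>" using assms simple_refls_E by blast
  have "smul.subspace {m. T s m \<in> M}"
    by (rule smul.subspaceI) (auto simp: linD[OF lin_T])
  moreover have "T s (av w) \<in> M" if "w \<in> I" for w
    using T_up[OF that a(1)] T_down[OF that a(1)] star_in_I[OF that a(1)] that a(2)
    by (cases "pos (w \<alpha>)") auto
  ultimately show ?thesis using free_mod_induct[OF assms(2), of "{m. T s m \<in> M}"] by blast
qed

lemma T_quadratic:
  assumes "s \<in> S" "m \<in> M"
  shows "T s (T s m) = (upow 2 - 1) \<cdot>\<^sub>A T s m + upow 2 \<cdot>\<^sub>A m"
proof -
  obtain \<alpha> where a: "\<alpha> \<in> \<Delta>" "s = refl \<alpha>" using assms simple_refls_E by blast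
  have l: "linear_A (T s \<circ> T s)" "linear_A (\<lambda>m. (upow 2 - 1) \<cdot>\<^sub>A T s m + upow 2 \<cdot>\<^sub>A m)"
    by (auto simp: linear_A_def linD[OF lin_T] smul.scale_right_distrib mult.commute)
  \<comment> \<open>Powers are kept as products of \<open>u\<close>, with \<open>upow_mult\<close>
    switched off, so that the block computation becomes a polynomial identity in
    \<open>u\<close>.\<close>
  have q: "upow 2 = u * u" by simp
  have "(T s \<circ> T s) (av w) = (upow 2 - 1) \<cdot>\<^sub>A T s (av w) + upow 2 \<cdot>\<^sub>A av w" if w: "w \<in> I" for w
  proof -
    note st = star_props[OF w a(1)] star_in_I[OF w a(1)]
    show ?thesis unfolding o_apply a(2)
      by (rule poly_mapping_eqI)
        (cases "pos (w \<alpha>)"; cases "refl \<alpha> \<circ> w = w \<circ> refl \<alpha>";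
          simp add: T_up T_down w a(1) st linD[OF lin_T] lookup_add del: upow_mult;
          simp add: q algebra_simps del: upow_mult)
  qed
  thus ?thesis using lin_eq_on[OF l assms(2)] by simp
qed

text \<open>From a shorter neighbour \<open>v\<close> of \<open>w\<close>,
  \<open>T (refl \<alpha>)\<close> returns \<open>w\<close>, up to the factor \<open>u + 1\<close>
  and a multiple of \<open>v\<close>. The set \<open>D\<close> restricts the directions of descent:
  two simple roots for the braid relation, one for commuting the bar with \<open>T s\<close>, and
  all of \<open>\<Delta>\<close> where only the identity is to remain at the bottom.\<close>

lemma M_generated:
  assumes N: "smul.subspace N" and down: "\<And>w. w \<in> I \<Longrightarrow> \<not> (\<exists>\<alpha>\<in>D. \<not> pos (w \<alpha>)) \<Longrightarrow> av w \<in> N"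
    and D: "D \<subseteq> \<Delta>" and T: "\<And>\<alpha> m. \<alpha> \<in> D \<Longrightarrow> m \<in> M \<Longrightarrow> m \<in> N \<Longrightarrow> T (refl \<alpha>) m \<in> N"
    and cancel: "\<And>m. m \<in> M \<Longrightarrow> (u + 1) \<cdot>\<^sub>A m \<in> N \<Longrightarrow> m \<in> N" and m: "m \<in> M"
  shows "m \<in> N"
proof (rule free_mod_induct[OF m N])
  fix w assume "w \<in> I"
  thus "av w \<in> N"
  proof (induction "l w" arbitrary: w rule: less_induct)
    case less
    show ?case
    proof (cases "\<exists>\<alpha>\<in>D. \<not> pos (w \<alpha>)")
      case True
      then obtain \<alpha> where a: "\<alpha> \<in> D" "\<alpha> \<in> \<Delta>" "\<not> pos (w \<alpha>)" using D by blast
      let ?v = "star (refl \<alpha>) w"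
      note st = star_props[OF less.prems a(2)] star_in_I[OF less.prems a(2)]
      have v: "pos (?v \<alpha>)" "star (refl \<alpha>) ?v = w" using st a by auto
      have "l ?v < l w" using len_star[OF st(5) a(2) v(1)] v(2) by (simp split: if_splits)
      hence vN: "av ?v \<in> N" using less.hyps st by blast
      hence TN: "T (refl \<alpha>) (av ?v) \<in> N" using T a st by simp
      have wM: "av w \<in> M" using less.prems by simp
      show ?thesis
      proof (cases "refl \<alpha> \<circ> ?v = ?v \<circ> refl \<alpha>")
        case True
        hence "(u + 1) \<cdot>\<^sub>A av w = T (refl \<alpha>) (av ?v) - u \<cdot>\<^sub>A av ?v"
          using T_up[OF st(5) a(2) v(1)] v(2) by simp
        thus ?thesis using cancel[OF wM] TN vN N by (simp add: smul.subspace_diff smul.subspace_scale)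
      next
        case False
        thus ?thesis using T_up[OF st(5) a(2) v(1)] v(2) TN by simp
      qed
    qed (use down less.prems in blast)
  qed
qed

end


section \<open>The braid relations\<close>

lemma altl_Suc_right: "altl f g (Suc k) = altl f g k \<circ> (if even k then f else g)"
proof (induction k arbitrary: f g)
  case (Suc k)
  have "altl g f (Suc k) = altl g f k \<circ> (if even k then g else f)" by (rule Suc)
  hence "f \<circ> altl g f (Suc k) = altl f g (Suc k) \<circ> (if even k then g else f)"
    by (simp only: altl.simps(2)[of f g k] o_assoc)
  thus "altl f g (Suc (Suc k)) = altl f g (Suc k) \<circ> (if even (Suc k) then f else g)"
    by (simp del: altl.simps add: altl.simps(2)[of f g "Suc k"])
qed simp

text \<open>The recurrence propagates \<open>D (a + j) = \<kappa> q\<^sup>j D (b - j)\<close> outwards until it reaches \<open>D 0\<close>.\<close>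
lemma reflect_zero:
  fixes \<Sigma> :: "('b \<Rightarrow>\<^sub>0 laurent) \<Rightarrow> ('b \<Rightarrow>\<^sub>0 laurent)"
  assumes linear_A: "linear_A \<Sigma>" and rec: "\<And>k. \<Sigma> (D (Suc k)) = D (Suc (Suc k)) + q \<cdot>\<^sub>A D k"
    and D0: "D 0 = 0" and base: "D a = \<kappa> \<cdot>\<^sub>A D b" "\<And>c. b = Suc c \<Longrightarrow> D (Suc a) = (\<kappa> * q) \<cdot>\<^sub>A D c"
  shows "D (a + b) = 0"
proof -
  have "j \<le> b \<Longrightarrow> D (a + j) = (\<kappa> * q ^ j) \<cdot>\<^sub>A D (b - j)" for j
  proof (induction j rule: less_induct)
    case (less j)
    consider "j = 0" | "j = 1" | i where "j = Suc (Suc i)"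
      by (cases j; cases "j - 1") auto
    thus ?case
    proof cases
      case 1 thus ?thesis using base by simp
    next
      case 2
      then obtain c where "b = Suc c" using less by (cases b) auto
      thus ?thesis using base 2 by simp
    next
      case 3
      define c where "c = b - j"
      have c: "b - i = Suc (Suc c)" and e: "b - Suc i = Suc c" "b - j = c"
        using less.prems 3 by (simp_all add: c_def)
      have "\<Sigma> (D (a + Suc i)) = D (a + j) + q \<cdot>\<^sub>A D (a + i)" using rec[of "a + i"] 3 by simp
      hence "D (a + j) = \<Sigma> (D (a + Suc i)) - q \<cdot>\<^sub>A D (a + i)" by simp
      also have "\<dots> = (\<kappa> * q ^ Suc i) \<cdot>\<^sub>A \<Sigma> (D (Suc c)) - q \<cdot>\<^sub>A (\<kappa> * q ^ i) \<cdot>\<^sub>A D (Suc (Suc c))"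
        using less.IH[of "Suc i"] less.IH[of i] less.prems 3 c e linD(2)[OF linear_A] by simp
      also have "\<dots> = (\<kappa> * q ^ j) \<cdot>\<^sub>A D c"
        by (simp add: rec smul.scale_right_distrib 3 algebra_simps)
      finally show ?thesis using e by simp
    qed
  qed
  from this[of b] show ?thesis using D0 by simp
qed

section \<open>The difference of the two alternating products\<close>

locale rank_two = based_root_system +
  fixes \<alpha> \<beta> :: 'a and m :: nat
  assumes \<alpha>: "\<alpha> \<in> \<Delta>" and \<beta>: "\<beta> \<in> \<Delta>" and \<alpha>_neq_\<beta>: "\<alpha> \<noteq> \<beta>" and braid: "braid_length \<alpha> \<beta> m"
begin

text \<open>Exchanging the roots turns \<open>A\<close> into \<open>B\<close>, so each result on
  \<open>A\<close>, \<open>x\<close> or \<open>cx\<close> is available for both products.\<close>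

lemma swap: "rank_two \<Phi> \<Delta> \<beta> \<alpha> m"
  using \<alpha> \<beta> \<alpha>_neq_\<beta> braid braid_length_commute
  by (intro rank_two.intro rank_two_axioms.intro based_root_system_axioms) auto

abbreviation "s \<equiv> refl \<alpha>"
abbreviation "t \<equiv> refl \<beta>"
abbreviation "x k \<equiv> x_alt \<alpha> \<beta> k"
abbreviation "A k \<equiv> alt (T s) (T t) k"
abbreviation "B k \<equiv> alt (T t) (T s) k"
abbreviation "ltr k \<equiv> letter \<alpha> \<beta> k"

lemma m_ge_2: "m \<ge> 2" using braid by (simp add: braid_length_def)

lemma simple_st: "s \<in> S" "t \<in> S" using \<alpha> \<beta> by (auto simp: simple_refls_def)

lemma ltr_in [simp]: "ltr k \<in> \<Delta>" using \<alpha> \<beta> by simp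

lemma len_x: "k \<le> m \<Longrightarrow> l (x k) = k" using braid by (simp add: braid_length_def)

lemma len_altl: "k \<le> m \<Longrightarrow> l (inv_alt \<alpha> \<beta> k) = k" "k \<le> m \<Longrightarrow> l (inv_alt \<beta> \<alpha> k) = k"
  using len_x rank_two.len_x[OF swap] \<alpha> \<beta> by (auto simp: altl_eq_alt)

lemma x_Suc: "x (Suc k) = refl (ltr k) \<circ> x k"
  unfolding alt_Suc_left by simp

lemma inv_alt_Suc: "inv_alt \<alpha> \<beta> (Suc k) = inv_alt \<alpha> \<beta> k \<circ> refl (ltr k)"
  unfolding altl_Suc_right by simp

text \<open>If the words agreed, the next letter of one would cancel the leftmost letter of the
  other, and the word of \<open>k + 1\<close> letters would have length
  \<open>k - 1\<close>.\<close>

lemma alt_neq: assumes "0 < k" "k < m" shows "x k \<noteq> x_alt \<beta> \<alpha> k"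
proof
  assume eq: "x k = x_alt \<beta> \<alpha> k"
  obtain j where j: "k = Suc j" using assms by (cases k) auto
  have "refl (ltr k) \<circ> x_alt \<beta> \<alpha> k = x_alt \<beta> \<alpha> j"
    unfolding j rank_two.x_Suc[OF swap] by simp
  hence "x (Suc k) = x_alt \<beta> \<alpha> j" using eq x_Suc[of k] by (simp del: alt.simps)
  hence "l (x (Suc k)) = l (x_alt \<beta> \<alpha> j)" by (rule arg_cong)
  thus False using len_x[of "Suc k"] rank_two.len_x[OF swap, of j] assms j by (simp del: alt.simps)
qed

lemma altl_eq_iff: assumes "0 < k" "k \<le> m"
  shows "inv_alt \<alpha> \<beta> k = inv_alt \<beta> \<alpha> k \<longleftrightarrow> k = m"
proof
  assume "inv_alt \<alpha> \<beta> k = inv_alt \<beta> \<alpha> k"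
  hence "x k = x_alt \<beta> \<alpha> k" by (metis inv_inv_alt)
  thus "k = m" using alt_neq assms by (metis le_neq_implies_less)
next
  assume "k = m"
  thus "inv_alt \<alpha> \<beta> k = inv_alt \<beta> \<alpha> k" using braid_length_inv[OF braid] by simp
qed

lemma lin_A: "linear_A (A k)"
proof (induction k rule: nat_less_induct)
  case (1 k)
  show ?case
  proof (cases k)
    case 0 show ?thesis unfolding 0 alt.simps by (rule lin_id)
  next
    case (Suc j)
    have "A k = (if even j then T s else T t) \<circ> A j" unfolding Suc alt_Suc_left ..
    moreover have "linear_A ((if even j then T s else T t) \<circ> A j)"
      using 1 Suc lin_T by (intro lin_o) auto
    ultimately show ?thesis by (simp only:)
  qed
qed

lemma A_Suc: "A (Suc k) v = T (refl (ltr k)) (A k v)"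
proof -
  have "A (Suc k) v = ((if even k then T s else T t) \<circ> A k) v" unfolding alt_Suc_left ..
  thus ?thesis by simp
qed

lemma A_in_M: "v \<in> M \<Longrightarrow> A k v \<in> M"
  by (induction k) (simp_all add: A_Suc T_in_M simple_st del: alt.simps(2))

text \<open>Parity decides which of the two operators adds a factor and which repeats the outermost
  one; the sum does not depend on it.\<close>

lemma T_sum_A:
  assumes "v \<in> M"
  shows "T s (A (Suc k) v) + T t (A (Suc k) v)
    = A (Suc (Suc k)) v + (upow 2 - 1) \<cdot>\<^sub>A A (Suc k) v + upow 2 \<cdot>\<^sub>A A k v"
proof -
  have "T (refl (ltr k)) (A (Suc k) v) = (upow 2 - 1) \<cdot>\<^sub>A A (Suc k) v + upow 2 \<cdot>\<^sub>A A k v"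
    unfolding A_Suc using T_quadratic A_in_M[OF assms] simple_st by simp
  moreover have "T s (A (Suc k) v) + T t (A (Suc k) v)
      = T (refl (ltr (Suc k))) (A (Suc k) v) + T (refl (ltr k)) (A (Suc k) v)"
    by (simp add: add.commute del: alt.simps)
  ultimately show ?thesis by (simp add: A_Suc del: alt.simps)
qed

definition D :: "(('a \<Rightarrow> 'a) \<Rightarrow>\<^sub>0 laurent) \<Rightarrow> nat \<Rightarrow> (('a \<Rightarrow> 'a) \<Rightarrow>\<^sub>0 laurent)" where
  "D v k = A k v - B k v"

lemma D_rec:
  assumes v: "v \<in> M"
  shows "T s (D v (Suc k)) + T t (D v (Suc k)) - (upow 2 - 1) \<cdot>\<^sub>A D v (Suc k)
    = D v (Suc (Suc k)) + upow 2 \<cdot>\<^sub>A D v k"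
proof -
  have "T s (D v (Suc k)) + T t (D v (Suc k))
      = (T s (A (Suc k) v) + T t (A (Suc k) v)) - (T t (B (Suc k) v) + T s (B (Suc k) v))"
      by (simp add: D_def linD[OF lin_T] del: alt.simps)
  also have "\<dots> = D v (Suc (Suc k)) + (upow 2 - 1) \<cdot>\<^sub>A D v (Suc k) + upow 2 \<cdot>\<^sub>A D v k"
      unfolding T_sum_A[OF v] rank_two.T_sum_A[OF swap v] D_def
      by (simp add: smul.scale_right_diff_distrib del: alt.simps)
  finally show ?thesis by simp
qed

lemma D_reflect:
  assumes v: "v \<in> M" and base: "D v a = \<kappa> \<cdot>\<^sub>A D v b"
    "\<And>c. b = Suc c \<Longrightarrow> D v (Suc a) = (\<kappa> * upow 2) \<cdot>\<^sub>A D v c"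
  shows "D v (a + b) = 0"
proof (rule reflect_zero[where q = "upow 2" and \<kappa> = \<kappa>])
  let ?\<Sigma> = "\<lambda>x. T s x + T t x - (upow 2 - 1) \<cdot>\<^sub>A x"
  show "linear_A ?\<Sigma>"
    by (simp add: linear_A_def linD[OF lin_T] smul.scale_right_distrib smul.scale_right_diff_distrib mult.commute)
  show "?\<Sigma> (D v (Suc k)) = D v (Suc (Suc k)) + upow 2 \<cdot>\<^sub>A D v k" for k by (rule D_rec[OF v])
qed (use base in \<open>simp_all add: D_def\<close>)

text \<open>The two middle indices are adjacent, and one relation between them suffices: the
  recurrence yields the next one, since the terms in \<open>D v n\<close> cancel exactly when
  \<open>\<kappa>\<close> squares to \<open>upow 2\<close>.\<close>

lemma D_reflect_odd:
  assumes v: "v \<in> M" and base: "D v (Suc n) = \<kappa> \<cdot>\<^sub>A D v n" and \<kappa>: "\<kappa> * \<kappa> = upow 2"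
  shows "D v (Suc (2 * n)) = 0"
proof -
  let ?\<Sigma> = "\<lambda>x. T s x + T t x - (upow 2 - 1) \<cdot>\<^sub>A x"
  have rec: "?\<Sigma> (D v (Suc k)) = D v (Suc (Suc k)) + upow 2 \<cdot>\<^sub>A D v k" for k by (rule D_rec[OF v])
  have "D v (Suc n + n) = 0"
  proof (rule D_reflect[OF v base])
    fix c assume n: "n = Suc c"
    have "D v (Suc (Suc n)) = ?\<Sigma> (D v (Suc n)) - upow 2 \<cdot>\<^sub>A D v n" using rec[of n] by simp
    also have "?\<Sigma> (D v (Suc n)) = \<kappa> \<cdot>\<^sub>A ?\<Sigma> (D v n)"
      unfolding base by (simp add: linD[OF lin_T] smul.scale_right_distrib smul.scale_right_diff_distrib mult.commute)
    also have "?\<Sigma> (D v n) = D v (Suc n) + upow 2 \<cdot>\<^sub>A D v c" using rec[of c] n by simp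
    also have "\<kappa> \<cdot>\<^sub>A (D v (Suc n) + upow 2 \<cdot>\<^sub>A D v c) - upow 2 \<cdot>\<^sub>A D v n = (\<kappa> * upow 2) \<cdot>\<^sub>A D v c"
      unfolding base by (simp add: smul.scale_right_distrib \<kappa>)
    finally show "D v (Suc (Suc n)) = (\<kappa> * upow 2) \<cdot>\<^sub>A D v c" .
  qed
  thus ?thesis by (simp add: mult_2)
qed

text \<open>Hence the vectors satisfying the braid relation form a submodule stable under \<open>T s\<close> and \<open>T t\<close>.\<close>
lemma braid_T_step:
  assumes v: "v \<in> M" and eq: "A m v = B m v"
  shows "A m (T s v) = B m (T s v)"
proof -
  obtain j where j: "m = Suc j" using m_ge_2 by (cases m) auto
  have "A m (T s v) = B j (T s (T s v))" by (simp add: j)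
  also have "\<dots> = (upow 2 - 1) \<cdot>\<^sub>A B j (T s v) + upow 2 \<cdot>\<^sub>A B j v"
    using T_quadratic[OF simple_st(1) v] linD[OF rank_two.lin_A[OF swap]] by simp
  also have "B j (T s v) = A m v" by (simp add: j)
  finally have 1: "A m (T s v) = (upow 2 - 1) \<cdot>\<^sub>A A m v + upow 2 \<cdot>\<^sub>A B j v" .
  have "A m v = B (Suc j) v" using eq unfolding j .
  also have "\<dots> = T (refl (letter \<beta> \<alpha> j)) (B j v)" by (rule rank_two.A_Suc[OF swap])
  also have "letter \<beta> \<alpha> j = ltr m" by (simp add: j)
  finally have Am: "A m v = T (refl (ltr m)) (B j v)" .
  have "B m (T s v) = A (Suc m) v" by simp
  also have "\<dots> = T (refl (ltr m)) (A m v)" by (rule A_Suc)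
  also have "T (refl (ltr m)) (A m v) = (upow 2 - 1) \<cdot>\<^sub>A A m v + upow 2 \<cdot>\<^sub>A B j v"
    unfolding Am using T_quadratic simple_st rank_two.A_in_M[OF swap v] by simp
  finally show ?thesis using 1 by simp
qed

text \<open>For a root this means membership in the rank two subsystem, with either sign;
  \<open>rank2_pos \<alpha> \<beta>\<close> is the positive part.\<close>

definition inJ :: "'a \<Rightarrow> bool" where "inJ \<gamma> \<longleftrightarrow> (\<forall>\<delta>\<in>\<Delta> - {\<alpha>, \<beta>}. cf \<delta> \<gamma> = 0)"

lemma inJ_rank2_group: "w \<in> rank2_group \<alpha> \<beta> \<Longrightarrow> inJ (w \<gamma>) \<longleftrightarrow> inJ \<gamma>"
  by (simp add: inJ_def rank2_group_def)

lemma inJ_swap: "rank_two.inJ \<Delta> \<beta> \<alpha> = inJ"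
  by (simp add: fun_eq_iff inJ_def rank_two.inJ_def[OF swap] insert_commute)

abbreviation "b k \<equiv> inv_alt \<alpha> \<beta> k (ltr k)"

lemma b_in: "k < m \<Longrightarrow> b k \<in> rank2_pos \<alpha> \<beta>"
  using braid_root[OF braid \<alpha> \<beta>] by simp

text \<open>Up to the common factor \<open>x k\<close>, the equation \<open>b k = \<beta>\<close>
  says that the two alternating words of \<open>k + 1\<close> letters agree, which first happens at
  \<open>m\<close>. So \<open>\<beta>\<close> is the last of the roots \<open>b k\<close>.\<close>

lemma b_eq_iff: assumes "k < m" shows "b k = \<beta> \<longleftrightarrow> k = m - 1"
proof -
  have W: "x k \<in> W" using \<alpha> \<beta> by simp
  have "x k (b k) = ltr k" by (simp add: altl_alt_inverse)
  hence "refl (ltr k) \<circ> x k = x k \<circ> refl (b k)" using refl_W_conj[OF W, of "b k"] by simp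
  hence 1: "x (Suc k) = x k \<circ> refl (b k)" unfolding x_Suc .
  have 2: "x_alt \<beta> \<alpha> (Suc k) = x k \<circ> refl \<beta>" by simp
  have "b k = \<beta> \<longleftrightarrow> x (Suc k) = x_alt \<beta> \<alpha> (Suc k)"
  proof
    assume "x (Suc k) = x_alt \<beta> \<alpha> (Suc k)"
    hence "inv (x k) \<circ> (x k \<circ> refl (b k)) = inv (x k) \<circ> (x k \<circ> refl \<beta>)" using 1 2 by metis
    hence "refl (b k) = refl \<beta>" using W_inv(5)[OF W] by metis
    then obtain c where c: "b k = c *\<^sub>R \<beta>" using refl_eqD[of "b k" \<beta>] rank2_pos_pos[OF b_in[OF assms]] by fastforce
    show "b k = \<beta>"
      by (rule simple_unique[OF rank2_pos_pos[OF b_in[OF assms]] \<beta>]) (use c \<beta> in simp)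
  qed (use 1 2 in metis)
  also have "\<dots> \<longleftrightarrow> Suc k = m"
    by (cases "Suc k = m")
      (use alt_neq[of "Suc k"] assms braid in \<open>auto simp: braid_length_def simp del: alt.simps\<close>)
  finally show ?thesis using assms by auto
qed

text \<open>The involution reached from \<open>c\<close> when the first \<open>k\<close> letters all
  act by conjugation.\<close>

definition cx :: "('a \<Rightarrow> 'a) \<Rightarrow> nat \<Rightarrow> 'a \<Rightarrow> 'a" where
  "cx c k = x k \<circ> c \<circ> inv_alt \<alpha> \<beta> k"

lemma cx_in_I: "c \<in> I \<Longrightarrow> cx c k \<in> I"
  using conj_in_I[of c "x k"] \<alpha> \<beta> by (simp add: cx_def)

lemma cx_Suc: "cx c (Suc k) = refl (ltr k) \<circ> cx c k \<circ> refl (ltr k)"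
  unfolding cx_def x_Suc inv_alt_Suc by (simp only: o_assoc)

lemma cx_ltr: "cx c k (ltr k) = x k (c (b k))"
  by (simp add: cx_def)

text \<open>A simple root with a positive image different from itself is not sent to plus or minus
  itself; the step then does not commute, and \<open>T\<close> merely conjugates the index.\<close>

lemma chain:
  assumes c: "c \<in> I" and up: "\<And>k. k < n \<Longrightarrow> pos (cx c k (ltr k)) \<and> cx c k (ltr k) \<noteq> ltr k"
  shows "A n (av c) = av (cx c n)"
  using up
proof (induction n)
  case 0 show ?case by (simp add: cx_def)
next
  case (Suc n)
  have p: "pos (cx c n (ltr n))" "cx c n (ltr n) \<noteq> ltr n" using Suc.prems[of n] by simp_all
  have "cx c n (ltr n) \<noteq> - ltr n" using p(1) by (metis ltr_in not_pos_uminus_base)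
  hence nc: "refl (ltr n) \<circ> cx c n \<noteq> cx c n \<circ> refl (ltr n)"
    using commutes_iff[OF I_in_W[OF cx_in_I[OF c]] ltr_in] p by blast
  have "A (Suc n) (av c) = T (refl (ltr n)) (av (cx c n))"
    unfolding A_Suc using Suc by (metis less_Suc_eq)
  also have "\<dots> = av (star (refl (ltr n)) (cx c n))"
    using T_up[OF cx_in_I[OF c] ltr_in p(1)] nc by (simp only: if_False)
  also have "star (refl (ltr n)) (cx c n) = cx c (Suc n)"
    unfolding star_def cx_Suc using nc by (rule if_not_P)
  finally show ?case .
qed

text \<open>Some coordinate outside the pair is positive at \<open>c (b k)\<close>, and
  \<open>x k\<close> preserves it. So the image of the current letter is positive and is neither of
  the two simple roots.\<close>

lemma chain_far:
  assumes c: "c \<in> I" and n: "n \<le> m"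
    and far: "\<And>k. k < n \<Longrightarrow> pos (c (b k)) \<and> \<not> inJ (c (b k))"
  shows "A n (av c) = av (cx c n)"
proof (rule chain[OF c])
  fix k assume k: "k < n"
  have xJ: "x k \<in> rank2_group \<alpha> \<beta>" using rank2_group_alt \<alpha> \<beta> by simp
  obtain \<delta> where d: "\<delta> \<in> \<Delta> - {\<alpha>, \<beta>}" "cf \<delta> (c (b k)) \<noteq> 0" using far[OF k] by (auto simp: inJ_def)
  hence g: "cf \<delta> (c (b k)) > 0" using pos_cf[of "c (b k)" \<delta>] far[OF k] by force
  have e: "cf \<delta> (x k (c (b k))) = cf \<delta> (c (b k))" using xJ d(1) unfolding rank2_group_def by blast
  have "x k (c (b k)) \<in> \<Phi>" using far[OF k] W_root[OF rank2_group_in_W[OF xJ]] pos_in by blast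
  hence "pos (x k (c (b k)))" using pos_if_cf_pos[of "x k (c (b k))" \<delta>] d(1) g unfolding e by blast
  moreover have "cf \<delta> (ltr k) = 0" using d(1) \<alpha> \<beta> by auto
  hence "x k (c (b k)) \<noteq> ltr k" using g unfolding e[symmetric] by (intro notI) (simp only: less_irrefl)
  ultimately have "pos (x k (c (b k)))" "x k (c (b k)) \<noteq> ltr k" by blast+
  thus "pos (cx c k (ltr k)) \<and> cx c k (ltr k) \<noteq> ltr k" unfolding cx_ltr by blast
qed

end

section \<open>The minimal involutions, case by case\<close>

lemma comp_altl_swap:
  assumes "f \<circ> s = s' \<circ> f" "f \<circ> t = t' \<circ> f"
  shows "f \<circ> altl s t k = altl s' t' k \<circ> f"
  using assms
proof (induction k arbitrary: s t s' t')
  case (Suc k)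
  have ih: "f \<circ> altl t s k = altl t' s' k \<circ> f" using Suc.prems by (intro Suc.IH)
  have "f \<circ> altl s t (Suc k) = (f \<circ> s) \<circ> altl t s k" by (simp only: altl.simps o_assoc)
  also have "\<dots> = s' \<circ> (f \<circ> altl t s k)" by (simp only: Suc.prems o_assoc)
  also have "\<dots> = altl s' t' (Suc k) \<circ> f" by (simp only: ih altl.simps o_assoc)
  finally show "f \<circ> altl s t (Suc k) = altl s' t' (Suc k) \<circ> f" .
qed simp

context rank_two
begin

text \<open>Since \<open>d \<beta>\<close> has a coordinate outside the pair and
  \<open>d \<alpha>\<close> has none, \<open>inJ (d \<gamma>)\<close> forces
  \<open>cf \<beta> \<gamma> = 0\<close>. As \<open>d\<close> is an involution,
  \<open>d \<alpha>\<close> is such a \<open>\<gamma>\<close>, and must be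
  \<open>\<alpha>\<close>.\<close>

lemma fixed_if_inJ:
  assumes d: "d \<in> I" "pos (d \<alpha>)" "pos (d \<beta>)" and J: "inJ (d \<alpha>)" "\<not> inJ (d \<beta>)"
  shows "d \<alpha> = \<alpha>" "\<gamma> \<in> rank2_pos \<alpha> \<beta> \<Longrightarrow> \<gamma> \<noteq> \<alpha> \<Longrightarrow> \<not> inJ (d \<gamma>)"
proof -
  have dW: "d \<in> W" using d I_in_W by blast
  note img = rank2_pos_W_image[OF _ dW \<alpha> \<beta> \<alpha>_neq_\<beta>]
  obtain \<delta> where dl: "\<delta> \<in> \<Delta> - {\<alpha>, \<beta>}" "cf \<delta> (d \<beta>) \<noteq> 0" using J by (auto simp: inJ_def)
  have key: "cf \<beta> \<gamma> = 0" if "\<gamma> \<in> rank2_pos \<alpha> \<beta>" "inJ (d \<gamma>)" for \<gamma>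
  proof -
    have "cf \<delta> (d \<gamma>) = cf \<alpha> \<gamma> * cf \<delta> (d \<alpha>) + cf \<beta> \<gamma> * cf \<delta> (d \<beta>)"
      using img(1)[OF that(1)] by simp
    moreover have "cf \<delta> (d \<gamma>) = 0" "cf \<delta> (d \<alpha>) = 0" using that J dl by (auto simp: inJ_def)
    ultimately show ?thesis using dl by simp
  qed
  have P: "d \<alpha> \<in> rank2_pos \<alpha> \<beta>" using d J by (simp add: rank2_pos_def inJ_def)
  have "inJ (d (d \<alpha>))" using I_I[OF d(1)] \<alpha> by (auto simp: inJ_def)
  hence "cf \<beta> (d \<alpha>) = 0" using key[OF P] by simp
  hence "cf \<delta> (d \<alpha>) = 0" if "\<delta> \<in> \<Delta>" "\<delta> \<noteq> \<alpha>" for \<delta> using J that by (cases "\<delta> = \<beta>") (auto simp: inJ_def)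
  thus "d \<alpha> = \<alpha>" by (rule simple_unique[OF d(2) \<alpha>])
  show "\<not> inJ (d \<gamma>)" if "\<gamma> \<in> rank2_pos \<alpha> \<beta>" "\<gamma> \<noteq> \<alpha>"
  proof
    assume "inJ (d \<gamma>)"
    hence "cf \<beta> \<gamma> = 0" using key that by blast
    hence "cf \<delta> \<gamma> = 0" if "\<delta> \<in> \<Delta>" "\<delta> \<noteq> \<alpha>" for \<delta>
      using \<open>\<gamma> \<in> rank2_pos \<alpha> \<beta>\<close> that by (cases "\<delta> = \<beta>") (auto simp: rank2_pos_def)
    hence "\<gamma> = \<alpha>" using simple_unique[OF _ \<alpha>] rank2_pos_pos that by blast
    thus False using that by blast
  qed
qed

text \<open>The coordinates involved are nonnegative, so nothing cancels: both coefficients of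
  \<open>\<gamma>\<close> would have to vanish.\<close>

lemma far_if_not_inJ:
  assumes d: "d \<in> I" "pos (d \<alpha>)" "pos (d \<beta>)" and J: "\<not> inJ (d \<alpha>)" "\<not> inJ (d \<beta>)" and g: "\<gamma> \<in> rank2_pos \<alpha> \<beta>"
  shows "\<not> inJ (d \<gamma>)"
proof
  assume J': "inJ (d \<gamma>)"
  have dW: "d \<in> W" using d I_in_W by blast
  note img = rank2_pos_W_image[OF g dW \<alpha> \<beta> \<alpha>_neq_\<beta>]
  have z: "cf \<alpha> \<gamma> * cf \<delta> (d \<alpha>) = 0" "cf \<beta> \<gamma> * cf \<delta> (d \<beta>) = 0" if dl: "\<delta> \<in> \<Delta> - {\<alpha>, \<beta>}" for \<delta>
  proof -
    have "cf \<delta> (d \<gamma>) = cf \<alpha> \<gamma> * cf \<delta> (d \<alpha>) + cf \<beta> \<gamma> * cf \<delta> (d \<beta>)" using img(1) by simp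
    hence "cf \<alpha> \<gamma> * cf \<delta> (d \<alpha>) + cf \<beta> \<gamma> * cf \<delta> (d \<beta>) = 0" using J' dl by (simp add: inJ_def)
    moreover have "cf \<alpha> \<gamma> * cf \<delta> (d \<alpha>) \<ge> 0" "cf \<beta> \<gamma> * cf \<delta> (d \<beta>) \<ge> 0"
      using mult_nonneg_nonneg[OF img(2) pos_cf[OF d(2)]] mult_nonneg_nonneg[OF img(3) pos_cf[OF d(3)]] dl
      by blast+
    ultimately show "cf \<alpha> \<gamma> * cf \<delta> (d \<alpha>) = 0" "cf \<beta> \<gamma> * cf \<delta> (d \<beta>) = 0" by linarith+
  qed
  obtain \<delta> \<epsilon> where "\<delta> \<in> \<Delta> - {\<alpha>, \<beta>}" "cf \<delta> (d \<alpha>) \<noteq> 0" "\<epsilon> \<in> \<Delta> - {\<alpha>, \<beta>}" "cf \<epsilon> (d \<beta>) \<noteq> 0"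
    using J unfolding inJ_def by blast
  hence 0: "cf \<alpha> \<gamma> = 0" "cf \<beta> \<gamma> = 0" using z by (metis mult_eq_0_iff)+
  have "\<gamma> = cf \<alpha> \<gamma> *\<^sub>R \<alpha> + cf \<beta> \<gamma> *\<^sub>R \<beta>"
    by (rule rank2_pos_expand) (use g \<alpha> \<beta> \<alpha>_neq_\<beta> in \<open>auto simp: rank2_pos_def\<close>)
  also have "\<dots> = 0" using 0 by simp
  finally have "\<gamma> = 0" .
  thus False using rank2_pos_pos[OF g] zero_notin by simp
qed

text \<open>On the span of the two roots \<open>d\<close> acts by a nonnegative matrix with square
  1, which is diagonal or antidiagonal; \<open>simple_unique\<close> then normalises the
  images.\<close>

lemma permuted_if_inJ:
  assumes d: "d \<in> I" "pos (d \<alpha>)" "pos (d \<beta>)" and J: "inJ (d \<alpha>)" "inJ (d \<beta>)"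
  shows "d \<alpha> = \<alpha> \<and> d \<beta> = \<beta> \<or> d \<alpha> = \<beta> \<and> d \<beta> = \<alpha>"
proof -
  have dW: "d \<in> W" using d I_in_W by blast
  note img = rank2_pos_W_image[OF _ dW \<alpha> \<beta> \<alpha>_neq_\<beta>]
  have P: "d \<alpha> \<in> rank2_pos \<alpha> \<beta>" "d \<beta> \<in> rank2_pos \<alpha> \<beta>" using d J by (simp_all add: rank2_pos_def inJ_def)
  define p q p' q' where pq: "p = cf \<alpha> (d \<alpha>)" "q = cf \<beta> (d \<alpha>)" "p' = cf \<alpha> (d \<beta>)" "q' = cf \<beta> (d \<beta>)"
  have nn: "p \<ge> 0" "q \<ge> 0" "p' \<ge> 0" "q' \<ge> 0" using d \<alpha> \<beta> pos_cf by (auto simp: pq)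
  have e: "\<alpha> = p *\<^sub>R d \<alpha> + q *\<^sub>R d \<beta>" "\<beta> = p' *\<^sub>R d \<alpha> + q' *\<^sub>R d \<beta>"
    using img(1)[OF P(1)] img(1)[OF P(2)] I_I[OF d(1)] by (simp_all add: pq)
  have 1: "p * p + q * p' = 1" "p * q + q * q' = 0" "p' * p + q' * p' = 0"
    using arg_cong[OF e(1), of "cf \<alpha>"] arg_cong[OF e(1), of "cf \<beta>"] arg_cong[OF e(2), of "cf \<alpha>"]
      \<alpha> \<beta> \<alpha>_neq_\<beta> by (simp_all add: pq)
  have other: "cf \<delta> (d \<alpha>) = 0" "cf \<delta> (d \<beta>) = 0" if "\<delta> \<in> \<Delta>" "\<delta> \<noteq> \<alpha>" "\<delta> \<noteq> \<beta>" for \<delta>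
    using J that by (auto simp: inJ_def)
  show ?thesis
  proof (cases "q = 0")
    case True
    have "d \<alpha> = \<alpha>"
      by (rule simple_unique[OF d(2) \<alpha>]) (use other True pq in metis)
    moreover have "p > 0" using 1 True nn by (cases "p = 0") auto
    hence "p' = 0" using 1(3) nn by (metis add_nonneg_eq_0_iff mult_eq_0_iff mult_nonneg_nonneg less_irrefl)
    hence "d \<beta> = \<beta>"
      by (intro simple_unique[OF d(3) \<beta>]) (use other pq in metis)
    ultimately show ?thesis by blast
  next
    case False
    hence "p = 0" using 1(2) nn by (metis add_nonneg_eq_0_iff mult_eq_0_iff mult_nonneg_nonneg)
    hence "d \<alpha> = \<beta>"
      by (intro simple_unique[OF d(2) \<beta>]) (use other pq in metis)
    thus ?thesis using I_I[OF d(1), of \<alpha>] by simp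
  qed
qed

text \<open>No step commutes, so both products conjugate \<open>d\<close> by the same element, the
  longest one of the rank two subgroup.\<close>

lemma bottom_none:
  assumes d: "d \<in> I" "pos (d \<alpha>)" "pos (d \<beta>)" and far: "\<And>\<gamma>. \<gamma> \<in> rank2_pos \<alpha> \<beta> \<Longrightarrow> \<not> inJ (d \<gamma>)"
  shows "A m (av d) = B m (av d)"
proof -
  have p: "pos (d \<gamma>)" if "\<gamma> \<in> rank2_pos \<alpha> \<beta>" for \<gamma>
    using rank2_pos_pos_image[OF that I_in_W[OF d(1)] \<alpha> \<beta> \<alpha>_neq_\<beta> d(2,3)] .
  have "A m (av d) = av (cx d m)"
    by (rule chain_far[OF d(1) order_refl]) (use p far b_in in blast)
  moreover have "B m (av d) = av (rank_two.cx \<beta> \<alpha> d m)"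
    by (rule rank_two.chain_far[OF swap d(1) order_refl])
      (use p far rank_two.b_in[OF swap] rank2_pos_commute inJ_swap in metis)
  moreover have "rank_two.cx \<beta> \<alpha> d m = cx d m"
    unfolding cx_def rank_two.cx_def[OF swap]
    using braid braid_length_inv[OF braid] by (simp only: braid_length_def)
  ultimately show ?thesis by simp
qed

text \<open>Both products meet the fixed root once: \<open>A m\<close> at its first factor,
  \<open>B m\<close> at its last. There the vector splits with coefficients \<open>u\<close> and
  \<open>u + 1\<close>; the other \<open>m - 1\<close> factors conjugate.\<close>

lemma bottom_one:
  assumes d: "d \<in> I" "pos (d \<alpha>)" "pos (d \<beta>)"
    and fixed: "d \<alpha> = \<alpha>" and far: "\<And>\<gamma>. \<gamma> \<in> rank2_pos \<alpha> \<beta> \<Longrightarrow> \<gamma> \<noteq> \<alpha> \<Longrightarrow> \<not> inJ (d \<gamma>)"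
  shows "A m (av d) = B m (av d)"
proof -
  let ?cx = "rank_two.cx \<beta> \<alpha>"
  obtain j where j: "m = Suc j" using m_ge_2 by (cases m) auto
  have dW: "d \<in> W" using d I_in_W by blast
  have comm: "s \<circ> d = d \<circ> s" using commutes_iff[OF dW \<alpha>] fixed by blast
  have sd: "star s d = s \<circ> d" unfolding star_def using comm by (rule if_P)
  have sdI: "s \<circ> d \<in> I" using star_in_I[OF d(1) \<alpha>] unfolding sd .
  have Ts: "T s (av d) = u \<cdot>\<^sub>A av d + (u + 1) \<cdot>\<^sub>A av (s \<circ> d)"
    using T_up[OF d(1) \<alpha> d(2)] comm unfolding sd by (simp only: if_True simp_thms)
  let ?b = "\<lambda>k. inv_alt \<beta> \<alpha> k (letter \<beta> \<alpha> k)"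
  have b: "?b k \<in> rank2_pos \<alpha> \<beta>" "?b k \<noteq> \<alpha>" if "k < j" for k
    using rank_two.b_in[OF swap, of k] rank_two.b_eq_iff[OF swap, of k] that j rank2_pos_commute[of \<alpha> \<beta>] by auto
  have p: "pos (d (?b k))" "\<not> inJ (d (?b k))" if "k < j" for k
    using rank2_pos_pos_image[OF b(1)[OF that] dW \<alpha> \<beta> \<alpha>_neq_\<beta> d(2,3)] far[OF b[OF that]] .
  have 1: "B j (av d) = av (?cx d j)"
    by (rule rank_two.chain_far[OF swap d(1)]) (use p j in \<open>simp_all only: inJ_swap\<close>, simp)
  have aJ: "inJ \<alpha>" using \<alpha> by (auto simp: inJ_def)
  have 2: "B j (av (s \<circ> d)) = av (?cx (s \<circ> d) j)"
  proof (rule rank_two.chain_far[OF swap sdI])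
    fix k assume k: "k < j"
    have "d (?b k) \<noteq> \<alpha>" using p(2)[OF k] aJ by metis
    hence "pos (s (d (?b k)))" using pos_refl_simple[OF \<alpha> p(1)[OF k]] by blast
    moreover have "\<not> inJ (s (d (?b k)))" using inJ_rank2_group[OF rank2_group_refl(1)[OF \<alpha>]] p(2)[OF k] by blast
    ultimately show "pos ((s \<circ> d) (?b k)) \<and> \<not> rank_two.inJ \<Delta> \<beta> \<alpha> ((s \<circ> d) (?b k))"
      unfolding inJ_swap o_apply by blast
  qed (use j in simp)
  let ?w = "?cx d j" and ?a = "letter \<beta> \<alpha> j" and ?x = "x_alt \<beta> \<alpha> j"
  have wI: "?w \<in> I" using rank_two.cx_in_I[OF swap d(1)] .
  \<comment> \<open>In the exchanged order \<open>\<alpha>\<close> is the last root of the sequence,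
    so the final letter meets the fixed root.\<close>
  have bj: "?b j = \<alpha>" using rank_two.b_eq_iff[OF swap, of j] j by simp
  have xa: "?x \<alpha> = ?a" using altl_alt_inverse(2)[of "refl \<beta>" "refl \<alpha>" j ?a] bj by simp
  have wa: "?w ?a = ?a" unfolding rank_two.cx_ltr[OF swap] bj fixed xa ..
  have aD: "?a \<in> \<Delta>" using \<alpha> \<beta> by simp
  have wcomm: "refl ?a \<circ> ?w = ?w \<circ> refl ?a" using commutes_iff[OF I_in_W[OF wI] aD] wa by blast
  have "star (refl ?a) ?w = refl ?a \<circ> ?w" unfolding star_def using wcomm by (rule if_P)
  also have "\<dots> = (refl (?x \<alpha>) \<circ> ?x) \<circ> d \<circ> inv_alt \<beta> \<alpha> j"
    unfolding rank_two.cx_def[OF swap] xa by (simp only: o_assoc)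
  also have "refl (?x \<alpha>) \<circ> ?x = ?x \<circ> s" using refl_W_conj \<alpha> \<beta> by simp
  also have "?x \<circ> s \<circ> d \<circ> inv_alt \<beta> \<alpha> j = ?cx (s \<circ> d) j"
    unfolding rank_two.cx_def[OF swap] by (simp only: o_assoc)
  finally have star: "star (refl ?a) ?w = ?cx (s \<circ> d) j" .
  have pa: "pos (?w ?a)" unfolding wa using pos_base[OF aD] .
  have "A m (av d) = B j (T s (av d))" by (simp add: j)
  also have "\<dots> = u \<cdot>\<^sub>A av ?w + (u + 1) \<cdot>\<^sub>A av (?cx (s \<circ> d) j)"
    unfolding Ts using linD[OF rank_two.lin_A[OF swap]] 1 2 by simp
  finally have 3: "A m (av d) = u \<cdot>\<^sub>A av ?w + (u + 1) \<cdot>\<^sub>A av (?cx (s \<circ> d) j)" .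
  have "B m (av d) = T (refl ?a) (av ?w)" unfolding j rank_two.A_Suc[OF swap] 1 ..
  also have "\<dots> = u \<cdot>\<^sub>A av ?w + (u + 1) \<cdot>\<^sub>A av (?cx (s \<circ> d) j)"
    using T_up[OF wI aD pa] wcomm unfolding star by (simp only: if_True simp_thms)
  finally show ?thesis using 3 by simp
qed

text \<open>The alternating word of \<open>n\<close> letters that begins with the leftmost letter of
  \<open>x k\<close>, or with \<open>\<beta>\<close> if \<open>k = 0\<close>.\<close>

definition Q :: "nat \<Rightarrow> nat \<Rightarrow> 'a \<Rightarrow> 'a" where
  "Q k n = (if even k then inv_alt \<beta> \<alpha> n else inv_alt \<alpha> \<beta> n)"

lemma x_inv_alt: "x k \<circ> inv_alt \<beta> \<alpha> j = Q k (k + j)"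
  unfolding Q_def by (rule alt_altl)

lemma Q_m: "Q k m = inv_alt \<alpha> \<beta> m"
  using altl_eq_iff[of m] m_ge_2 by (simp add: Q_def)

lemma Q_Suc: assumes "0 < n" "n \<le> m" shows "Q (Suc k) n = Q k n \<longleftrightarrow> n = m"
  using altl_eq_iff[OF assms] by (auto simp: Q_def)

text \<open>Here \<open>w\<close> is an alternating word times \<open>d\<close>. The next letter,
  multiplied on the left, lengthens the word at its left end; multiplied on the right, it passes
  through \<open>d\<close> and lengthens the right end. The two longer words agree exactly when they
  have \<open>m\<close> letters, so only the step to the top commutes.\<close>

lemma word_step:
  assumes w: "w \<in> I" "w = x k \<circ> inv_alt \<beta> \<alpha> j \<circ> d" and d: "d \<in> W"
    and dl: "d (ltr k) = letter \<beta> \<alpha> j" and le: "k + j < m"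
  shows "pos (w (ltr k))" "w (ltr k) = ltr k \<longleftrightarrow> Suc (k + j) = m"
    "refl (ltr k) \<circ> w = Q (Suc k) (Suc (k + j)) \<circ> d"
proof -
  let ?a = "ltr k" and ?a' = "letter \<beta> \<alpha> j"
  have aD: "?a \<in> \<Delta>" "?a' \<in> \<Delta>" using \<alpha> \<beta> by auto
  have lQ: "l (Q k n) = n" if "n \<le> m" for n using len_altl that by (simp add: Q_def)
  have QW: "Q k n \<in> W" for n using \<alpha> \<beta> by (simp add: Q_def)
  have wQ: "w = Q k (k + j) \<circ> d" unfolding w(2) x_inv_alt ..
  have R: "Q k (k + j) \<circ> refl ?a' = Q k (Suc (k + j))"
  proof -
    have "Q k (k + j) \<circ> refl ?a' = x k \<circ> (inv_alt \<beta> \<alpha> j \<circ> refl ?a')"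
      unfolding x_inv_alt[symmetric] by (simp only: o_assoc)
    also have "inv_alt \<beta> \<alpha> j \<circ> refl ?a' = inv_alt \<beta> \<alpha> (Suc j)" using rank_two.inv_alt_Suc[OF swap] ..
    also have "x k \<circ> inv_alt \<beta> \<alpha> (Suc j) = Q k (Suc (k + j))" unfolding x_inv_alt by simp
    finally show ?thesis .
  qed
  have "refl ?a \<circ> w = (refl ?a \<circ> x k) \<circ> inv_alt \<beta> \<alpha> j \<circ> d" unfolding w(2) by (simp only: o_assoc)
  also have "\<dots> = x (Suc k) \<circ> inv_alt \<beta> \<alpha> j \<circ> d" unfolding x_Suc ..
  finally show L: "refl ?a \<circ> w = Q (Suc k) (Suc (k + j)) \<circ> d" unfolding x_inv_alt by simp
  have wa: "w ?a = Q k (k + j) ?a'" unfolding wQ by (simp add: dl)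
  show p: "pos (w ?a)"
    using len_simple_right(1)[OF QW aD(2), of "k + j"] lQ[of "k + j"] lQ[of "Suc (k + j)"] le
    unfolding wa R by (simp split: if_splits)
  have "w \<circ> refl ?a = Q k (k + j) \<circ> (refl (d ?a) \<circ> d)"
    unfolding wQ refl_W_conj[OF d] by (simp only: o_assoc)
  also have "\<dots> = Q k (k + j) \<circ> refl ?a' \<circ> d" unfolding dl by (simp only: o_assoc)
  finally have wr: "w \<circ> refl ?a = Q k (Suc (k + j)) \<circ> d" unfolding R .
  have "w ?a \<noteq> - ?a" using p aD(1) not_pos_uminus_base by metis
  hence "w ?a = ?a \<longleftrightarrow> refl ?a \<circ> w = w \<circ> refl ?a" using commutes_iff[OF I_in_W[OF w(1)] aD(1)] by blast
  also have "\<dots> \<longleftrightarrow> Q (Suc k) (Suc (k + j)) \<circ> d = Q k (Suc (k + j)) \<circ> d" unfolding L wr ..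
  also have "\<dots> \<longleftrightarrow> Q (Suc k) (Suc (k + j)) = Q k (Suc (k + j))"
  proof
    assume "Q (Suc k) (Suc (k + j)) \<circ> d = Q k (Suc (k + j)) \<circ> d"
    hence "Q (Suc k) (Suc (k + j)) \<circ> d \<circ> inv d = Q k (Suc (k + j)) \<circ> d \<circ> inv d" by simp
    thus "Q (Suc k) (Suc (k + j)) = Q k (Suc (k + j))" using W_inv(4)[OF d] by (metis o_assoc comp_id)
  qed simp
  also have "\<dots> \<longleftrightarrow> Suc (k + j) = m" using le by (intro Q_Suc) auto
  finally show "w ?a = ?a \<longleftrightarrow> Suc (k + j) = m" .
qed

text \<open>\<open>cx c k\<close> is an alternating word of \<open>2 * k + e\<close> letters times
  \<open>d\<close>. For \<open>e = 0\<close> the chain starts at a \<open>d\<close> exchanging the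
  roots, for \<open>e = 1\<close> one step above a \<open>d\<close> fixing both. Parity decides
  whether the word of \<open>m\<close> letters is hit by a conjugation or by a final commuting
  step.\<close>

lemma chain_words:
  assumes c: "c \<in> I" and d: "d \<in> W" and cx: "\<And>k. cx c k = x k \<circ> inv_alt \<beta> \<alpha> (k + e) \<circ> d"
    and dl: "\<And>k. d (ltr k) = letter \<beta> \<alpha> (k + e)"
  shows "2 * n + e \<le> m \<Longrightarrow> A n (av c) = av (cx c n)"
    "Suc (2 * n + e) = m \<Longrightarrow> T (refl (ltr n)) (av (cx c n)) = u \<cdot>\<^sub>A av (cx c n) + (u + 1) \<cdot>\<^sub>A av (inv_alt \<alpha> \<beta> m \<circ> d)"
    "2 * n + e = m \<Longrightarrow> cx c n = inv_alt \<alpha> \<beta> m \<circ> d"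
proof -
  note st = word_step[OF cx_in_I[OF c] cx d dl]
  show "A n (av c) = av (cx c n)" if n: "2 * n + e \<le> m"
  proof (rule chain[OF c])
    fix k assume k: "k < n"
    have le: "k + (k + e) < m" "Suc (k + (k + e)) \<noteq> m" using n k by auto
    show "pos (cx c k (ltr k)) \<and> cx c k (ltr k) \<noteq> ltr k" using st(1,2)[OF le(1)] le(2) by blast
  qed
  show "T (refl (ltr n)) (av (cx c n)) = u \<cdot>\<^sub>A av (cx c n) + (u + 1) \<cdot>\<^sub>A av (inv_alt \<alpha> \<beta> m \<circ> d)"
    if n: "Suc (2 * n + e) = m"
  proof -
    have le: "n + (n + e) < m" "Suc (n + (n + e)) = m" using n by auto
    have "cx c n (ltr n) = ltr n" using st(2)[OF le(1)] le(2) by blast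
    hence comm: "refl (ltr n) \<circ> cx c n = cx c n \<circ> refl (ltr n)"
      using commutes_iff[OF I_in_W[OF cx_in_I[OF c]] ltr_in] by blast
    have "star (refl (ltr n)) (cx c n) = refl (ltr n) \<circ> cx c n" unfolding star_def using comm by (rule if_P)
    also have "\<dots> = inv_alt \<alpha> \<beta> m \<circ> d" unfolding st(3)[OF le(1)] le(2) Q_m ..
    finally have star: "star (refl (ltr n)) (cx c n) = inv_alt \<alpha> \<beta> m \<circ> d" .
    show ?thesis using T_up[OF cx_in_I[OF c] ltr_in st(1)[OF le(1)]] comm unfolding star by (simp only: if_True simp_thms)
  qed
  show "cx c n = inv_alt \<alpha> \<beta> m \<circ> d" if n: "2 * n + e = m"
  proof -
    have "n + (n + e) = m" using n by simp
    thus ?thesis unfolding cx x_inv_alt using Q_m by simp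
  qed
qed

lemma bottom_swap:
  assumes d: "d \<in> I" "d \<alpha> = \<beta>" "d \<beta> = \<alpha>"
  shows "D (av d) m = 0"
proof -
  have dW: "d \<in> W" using d I_in_W by blast
  have dM: "av d \<in> M" using d by simp
  have ds: "d \<circ> s = t \<circ> d" "d \<circ> t = s \<circ> d" using refl_W_conj[OF dW] d by metis+
  have cx: "cx d k = x k \<circ> inv_alt \<beta> \<alpha> (k + 0) \<circ> d" for k
    unfolding cx_def using comp_altl_swap[OF ds, of k] by (simp only: o_assoc[symmetric] add_0_right)
  have cx': "rank_two.cx \<beta> \<alpha> d k = x_alt \<beta> \<alpha> k \<circ> inv_alt \<alpha> \<beta> (k + 0) \<circ> d" for k
    unfolding rank_two.cx_def[OF swap] using comp_altl_swap[OF ds(2,1), of k]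
    by (simp only: o_assoc[symmetric] add_0_right)
  have dl: "d (ltr k) = letter \<beta> \<alpha> (k + 0)" "d (letter \<beta> \<alpha> k) = ltr (k + 0)" for k using d by simp_all
  note W = chain_words[OF d(1) dW cx dl(1)] rank_two.chain_words[OF swap d(1) dW cx' dl(2)]
  have top: "inv_alt \<beta> \<alpha> m = inv_alt \<alpha> \<beta> m" using braid_length_inv[OF braid] by simp
  show ?thesis
  proof (cases "even m")
    case True
    then obtain n where n: "m = 2 * n" by (elim evenE)
    have "A n (av d) = av (inv_alt \<alpha> \<beta> m \<circ> d)" using W(1)[of n] W(3)[of n] n by simp
    moreover have "B n (av d) = av (inv_alt \<alpha> \<beta> m \<circ> d)" using W(4)[of n] W(6)[of n] n top by simp
    ultimately have D: "D (av d) n = 0" by (simp add: D_def)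
    \<comment> \<open>Both ascents end at the same top after \<open>n\<close> factors, so
      \<open>D\<close> vanishes there and the recurrence reads
      \<open>D (n + 1) = - u^2 D (n - 1)\<close>; hence the scalar -1.\<close>
    have "D (av d) (n + n) = 0"
    proof (rule D_reflect[OF dM, where \<kappa> = "-1"])
      fix c assume c: "n = Suc c"
      show "D (av d) (Suc n) = (- 1 * upow 2) \<cdot>\<^sub>A D (av d) c"
        using D_rec[OF dM, of c] D c linD(3)[OF lin_T] by (simp add: eq_neg_iff_add_eq_0)
    qed (use D in simp)
    thus ?thesis using n by (simp add: mult_2)
  next
    case False
    then obtain n where n: "m = Suc (2 * n)" using oddE by (metis Suc_eq_plus1)
    have le: "2 * n + 0 \<le> m" "Suc (2 * n + 0) = m" using n by auto
    have "A (Suc n) (av d) = u \<cdot>\<^sub>A A n (av d) + (u + 1) \<cdot>\<^sub>A av (inv_alt \<alpha> \<beta> m \<circ> d)"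
      unfolding A_Suc W(1)[OF le(1)] W(2)[OF le(2)] ..
    moreover have "B (Suc n) (av d) = u \<cdot>\<^sub>A B n (av d) + (u + 1) \<cdot>\<^sub>A av (inv_alt \<alpha> \<beta> m \<circ> d)"
      unfolding rank_two.A_Suc[OF swap] W(4)[OF le(1)] W(5)[OF le(2)] top ..
    \<comment> \<open>Both ascents end with a commuting step to the same top. That term cancels,
      which leaves the scalar \<open>u\<close>.\<close>
    ultimately have "D (av d) (Suc n) = u \<cdot>\<^sub>A D (av d) n"
      unfolding D_def by (simp add: smul.scale_right_diff_distrib del: alt.simps)
    thus ?thesis unfolding n by (rule D_reflect_odd[OF dM]) simp
  qed
qed

text \<open>Both possible first steps commute. After this split, \<open>A\<close> with
  \<open>k + 1\<close> factors is expressed through \<open>B\<close> with \<open>k\<close> factors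
  and vice versa, which governs the signs of the scalars.\<close>

lemma bottom_both:
  assumes d: "d \<in> I" "d \<alpha> = \<alpha>" "d \<beta> = \<beta>"
  shows "D (av d) m = 0"
proof -
  have dW: "d \<in> W" using d I_in_W by blast
  have dM: "av d \<in> M" using d by simp
  have ds: "d \<circ> s = s \<circ> d" "d \<circ> t = t \<circ> d" using refl_W_conj[OF dW] d by metis+
  have st: "star s d = s \<circ> d" "star t d = t \<circ> d" unfolding star_def using ds[symmetric] by (simp_all only: if_True simp_thms)
  have I: "s \<circ> d \<in> I" "t \<circ> d \<in> I" using star_in_I[OF d(1)] \<alpha> \<beta> st by metis+
  have pd: "pos (d \<alpha>)" "pos (d \<beta>)" using d \<alpha> \<beta> by auto
  have T: "T s (av d) = u \<cdot>\<^sub>A av d + (u + 1) \<cdot>\<^sub>A av (s \<circ> d)"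
    "T t (av d) = u \<cdot>\<^sub>A av d + (u + 1) \<cdot>\<^sub>A av (t \<circ> d)"
    using T_up[OF d(1) \<alpha> pd(1)] T_up[OF d(1) \<beta> pd(2)] ds unfolding st by (simp_all only: if_True simp_thms)
  have cx: "cx (t \<circ> d) k = x k \<circ> inv_alt \<beta> \<alpha> (k + 1) \<circ> d" for k
  proof -
    have "cx (t \<circ> d) k = x k \<circ> (t \<circ> (d \<circ> inv_alt \<alpha> \<beta> k))" unfolding cx_def by (simp only: o_assoc)
    also have "\<dots> = x k \<circ> ((t \<circ> inv_alt \<alpha> \<beta> k) \<circ> d)"
      unfolding comp_altl_swap[OF ds, of k] by (simp only: o_assoc)
    finally show ?thesis by (simp only: o_assoc Suc_eq_plus1[symmetric] altl.simps)
  qed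
  have cx': "rank_two.cx \<beta> \<alpha> (s \<circ> d) k = x_alt \<beta> \<alpha> k \<circ> inv_alt \<alpha> \<beta> (k + 1) \<circ> d" for k
  proof -
    have "rank_two.cx \<beta> \<alpha> (s \<circ> d) k = x_alt \<beta> \<alpha> k \<circ> (s \<circ> (d \<circ> inv_alt \<beta> \<alpha> k))"
      unfolding rank_two.cx_def[OF swap] by (simp only: o_assoc)
    also have "\<dots> = x_alt \<beta> \<alpha> k \<circ> ((s \<circ> inv_alt \<beta> \<alpha> k) \<circ> d)"
      unfolding comp_altl_swap[OF ds(2,1), of k] by (simp only: o_assoc)
    finally show ?thesis by (simp only: o_assoc Suc_eq_plus1[symmetric] altl.simps)
  qed
  have dl: "d (ltr k) = letter \<beta> \<alpha> (k + 1)" "d (letter \<beta> \<alpha> k) = ltr (k + 1)" for k using d by simp_all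
  note W = chain_words[OF I(2) dW cx dl(1)] rank_two.chain_words[OF swap I(1) dW cx' dl(2)]
  have top: "inv_alt \<beta> \<alpha> m = inv_alt \<alpha> \<beta> m" using braid_length_inv[OF braid] by simp
  let ?R = "cx (t \<circ> d)" and ?R' = "rank_two.cx \<beta> \<alpha> (s \<circ> d)" and ?top = "av (inv_alt \<alpha> \<beta> m \<circ> d)"
  have A1: "A (Suc k) (av d) = u \<cdot>\<^sub>A B k (av d) + (u + 1) \<cdot>\<^sub>A B k (av (s \<circ> d))" for k
    using T linD[OF rank_two.lin_A[OF swap]] by simp
  have B1: "B (Suc k) (av d) = u \<cdot>\<^sub>A A k (av d) + (u + 1) \<cdot>\<^sub>A A k (av (t \<circ> d))" for k
    using T linD[OF lin_A] by simp
  show ?thesis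
  proof (cases "even m")
    case True
    then obtain n where n: "m = Suc (Suc (2 * n))" using m_ge_2
      by (metis evenE Suc_le_D add_2_eq_Suc le_add_diff_inverse mult_2_right dvd_add_triv_left_iff mult.commute)
    have le: "2 * n + 1 \<le> m" "Suc (2 * n + 1) = m" using n by auto
    have a: "A (Suc n) (av (t \<circ> d)) = u \<cdot>\<^sub>A A n (av (t \<circ> d)) + (u + 1) \<cdot>\<^sub>A ?top"
      unfolding A_Suc W(1)[OF le(1)] W(2)[OF le(2)] ..
    have b: "B (Suc n) (av (s \<circ> d)) = u \<cdot>\<^sub>A B n (av (s \<circ> d)) + (u + 1) \<cdot>\<^sub>A ?top"
      unfolding rank_two.A_Suc[OF swap] W(4)[OF le(1)] W(5)[OF le(2)] top ..
    have "D (av d) (Suc (Suc n)) = u \<cdot>\<^sub>A B (Suc n) (av d) + (u + 1) \<cdot>\<^sub>A B (Suc n) (av (s \<circ> d))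
        - (u \<cdot>\<^sub>A A (Suc n) (av d) + (u + 1) \<cdot>\<^sub>A A (Suc n) (av (t \<circ> d)))"
      unfolding D_def A1[of "Suc n"] B1[of "Suc n"] ..
    \<comment> \<open>The top terms cancel, and so do the terms in \<open>s \<circ> d\<close> and
      \<open>t \<circ> d\<close>: each arises twice with coefficient \<open>u (u + 1)\<close> and
      opposite signs.\<close>
    also have "\<dots> = (u * u) \<cdot>\<^sub>A D (av d) n"
      unfolding a b A1[of n] B1[of n] D_def
      by (rule poly_mapping_eqI) (simp add: lookup_add lookup_minus algebra_simps del: upow_mult alt.simps)
    finally have "D (av d) (Suc (Suc n)) = (1 * upow 2) \<cdot>\<^sub>A D (av d) n" by simp
    \<comment> \<open>Both middle indices are \<open>Suc n\<close>, so the first base condition is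
      trivial for the scalar 1.\<close>
    hence "D (av d) (Suc n + Suc n) = 0" by (intro D_reflect[OF dM, where \<kappa> = 1]) auto
    thus ?thesis using n by (simp add: mult_2)
  next
    case False
    then obtain n where n: "m = Suc (2 * n)" using oddE by (metis Suc_eq_plus1)
    have le: "2 * n + 1 \<le> m" "2 * n + 1 = m" using n by auto
    have "A n (av (t \<circ> d)) = ?top" unfolding W(1)[OF le(1)] W(3)[OF le(2)] ..
    moreover have "B n (av (s \<circ> d)) = ?top" unfolding W(4)[OF le(1)] W(6)[OF le(2)] top ..
    \<comment> \<open>\<open>A\<close> and \<open>B\<close> change places once, hence the minus
      sign; the square of the scalar is still \<open>upow 2\<close>.\<close>
    ultimately have "D (av d) (Suc n) = (- u) \<cdot>\<^sub>A D (av d) n"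
      unfolding D_def A1 B1 by (simp add: smul.scale_right_diff_distrib del: alt.simps)
    thus ?thesis unfolding n by (rule D_reflect_odd[OF dM]) simp
  qed
qed

lemma braid_T:
  assumes "v \<in> M"
  shows "altl (T s) (T t) m v = altl (T t) (T s) m v"
proof -
  have "v \<in> {v. A m v = B m v}"
  proof (rule M_generated[of _ "{\<alpha>, \<beta>}"])
    show "smul.subspace {v. A m v = B m v}"
      by (rule subspace_eqI[OF lin_A rank_two.lin_A[OF swap]])
    show "{\<alpha>, \<beta>} \<subseteq> \<Delta>" using \<alpha> \<beta> by simp
    show "T (refl \<gamma>) v \<in> {v. A m v = B m v}"
      if "\<gamma> \<in> {\<alpha>, \<beta>}" "v \<in> M" "v \<in> {v. A m v = B m v}" for \<gamma> v
      using that braid_T_step[of v] rank_two.braid_T_step[OF swap, of v] by auto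
    show "v \<in> {v. A m v = B m v}" if "(u + 1) \<cdot>\<^sub>A v \<in> {v. A m v = B m v}" for v
      using that smul_cancel[OF upow_plus_1_nonzero[of 1]] linD(2)[OF lin_A]
        linD(2)[OF rank_two.lin_A[OF swap]] by auto
    fix d assume dI: "d \<in> I" and "\<not> (\<exists>\<gamma>\<in>{\<alpha>, \<beta>}. \<not> pos (d \<gamma>))"
    hence d: "d \<in> I" "pos (d \<alpha>)" "pos (d \<beta>)" by auto
    consider "inJ (d \<alpha>)" "inJ (d \<beta>)" | "inJ (d \<alpha>)" "\<not> inJ (d \<beta>)" | "\<not> inJ (d \<alpha>)" "inJ (d \<beta>)"
      | "\<not> inJ (d \<alpha>)" "\<not> inJ (d \<beta>)" by blast
    hence "A m (av d) = B m (av d)"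
    proof cases
      case 1
      hence "D (av d) m = 0"
        using permuted_if_inJ[OF d] bottom_both[OF d(1)] bottom_swap[OF d(1)] by blast
      thus ?thesis by (simp add: D_def)
    next
      case 2
      show ?thesis by (rule bottom_one[OF d fixed_if_inJ[OF d 2]])
    next
      case 3
      have 3: "rank_two.inJ \<Delta> \<beta> \<alpha> (d \<beta>)" "\<not> rank_two.inJ \<Delta> \<beta> \<alpha> (d \<alpha>)" using 3 inJ_swap by auto
      show ?thesis
        by (rule rank_two.bottom_one[OF swap d(1,3,2) rank_two.fixed_if_inJ[OF swap d(1,3,2) 3], symmetric])
    next
      case 4
      show ?thesis by (rule bottom_none[OF d far_if_not_inJ[OF d 4]])
    qed
    thus "av d \<in> {v. A m v = B m v}" by simp
  qed (use assms in simp)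
  \<comment> \<open>For even \<open>m\<close>, passing from right-anchored to left-anchored products
    exchanges the two sides of the equation.\<close>
  thus ?thesis by (auto simp: alt_eq_altl split: if_splits)
qed

end


section \<open>The Bruhat order\<close>

context based_root_system
begin

lemma braid_T:
  assumes "\<alpha> \<in> \<Delta>" "\<beta> \<in> \<Delta>" "\<alpha> \<noteq> \<beta>" "braid_length \<alpha> \<beta> m" "v \<in> M"
  shows "altl (T (refl \<alpha>)) (T (refl \<beta>)) m v = altl (T (refl \<beta>)) (T (refl \<alpha>)) m v"
  using assms
  by (intro rank_two.braid_T rank_two.intro rank_two_axioms.intro based_root_system_axioms)

lemma bruhat_le_in_W: "bruhat_le \<Phi> \<Delta> y w \<Longrightarrow> w \<in> W \<Longrightarrow> y \<in> W"
  unfolding bruhat_le_def by (erule converse_rtranclpE) (auto simp: bruhat_step_def)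

lemma bruhat_le_refl [simp]: "bruhat_le \<Phi> \<Delta> w w"
  by (simp add: bruhat_le_def)

lemma bruhat_le_trans: "bruhat_le \<Phi> \<Delta> x y \<Longrightarrow> bruhat_le \<Phi> \<Delta> y z \<Longrightarrow> bruhat_le \<Phi> \<Delta> x z"
  by (simp add: bruhat_le_def)

lemma bruhat_le_len: "bruhat_le \<Phi> \<Delta> y w \<Longrightarrow> l y \<le> l w"
  unfolding bruhat_le_def by (induction rule: rtranclp_induct) (auto simp: bruhat_step_def)

lemma bruhat_stepE:
  assumes "bruhat_step \<Phi> \<Delta> y z"
  obtains \<gamma> where "pos \<gamma>" "y \<in> W" "z = refl \<gamma> \<circ> y" "pos (inv y \<gamma>)"
proof -
  obtain \<gamma> where g: "\<gamma> \<in> \<Phi>" "y \<in> W" "z = refl \<gamma> \<circ> y" "l y < l z"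
    using assms by (auto simp: bruhat_step_def)
  define \<gamma>' where "\<gamma>' = (if pos \<gamma> then \<gamma> else - \<gamma>)"
  have "pos \<gamma>'" "refl \<gamma>' = refl \<gamma>" using g pos_uminus by (auto simp: \<gamma>'_def)
  thus ?thesis using that[of \<gamma>'] g len_refl_iff[of y \<gamma>'] by simp
qed

lemma bruhat_stepI:
  "y \<in> W \<Longrightarrow> pos \<gamma> \<Longrightarrow> pos (inv y \<gamma>) \<Longrightarrow> bruhat_step \<Phi> \<Delta> y (refl \<gamma> \<circ> y)"
  using len_refl_iff[of y \<gamma>] by (auto simp: bruhat_step_def)

text \<open>At \<open>\<gamma> = \<alpha>\<close> the step collapses. Otherwise
  \<open>refl \<alpha>\<close> keeps \<open>\<gamma>\<close> positive, and multiplication gives a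
  step at the reflected root.\<close>

lemma bruhat_step_simple:
  assumes "bruhat_step \<Phi> \<Delta> y z" "\<alpha> \<in> \<Delta>"
  shows "refl \<alpha> \<circ> y = z \<or> bruhat_step \<Phi> \<Delta> (refl \<alpha> \<circ> y) (refl \<alpha> \<circ> z)"
proof -
  obtain \<gamma> where g: "pos \<gamma>" "y \<in> W" "z = refl \<gamma> \<circ> y" "pos (inv y \<gamma>)" using bruhat_stepE[OF assms(1)] .
  show ?thesis
  proof (cases "\<gamma> = \<alpha>")
    case False
    have r: "refl \<alpha> \<in> W" using refl_in_W assms by simp
    have "pos (refl \<alpha> \<gamma>)" using pos_refl_simple assms g False by blast
    moreover have "pos (inv (refl \<alpha> \<circ> y) (refl \<alpha> \<gamma>))" using g inv_comp_W[OF r g(2)] by simp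
    ultimately have "bruhat_step \<Phi> \<Delta> (refl \<alpha> \<circ> y) (refl (refl \<alpha> \<gamma>) \<circ> (refl \<alpha> \<circ> y))"
      using bruhat_stepI comp_in_W[OF r g(2)] by blast
    moreover have "refl (refl \<alpha> \<gamma>) \<circ> (refl \<alpha> \<circ> y) = refl \<alpha> \<circ> z"
      using refl_conj_refl[of \<alpha> \<gamma>] unfolding g(3) by (simp only: o_assoc)
    ultimately show ?thesis by simp
  qed (use g in blast)
qed

text \<open>Along a chain from \<open>y\<close> to \<open>w\<close>, the multiplied steps are
  followed until one collapses; from there on the original chain is used.\<close>

lemma bruhat_lift:
  assumes "bruhat_le \<Phi> \<Delta> y w" "\<alpha> \<in> \<Delta>"
  shows "bruhat_le \<Phi> \<Delta> (refl \<alpha> \<circ> y) w \<or> bruhat_le \<Phi> \<Delta> (refl \<alpha> \<circ> y) (refl \<alpha> \<circ> w)"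
  using assms(1) unfolding bruhat_le_def
proof (induction rule: converse_rtranclp_induct)
  case (step y z)
  consider "refl \<alpha> \<circ> y = z" | "bruhat_step \<Phi> \<Delta> (refl \<alpha> \<circ> y) (refl \<alpha> \<circ> z)"
    using bruhat_step_simple[OF step(1) assms(2)] by metis
  thus "(bruhat_step \<Phi> \<Delta>)\<^sup>*\<^sup>* (refl \<alpha> \<circ> y) w \<or> (bruhat_step \<Phi> \<Delta>)\<^sup>*\<^sup>* (refl \<alpha> \<circ> y) (refl \<alpha> \<circ> w)"
  proof cases
    case 1 thus ?thesis using step(2) by metis
  next
    case 2 thus ?thesis using step.IH by (metis converse_rtranclp_into_rtranclp)
  qed
qed simp

text \<open>A descent puts \<open>refl \<alpha> \<circ> w\<close> below \<open>w\<close>, so both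
  alternatives of \<open>bruhat_lift\<close> end below \<open>w\<close>.\<close>

lemma bruhat_le_simple_left:
  assumes "w \<in> W" "\<alpha> \<in> \<Delta>" "\<not> pos (inv w \<alpha>)" "bruhat_le \<Phi> \<Delta> y w"
  shows "bruhat_le \<Phi> \<Delta> (refl \<alpha> \<circ> y) w"
proof -
  have r: "refl \<alpha> \<in> W" using refl_in_W assms by simp
  have "- inv w \<alpha> = inv (refl \<alpha> \<circ> w) \<alpha>"
    using inv_comp_W[OF r assms(1)] W_uminus[OF inv_in_W[OF assms(1)], of \<alpha>] assms(2) by simp
  hence "pos (inv (refl \<alpha> \<circ> w) \<alpha>)"
    using assms pos_uminus[of "inv w \<alpha>"] inv_in_W by simp
  hence "bruhat_step \<Phi> \<Delta> (refl \<alpha> \<circ> w) (refl \<alpha> \<circ> (refl \<alpha> \<circ> w))"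
    using bruhat_stepI[OF comp_in_W[OF r assms(1)]] assms(2) pos_base by blast
  hence "bruhat_le \<Phi> \<Delta> (refl \<alpha> \<circ> w) w" by (simp add: bruhat_le_def r_into_rtranclp)
  thus ?thesis using bruhat_lift[OF assms(4,2)] bruhat_le_trans by metis
qed

text \<open>Inverting \<open>refl \<gamma> \<circ> y\<close> gives a step at the root
  \<open>inv y \<gamma>\<close>. This transfers results on left multiplication to the right.\<close>

lemma bruhat_le_inv:
  assumes "bruhat_le \<Phi> \<Delta> y w" "w \<in> W"
  shows "bruhat_le \<Phi> \<Delta> (inv y) (inv w)"
  using assms(1) unfolding bruhat_le_def
proof (induction rule: converse_rtranclp_induct)
  case (step y z)
  obtain \<gamma> where g: "pos \<gamma>" "y \<in> W" "z = refl \<gamma> \<circ> y" "pos (inv y \<gamma>)" using bruhat_stepE[OF step(1)] .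
  have "inv z = inv y \<circ> refl \<gamma>" using inv_comp_W[OF refl_in_W g(2), of \<gamma>] g by simp
  also have "\<dots> = refl (inv y \<gamma>) \<circ> inv y" using refl_W_conj[OF inv_in_W[OF g(2)]] by metis
  finally have "bruhat_step \<Phi> \<Delta> (inv y) (inv z)"
    using bruhat_stepI[OF inv_in_W[OF g(2)] g(4)] g(1,2) by simp
  thus ?case using step.IH by (metis converse_rtranclp_into_rtranclp)
qed simp

lemma bruhat_le_simple_right:
  assumes "w \<in> W" "\<alpha> \<in> \<Delta>" "\<not> pos (w \<alpha>)" "bruhat_le \<Phi> \<Delta> y w"
  shows "bruhat_le \<Phi> \<Delta> (y \<circ> refl \<alpha>) w"
proof -
  have y: "y \<in> W" using bruhat_le_in_W assms by blast
  have r: "refl \<alpha> \<in> W" using refl_in_W assms by simp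
  have iw: "inv w \<in> W" using inv_in_W assms by blast
  have "\<not> pos (inv (inv w) \<alpha>)" using assms by simp
  hence "bruhat_le \<Phi> \<Delta> (refl \<alpha> \<circ> inv y) (inv w)"
    using bruhat_le_simple_left[OF iw assms(2)] bruhat_le_inv[OF assms(4,1)] by blast
  hence "bruhat_le \<Phi> \<Delta> (inv (refl \<alpha> \<circ> inv y)) (inv (inv w))" using bruhat_le_inv iw by blast
  moreover have "inv (refl \<alpha> \<circ> inv y) = y \<circ> refl \<alpha>" using inv_comp_W[OF r inv_in_W[OF y]] y by simp
  ultimately show ?thesis using assms(1) by simp
qed

lemma bruhat_le_star:
  assumes "w \<in> I" "\<alpha> \<in> \<Delta>" "\<not> pos (w \<alpha>)" "bruhat_le \<Phi> \<Delta> y w"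
  shows "bruhat_le \<Phi> \<Delta> (star (refl \<alpha>) y) w"
proof -
  have w: "w \<in> W" "inv w = w" using assms I_in_W I_inv by auto
  have "\<not> pos (inv w \<alpha>)" unfolding w(2) by (rule assms(3))
  hence 1: "bruhat_le \<Phi> \<Delta> (refl \<alpha> \<circ> y) w" using bruhat_le_simple_left[OF w(1) assms(2) _ assms(4)] by blast
  have 2: "bruhat_le \<Phi> \<Delta> (refl \<alpha> \<circ> y \<circ> refl \<alpha>) w" by (rule bruhat_le_simple_right[OF w(1) assms(2,3) 1])
  have "star (refl \<alpha>) y \<in> {refl \<alpha> \<circ> y, refl \<alpha> \<circ> y \<circ> refl \<alpha>}" unfolding star_def by (simp only: insert_iff split: if_split) blast
  thus ?thesis using 1 2 by (metis insertE singletonD)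
qed

lemma W_left_induct [consumes 1, case_names id step]:
  assumes "w \<in> W" and id: "P id"
    and step: "\<And>v \<alpha>. v \<in> W \<Longrightarrow> \<alpha> \<in> \<Delta> \<Longrightarrow> pos (inv v \<alpha>) \<Longrightarrow> P v \<Longrightarrow> P (refl \<alpha> \<circ> v)"
  shows "P w"
  using assms(1)
proof (induction "l w" arbitrary: w rule: less_induct)
  case less
  show ?case
  proof (cases "w = id")
    case False
    have iw: "inv w \<in> W" using inv_in_W less.prems .
    have "inv w \<noteq> id"
    proof
      assume "inv w = id"
      hence "w \<circ> inv w = w" by simp
      thus False using W_inv(4)[OF less.prems] False by metis
    qed
    then obtain \<alpha> where a: "\<alpha> \<in> \<Delta>" "\<not> pos (inv w \<alpha>)" using W_eq_id[OF iw] by blast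
    let ?v = "refl \<alpha> \<circ> w"
    have r: "refl \<alpha> \<in> W" using refl_in_W a by simp
    have v: "?v \<in> W" using comp_in_W[OF r less.prems] .
    have "- inv w \<alpha> = inv ?v \<alpha>"
      using inv_comp_W[OF r less.prems] W_uminus[OF iw, of \<alpha>] a(1) by simp
    hence p: "pos (inv ?v \<alpha>)" using a pos_uminus[of "inv w \<alpha>"] iw by simp
    have "l ?v < l w" using len_simple[OF less.prems a(1)] a(2) by simp
    hence "P ?v" using less.hyps v by blast
    hence "P (refl \<alpha> \<circ> ?v)" using step v a(1) p by blast
    moreover have "refl \<alpha> \<circ> ?v = w" by simp
    ultimately show ?thesis by metis
  next
    case True thus ?thesis using id by metis
  qed
qed


section \<open>The module structure\<close>

text \<open>\<open>matsumoto\<close> asks for an equality of functions, but the braid relations are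
  known only on \<open>M\<close>; outside \<open>M\<close> the operator is replaced by the
  identity.\<close>

definition TM :: "('a \<Rightarrow> 'a) \<Rightarrow> (('a \<Rightarrow> 'a) \<Rightarrow>\<^sub>0 laurent) \<Rightarrow> (('a \<Rightarrow> 'a) \<Rightarrow>\<^sub>0 laurent)" where
  "TM s v = (if v \<in> M then T s v else v)"

lemma word_prod_T_in_M: "set ss \<subseteq> S \<Longrightarrow> v \<in> M \<Longrightarrow> word_prod (map T ss) v \<in> M"
  by (induction ss) (auto intro: T_in_M)

lemma word_prod_TM: "set ss \<subseteq> S \<Longrightarrow> word_prod (map TM ss) v = (if v \<in> M then word_prod (map T ss) v else v)"
  by (induction ss) (auto simp: TM_def word_prod_T_in_M)

lemma reduced_word_words_T:
  assumes "reduced_word ss" "reduced_word ts" "word_prod ss = word_prod ts" "v \<in> M"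
  shows "word_prod (map T ss) v = word_prod (map T ts) v"
proof -
  have "word_prod (map TM ss) = word_prod (map TM ts)"
  proof (rule matsumoto[OF _ assms(1-3)])
    fix \<alpha> \<beta> m assume *: "\<alpha> \<in> \<Delta>" "\<beta> \<in> \<Delta>" "\<alpha> \<noteq> \<beta>" "braid_length \<alpha> \<beta> m"
    have S: "set (altw (refl \<alpha>) (refl \<beta>) m) \<subseteq> S" "set (altw (refl \<beta>) (refl \<alpha>) m) \<subseteq> S"
      using set_altw[of "refl \<alpha>" "refl \<beta>" m] set_altw[of "refl \<beta>" "refl \<alpha>" m] *
      by (auto simp: simple_refls_def)
    show "altl (TM (refl \<alpha>)) (TM (refl \<beta>)) m = altl (TM (refl \<beta>)) (TM (refl \<alpha>)) m"
      using word_prod_TM[OF S(1)] word_prod_TM[OF S(2)] braid_T[OF *] unfolding word_prod_altw by (intro ext) simp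
  qed
  thus ?thesis using assms word_prod_TM[of ss v] word_prod_TM[of ts v] by (simp add: reduced_word_def)
qed

definition T_of :: "('a \<Rightarrow> 'a) \<Rightarrow> (('a \<Rightarrow> 'a) \<Rightarrow>\<^sub>0 laurent) \<Rightarrow> (('a \<Rightarrow> 'a) \<Rightarrow>\<^sub>0 laurent)" where
  "T_of w = word_prod (map T (SOME ss. reduced_word ss \<and> w = word_prod ss))"

lemma T_of_word: assumes "w \<in> W" shows "\<exists>ss. reduced_word ss \<and> w = word_prod ss \<and> T_of w = word_prod (map T ss)"
  unfolding T_of_def using someI_ex[OF reduced_word_ex[OF assms]] by blast

lemma T_of_eq: assumes "reduced_word ss" "v \<in> M" shows "T_of (word_prod ss) v = word_prod (map T ss) v"
proof -
  have "word_prod ss \<in> W" using assms prod_in_W by (simp add: reduced_word_def)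
  then obtain ts where "reduced_word ts" "word_prod ss = word_prod ts" "T_of (word_prod ss) = word_prod (map T ts)" using T_of_word by metis
  thus ?thesis using reduced_word_words_T[OF assms(1) _ _ assms(2)] by metis
qed

lemma lin_T_of: "linear_A (T_of w)"
  unfolding T_of_def by (rule lin_word_prod) (auto simp: lin_T)

lemma T_of_in_M: assumes "w \<in> W" "v \<in> M" shows "T_of w v \<in> M"
proof -
  obtain ss where "reduced_word ss" "T_of w = word_prod (map T ss)" using T_of_word assms by metis
  thus ?thesis using word_prod_T_in_M assms by (simp add: reduced_word_def)
qed

lemma T_of_id: "v \<in> M \<Longrightarrow> T_of id v = v"
  using T_of_eq[of "[]" v] by (simp add: reduced_word_def)

lemma T_of_step:
  assumes "w \<in> W" "\<alpha> \<in> \<Delta>" "pos (inv w \<alpha>)" "v \<in> M"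
  shows "T_of (refl \<alpha> \<circ> w) v = T (refl \<alpha>) (T_of w v)"
proof -
  obtain ss where ss: "reduced_word ss" "w = word_prod ss" "T_of w = word_prod (map T ss)" using T_of_word assms by metis
  have "reduced_word (refl \<alpha> # ss)"
    using ss len_simple(1)[OF assms(1,2)] assms by (simp add: reduced_word_def simple_refls_def)
  thus ?thesis using T_of_eq[of "refl \<alpha> # ss" v] ss assms by simp
qed

lemma T_of_simple: assumes "\<alpha> \<in> \<Delta>" "v \<in> M" shows "T_of (refl \<alpha>) v = T (refl \<alpha>) v"
  using T_of_step[OF weyl_group.one assms(1) _ assms(2)] assms by (simp add: T_of_id)

definition act :: "(('a \<Rightarrow> 'a) \<Rightarrow>\<^sub>0 laurent) \<Rightarrow> (('a \<Rightarrow> 'a) \<Rightarrow>\<^sub>0 laurent) \<Rightarrow> (('a \<Rightarrow> 'a) \<Rightarrow>\<^sub>0 laurent)" where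
  "act h v = sext (\<lambda>c. c) (\<lambda>w. T_of w v) h"

lemma lin_act_left: "linear_A (\<lambda>h. act h v)"
  unfolding act_def using lin_sext .

lemma lin_act: "linear_A (act h)"
  unfolding linear_A_def act_def sext_def
  by (simp add: linD[OF lin_T_of] smul.scale_right_distrib sum.distrib smul.scale_sum_right mult.commute)

lemma act_basis [simp]: "act (av w) v = T_of w v"
  by (simp add: act_def)

abbreviation "H \<equiv> hecke_carrier \<Phi>"

lemma act_in_M: "h \<in> H \<Longrightarrow> v \<in> M \<Longrightarrow> act h v \<in> M"
  unfolding act_def by (rule sext_closed[OF _ subspace_free_mod]) (auto intro: T_of_in_M)

text \<open>The inverse of \<open>T s\<close> on \<open>M\<close>, solved from the quadratic
  relation.\<close>

definition Ti :: "('a \<Rightarrow> 'a) \<Rightarrow> (('a \<Rightarrow> 'a) \<Rightarrow>\<^sub>0 laurent) \<Rightarrow> (('a \<Rightarrow> 'a) \<Rightarrow>\<^sub>0 laurent)" where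
  "Ti s v = upow (- 2) \<cdot>\<^sub>A T s v - (1 - upow (- 2)) \<cdot>\<^sub>A v"

lemma lin_Ti: "linear_A (Ti s)"
  by (simp add: linear_A_def Ti_def linD[OF lin_T] smul.scale_right_distrib
      smul.scale_right_diff_distrib mult.commute)

lemma Ti_T: assumes "s \<in> S" "v \<in> M" shows "Ti s (T s v) = v"
  unfolding Ti_def T_quadratic[OF assms]
  by (rule poly_mapping_eqI)
    (simp add: lookup_add lookup_minus distrib_left right_diff_distrib left_diff_distrib
      mult.assoc[symmetric])

lemma T_Ti: assumes "s \<in> S" "v \<in> M" shows "T s (Ti s v) = v"
  unfolding Ti_def linD[OF lin_T] T_quadratic[OF assms]
  by (rule poly_mapping_eqI)
    (simp add: lookup_add lookup_minus distrib_left right_diff_distrib left_diff_distrib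
      mult.assoc[symmetric])

end

section \<open>The action of the Hecke algebra\<close>

locale hecke_algebra = based_root_system +
  fixes mul :: "(('a \<Rightarrow> 'a) \<Rightarrow>\<^sub>0 laurent) \<Rightarrow> (('a \<Rightarrow> 'a) \<Rightarrow>\<^sub>0 laurent) \<Rightarrow> (('a \<Rightarrow> 'a) \<Rightarrow>\<^sub>0 laurent)"
    and hbar :: "(('a \<Rightarrow> 'a) \<Rightarrow>\<^sub>0 laurent) \<Rightarrow> (('a \<Rightarrow> 'a) \<Rightarrow>\<^sub>0 laurent)"
  assumes hecke_product: "hecke_product \<Phi> \<Delta> mul" and hecke_bar: "hecke_bar \<Phi> mul hbar"
begin

lemma mul_in_H: "x \<in> H \<Longrightarrow> y \<in> H \<Longrightarrow> mul x y \<in> H"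
  and mul_assoc: "x \<in> H \<Longrightarrow> y \<in> H \<Longrightarrow> z \<in> H \<Longrightarrow> mul (mul x y) z = mul x (mul y z)"
  and mul_one: "x \<in> H \<Longrightarrow> mul (av id) x = x" "x \<in> H \<Longrightarrow> mul x (av id) = x"
  and mul_add_left: "x \<in> H \<Longrightarrow> y \<in> H \<Longrightarrow> z \<in> H \<Longrightarrow> mul (x + y) z = mul x z + mul y z"
  and mul_add_right: "x \<in> H \<Longrightarrow> y \<in> H \<Longrightarrow> z \<in> H \<Longrightarrow> mul x (y + z) = mul x y + mul x z"
  and mul_smul_left: "x \<in> H \<Longrightarrow> y \<in> H \<Longrightarrow> mul (c \<cdot>\<^sub>A x) y = c \<cdot>\<^sub>A mul x y"
  and mul_smul_right: "x \<in> H \<Longrightarrow> y \<in> H \<Longrightarrow> mul x (c \<cdot>\<^sub>A y) = c \<cdot>\<^sub>A mul x y"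
  and mul_basis: "v \<in> W \<Longrightarrow> w \<in> W \<Longrightarrow> l (v \<circ> w) = l v + l w \<Longrightarrow> mul (av v) (av w) = av (v \<circ> w)"
  and mul_quadratic: "s \<in> S \<Longrightarrow> mul (av s + av id) (av s - upow 2 \<cdot>\<^sub>A av id) = 0"
  using hecke_product unfolding hecke_product_def Let_def by blast+

lemma hbar_in_H: "x \<in> H \<Longrightarrow> hbar x \<in> H"
  and hbar_add: "x \<in> H \<Longrightarrow> y \<in> H \<Longrightarrow> hbar (x + y) = hbar x + hbar y"
  and hbar_mul: "x \<in> H \<Longrightarrow> y \<in> H \<Longrightarrow> hbar (mul x y) = mul (hbar x) (hbar y)"
  and hbar_one: "hbar (av id) = av id"
  and hbar_basis: "w \<in> W \<Longrightarrow> \<exists>x\<in>H. mul x (av (inv w)) = av id \<and> mul (av (inv w)) x = av id \<and>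
           hbar (upow n \<cdot>\<^sub>A av w) = upow (- n) \<cdot>\<^sub>A x"
  using hecke_bar unfolding hecke_bar_def Let_def by blast+

lemma id_in_W [simp]: "id \<in> W" by (rule weyl_group.one)

lemma id_in_H: "av id \<in> H" by simp

lemma simple_in_H: "s \<in> S \<Longrightarrow> av s \<in> H" by (simp add: simple_in_W)

lemma mul_diff_right:
  assumes "x \<in> H" "y \<in> H" "z \<in> H" shows "mul x (y - z) = mul x y - mul x z"
  using mul_add_right[of x "y - z" z] assms by (simp add: algebra_simps)

lemma len_simple_eq: "\<alpha> \<in> \<Delta> \<Longrightarrow> l (refl \<alpha>) = 1"
  using len_simple(1)[OF weyl_group.one, of \<alpha>] by simp

lemma mul_simple_up:
  assumes "w \<in> W" "\<alpha> \<in> \<Delta>" "pos (inv w \<alpha>)"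
  shows "mul (av (refl \<alpha>)) (av w) = av (refl \<alpha> \<circ> w)"
  using assms len_simple(1)[OF assms(1,2)] len_simple_eq[OF assms(2)]
  by (intro mul_basis) (simp_all add: refl_in_W)

lemma mul_simple_square:
  assumes "s \<in> S"
  shows "mul (av s) (av s) = (upow 2 - 1) \<cdot>\<^sub>A av s + upow 2 \<cdot>\<^sub>A av id"
proof -
  have s: "av s \<in> H" using simple_in_H assms .
  have "0 = mul (av s + av id) (av s - upow 2 \<cdot>\<^sub>A av id)" using mul_quadratic[OF assms] by simp
  also have "\<dots> = mul (av s) (av s) - upow 2 \<cdot>\<^sub>A av s + (av s - upow 2 \<cdot>\<^sub>A av id)"
    using s by (simp add: mul_add_left mul_diff_right mul_smul_right mul_one smul.scale_right_distrib)
  finally show ?thesis by (simp add: smul.scale_left_diff_distrib algebra_simps)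
qed

lemma mul_simple_down:
  assumes w: "w \<in> W" "\<alpha> \<in> \<Delta>" "pos (inv w \<alpha>)"
  shows "mul (av (refl \<alpha>)) (av (refl \<alpha> \<circ> w)) = (upow 2 - 1) \<cdot>\<^sub>A av (refl \<alpha> \<circ> w) + upow 2 \<cdot>\<^sub>A av w"
proof -
  have s: "refl \<alpha> \<in> S" using w by (auto simp: simple_refls_def)
  note H = simple_in_H[OF s] w(1)
  have "mul (av (refl \<alpha>)) (av (refl \<alpha> \<circ> w)) = mul (mul (av (refl \<alpha>)) (av (refl \<alpha>))) (av w)"
    using mul_assoc[of "av (refl \<alpha>)" "av (refl \<alpha>)" "av w"] H mul_simple_up[OF w] by simp
  also have "\<dots> = (upow 2 - 1) \<cdot>\<^sub>A av (refl \<alpha> \<circ> w) + upow 2 \<cdot>\<^sub>A av w"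
    unfolding mul_simple_square[OF s] using H mul_simple_up[OF w]
    by (simp add: mul_add_left mul_smul_left mul_one)
  finally show ?thesis .
qed

text \<open>On the basis, ascending letters match by \<open>T_of_step\<close>; descending ones give
  the same two terms because \<open>mul\<close> and \<open>T\<close> obey the same quadratic
  relation.\<close>

lemma act_mul_simple:
  assumes h: "h \<in> H" and \<alpha>: "\<alpha> \<in> \<Delta>" and v: "v \<in> M"
  shows "act (mul (av (refl \<alpha>)) h) v = T (refl \<alpha>) (act h v)"
proof -
  let ?s = "refl \<alpha>"
  have s: "?s \<in> S" using \<alpha> by (auto simp: simple_refls_def)
  note L = linD[OF lin_act_left[of v]] linD[OF lin_T]
  note sH = simple_in_H[OF s]
  have "h \<in> {h \<in> H. act (mul (av ?s) h) v = T ?s (act h v)}"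
  proof (rule free_mod_induct[OF h])
    have "mul (av ?s) 0 = 0" using mul_smul_right[of "av ?s" "av id" 0] sH by simp
    thus "smul.subspace {h \<in> H. act (mul (av ?s) h) v = T ?s (act h v)}"
      using sH by (intro smul.subspaceI) (auto simp: L mul_add_right mul_smul_right)
    fix w assume w: "w \<in> W"
    let ?w' = "?s \<circ> w"
    have r: "?s \<in> W" using simple_in_W s by blast
    have w': "?w' \<in> W" using comp_in_W[OF r w] .
    have ww: "?s \<circ> ?w' = w" by simp
    have "act (mul (av ?s) (av w)) v = T ?s (act (av w) v)"
    proof (cases "pos (inv w \<alpha>)")
      case True
      thus ?thesis using mul_simple_up[OF w \<alpha> True] T_of_step[OF w \<alpha> True v] by simp
    next
      case False
      have "inv ?w' \<alpha> = - inv w \<alpha>"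
        using inv_comp_W[OF r w] W_uminus[OF inv_in_W[OF w], of \<alpha>] \<alpha> by simp
      hence p: "pos (inv ?w' \<alpha>)" using False pos_uminus[of "inv w \<alpha>"] \<alpha> inv_in_W[OF w] by simp
      have 1: "T_of w v = T ?s (T_of ?w' v)" using T_of_step[OF w' \<alpha> p v] unfolding ww .
      have 2: "mul (av ?s) (av w) = (upow 2 - 1) \<cdot>\<^sub>A av w + upow 2 \<cdot>\<^sub>A av ?w'"
        using mul_simple_down[OF w' \<alpha> p] unfolding ww .
      show ?thesis
        unfolding 2 L act_basis 1 T_quadratic[OF s T_of_in_M[OF w' v]] ..
    qed
    thus "av w \<in> {h \<in> H. act (mul (av ?s) h) v = T ?s (act h v)}" using w by simp
  qed
  thus ?thesis by simp
qed

lemma act_mul: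
  assumes h: "h \<in> H" and h': "h' \<in> H" and v: "v \<in> M"
  shows "act (mul h h') v = act h (act h' v)"
proof -
  note L = linD[OF lin_act_left]
  have "h \<in> {h \<in> H. act (mul h h') v = act h (act h' v)}"
  proof (rule free_mod_induct[OF h])
    have "mul 0 h' = 0" using mul_smul_left[of "av id" h' 0] h' by simp
    thus "smul.subspace {h \<in> H. act (mul h h') v = act h (act h' v)}"
      using h' by (intro smul.subspaceI) (auto simp: L mul_add_left mul_smul_left)
    fix w assume w: "w \<in> W"
    hence "act (mul (av w) h') v = act (av w) (act h' v)"
    proof (induction rule: W_left_induct)
      case id show "act (mul (av id) h') v = act (av id) (act h' v)"
        using h' v by (simp add: mul_one T_of_id act_in_M)
    next
      case (step w \<alpha>)
      have s: "av (refl \<alpha>) \<in> H" using simple_in_H step by (auto simp: simple_refls_def)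
      have wH: "av w \<in> H" using step by simp
      have "mul (av (refl \<alpha> \<circ> w)) h' = mul (av (refl \<alpha>)) (mul (av w) h')"
        using mul_assoc[OF s wH h'] mul_simple_up[OF step(1-3)] by simp
      hence "act (mul (av (refl \<alpha> \<circ> w)) h') v = T (refl \<alpha>) (act (av w) (act h' v))"
        using act_mul_simple[OF mul_in_H[OF wH h'] step(2) v] step.IH by simp
      also have "\<dots> = act (av (refl \<alpha> \<circ> w)) (act h' v)"
        using T_of_step[OF step(1-3) act_in_M[OF h' v]] by simp
      finally show "act (mul (av (refl \<alpha> \<circ> w)) h') v = act (av (refl \<alpha> \<circ> w)) (act h' v)" .
    qed
    thus "av w \<in> {h \<in> H. act (mul h h') v = act h (act h' v)}" using w by simp
  qed
  thus ?thesis by simp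
qed

lemma hecke_module_act: "hecke_module \<Phi> mul act"
  unfolding hecke_module_def Let_def
  by (auto simp: act_in_M linD[OF lin_act] linD[OF lin_act_left] act_mul T_of_id)

lemma hecke_module_unique:
  assumes act': "hecke_module \<Phi> mul act'"
    and T: "\<forall>s\<in>S. \<forall>m\<in>M. act' (av s) m = T s m" and h: "h \<in> H" and v: "v \<in> M"
  shows "act' h v = act h v"
proof -
  have M: "\<And>h m. h \<in> H \<Longrightarrow> m \<in> M \<Longrightarrow> act' h m \<in> M"
    and add: "\<And>h h' m. h \<in> H \<Longrightarrow> h' \<in> H \<Longrightarrow> m \<in> M \<Longrightarrow> act' (h + h') m = act' h m + act' h' m"
    and sc: "\<And>c h m. h \<in> H \<Longrightarrow> m \<in> M \<Longrightarrow> act' (c \<cdot>\<^sub>A h) m = c \<cdot>\<^sub>A act' h m"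
    and one: "\<And>m. m \<in> M \<Longrightarrow> act' (av id) m = m"
    and mul: "\<And>h h' m. h \<in> H \<Longrightarrow> h' \<in> H \<Longrightarrow> m \<in> M \<Longrightarrow> act' (mul h h') m = act' h (act' h' m)"
    using act' unfolding hecke_module_def Let_def by blast+
  have "h \<in> {h \<in> H. act' h v = act h v}"
  proof (rule free_mod_induct[OF h])
    have "act' 0 v = 0" using sc[OF id_in_H v, of 0] by simp
    thus "smul.subspace {h \<in> H. act' h v = act h v}"
      using v by (intro smul.subspaceI) (auto simp: linD[OF lin_act_left] add sc)
    fix w assume w: "w \<in> W"
    hence "act' (av w) v = act (av w) v"
    proof (induction rule: W_left_induct)
      case id show "act' (av id) v = act (av id) v" using one[OF v] v by (simp add: T_of_id)
    next
      case (step w \<alpha>)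
      have s: "refl \<alpha> \<in> S" using step by (auto simp: simple_refls_def)
      have wH: "av w \<in> H" using step by simp
      have "act' (av (refl \<alpha> \<circ> w)) v = act' (av (refl \<alpha>)) (act' (av w) v)"
        using mul[OF simple_in_H[OF s] wH v] mul_simple_up[OF step(1-3)] by simp
      also have "\<dots> = T (refl \<alpha>) (act (av w) v)" using T s M[OF wH v] step.IH by simp
      also have "\<dots> = act (av (refl \<alpha> \<circ> w)) v" using T_of_step[OF step(1-3) v] by simp
      finally show "act' (av (refl \<alpha> \<circ> w)) v = act (av (refl \<alpha> \<circ> w)) v" .
    qed
    thus "av w \<in> {h \<in> H. act' h v = act h v}" using w by simp
  qed
  thus ?thesis by simp
qed


section \<open>The bar operator\<close>

text \<open>\<open>hecke_bar\<close> provides only some inverse of \<open>av s\<close>. By the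
  quadratic relation the right-hand side is an inverse as well, and associativity makes the two
  equal.\<close>

lemma hbar_simple:
  assumes "s \<in> S"
  shows "hbar (av s) = upow (- 2) \<cdot>\<^sub>A av s - (1 - upow (- 2)) \<cdot>\<^sub>A av id" (is "_ = ?y")
proof -
  note sH = simple_in_H[OF assms]
  have "inv s = s" using assms by (auto elim: simple_refls_E)
  then obtain x where x: "x \<in> H" "mul x (av s) = av id" "hbar (av s) = x"
    using hbar_basis[OF simple_in_W[OF assms], of 0] by auto
  have yH: "?y \<in> H" using sH by simp
  have "mul (av s) ?y = upow (- 2) \<cdot>\<^sub>A mul (av s) (av s) - (1 - upow (- 2)) \<cdot>\<^sub>A av s"
    using sH by (simp add: mul_diff_right mul_smul_right mul_one)
  also have "\<dots> = av id"
    unfolding mul_simple_square[OF assms]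
    by (simp add: smul.scale_right_distrib smul.scale_right_diff_distrib smul.scale_left_diff_distrib)
  finally have "mul x (mul (av s) ?y) = x" using mul_one(2)[OF x(1)] by simp
  moreover have "mul x (mul (av s) ?y) = mul (mul x (av s)) ?y"
    using mul_assoc[OF x(1) sH yH] by simp
  ultimately show ?thesis using x mul_one(1)[OF yH] by simp
qed

lemma act_hbar_simple: "s \<in> S \<Longrightarrow> v \<in> M \<Longrightarrow> act (hbar (av s)) v = Ti s v"
  unfolding hbar_simple linD[OF lin_act_left] by (auto simp: Ti_def T_of_id T_of_simple elim!: simple_refls_E)

lemma hbar_smul: assumes "h \<in> H" shows "hbar (c \<cdot>\<^sub>A h) = cbar c \<cdot>\<^sub>A hbar h"
proof (rule semilinear_on[OF subspace_free_mod _ _ assms])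
  show "hbar (x + y) = hbar x + hbar y" if "x \<in> H" "y \<in> H" for x y using hbar_add that .
  fix n x assume x: "x \<in> H"
  obtain y where y: "y \<in> H" "mul y (av (inv id)) = av id" "hbar (upow n \<cdot>\<^sub>A av id) = upow (- n) \<cdot>\<^sub>A y"
    using hbar_basis[OF weyl_group.one, of n] by blast
  \<comment> \<open>The axiom for \<open>w = id\<close> determines the bar on scalars, since the
    unit is its own inverse.\<close>
  have "y = av id" using y(2) mul_one(2)[OF y(1)] by simp
  hence e: "hbar (upow n \<cdot>\<^sub>A av id) = upow (- n) \<cdot>\<^sub>A av id" using y(3) by simp
  have "upow n \<cdot>\<^sub>A x = mul (upow n \<cdot>\<^sub>A av id) x" using x by (simp add: mul_smul_left mul_one)
  hence "hbar (upow n \<cdot>\<^sub>A x) = mul (hbar (upow n \<cdot>\<^sub>A av id)) (hbar x)" using x by (simp add: hbar_mul)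
  thus "hbar (upow n \<cdot>\<^sub>A x) = upow (- n) \<cdot>\<^sub>A hbar x"
    unfolding e using x by (simp add: mul_smul_left mul_one hbar_in_H)
qed

text \<open>Lusztig's formula: the bar operator sends \<open>a\<^sub>w\<close> to \<open>(-1)\<^bsup>l(w)\<^esup> T\<^sub>w\<^sup>-\<^sup>1 a\<^sub>w\<close>.\<close>
definition Tbar_act :: "('a \<Rightarrow> 'a) \<Rightarrow> (('a \<Rightarrow> 'a) \<Rightarrow>\<^sub>0 laurent) \<Rightarrow> (('a \<Rightarrow> 'a) \<Rightarrow>\<^sub>0 laurent)" where
  "Tbar_act w = act (hbar (av w))"

text \<open>For an involution, \<open>hbar (av w)\<close> is the inverse of \<open>av w\<close>.
  Writing it with \<open>hbar\<close> makes \<open>Tbar_act\<close> multiplicative on products whose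
  lengths add.\<close>

definition bar_basis :: "('a \<Rightarrow> 'a) \<Rightarrow> (('a \<Rightarrow> 'a) \<Rightarrow>\<^sub>0 laurent)" where
  "bar_basis w = ((- 1) ^ l w) \<cdot>\<^sub>A Tbar_act w (av w)"

definition mbar :: "(('a \<Rightarrow> 'a) \<Rightarrow>\<^sub>0 laurent) \<Rightarrow> (('a \<Rightarrow> 'a) \<Rightarrow>\<^sub>0 laurent)" where
  "mbar = sext cbar bar_basis"

lemma lin_Tbar_act: "linear_A (Tbar_act w)" unfolding Tbar_act_def by (rule lin_act)

lemma Tbar_act_in_M: "w \<in> W \<Longrightarrow> v \<in> M \<Longrightarrow> Tbar_act w v \<in> M"
  unfolding Tbar_act_def by (intro act_in_M hbar_in_H) simp_all

lemma Tbar_act_mul: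
  assumes "x \<in> W" "y \<in> W" "l (x \<circ> y) = l x + l y" "v \<in> M"
  shows "Tbar_act (x \<circ> y) v = Tbar_act x (Tbar_act y v)"
proof -
  have xy: "av x \<in> H" "av y \<in> H" using assms by simp_all
  have "hbar (av (x \<circ> y)) = mul (hbar (av x)) (hbar (av y))"
    using mul_basis[OF assms(1-3)] hbar_mul[OF xy] by simp
  thus ?thesis unfolding Tbar_act_def using act_mul[OF hbar_in_H[OF xy(1)] hbar_in_H[OF xy(2)] assms(4)] by simp
qed

lemma Tbar_act_simple: "s \<in> S \<Longrightarrow> v \<in> M \<Longrightarrow> Tbar_act s v = Ti s v"
  unfolding Tbar_act_def by (rule act_hbar_simple)

lemma mbar_add: "mbar (x + y) = mbar x + mbar y"
  unfolding mbar_def by (rule sext_add) (simp_all add: cbar_add)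

lemma mbar_smul: "mbar (c \<cdot>\<^sub>A x) = cbar c \<cdot>\<^sub>A mbar x"
  unfolding mbar_def by (rule sext_smul) (simp_all add: cbar_mult)

lemma mbar_0 [simp]: "mbar 0 = 0"
  using mbar_add[of 0 0] by simp

lemma mbar_diff: "mbar (x - y) = mbar x - mbar y"
  using mbar_add[of "x - y" y] by (simp add: algebra_simps)

lemma mbar_basis: "mbar (av w) = bar_basis w"
  by (simp add: mbar_def)

lemma bar_basis_in_M: "w \<in> I \<Longrightarrow> bar_basis w \<in> M"
  unfolding bar_basis_def using Tbar_act_in_M[OF I_in_W, of w "av w"] by simp

lemma mbar_in_M: "v \<in> M \<Longrightarrow> mbar v \<in> M"
  unfolding mbar_def by (rule sext_closed[OF _ subspace_free_mod bar_basis_in_M])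

text \<open>If \<open>s\<close> and \<open>w\<close> commute, \<open>Tbar_act\<close> of their
  product has \<open>Ti s\<close> on either side of \<open>Tbar_act w\<close>; the latter is applied
  to the identity that \<open>Ti s\<close> makes of case (i). Otherwise \<open>Ti s\<close> stands
  on both sides, and the inner one turns the conjugated basis element back into
  \<open>av w\<close>.\<close>

lemma mbar_T_up:
  assumes w: "w \<in> I" and \<alpha>: "\<alpha> \<in> \<Delta>" and p: "pos (w \<alpha>)"
  shows "mbar (T (refl \<alpha>) (av w)) = Ti (refl \<alpha>) (mbar (av w))"
proof -
  let ?s = "refl \<alpha>" and ?v = "star (refl \<alpha>) w"
  have s: "?s \<in> S" "?s \<in> W" using \<alpha> refl_in_W by (auto simp: simple_refls_def)
  have W: "w \<in> W" "inv w = w" using w I_in_W I_inv by auto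
  have vI: "?v \<in> I" using star_in_I[OF w \<alpha>] .
  have lw: "l (?s \<circ> w) = l ?s + l w" using len_simple(1)[OF W(1) \<alpha>] W p len_simple_eq[OF \<alpha>] by simp
  have wM: "av w \<in> M" "av ?v \<in> M" using w vI by simp_all
  have K1: "Tbar_act (?s \<circ> w) v = Ti ?s (Tbar_act w v)" if "v \<in> M" for v
    using Tbar_act_mul[OF s(2) W(1) lw that] Tbar_act_simple[OF s(1) Tbar_act_in_M[OF W(1) that]] by simp
  have T_of: "Ti ?s (T ?s (av w)) = av w" using Ti_T[OF s(1) wM(1)] .
  show ?thesis
  proof (cases "?s \<circ> w = w \<circ> ?s")
    case True
    have v: "?v = ?s \<circ> w" unfolding star_def using True by (rule if_P)
    have lv: "l ?v = Suc (l w)" using len_star[OF w \<alpha> p] True by (simp only: if_True simp_thms Suc_eq_plus1)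
    have T: "T ?s (av w) = u \<cdot>\<^sub>A av w + (u + 1) \<cdot>\<^sub>A av ?v"
      using T_up[OF w \<alpha> p] True by (simp only: if_True simp_thms)
    have K2: "Tbar_act ?v v = Tbar_act w (Ti ?s v)" if "v \<in> M" for v
    proof -
      have "l (w \<circ> ?s) = l w + l ?s" using lw unfolding True by simp
      thus ?thesis unfolding v True
        using Tbar_act_mul[OF W(1) s(2) _ that] Tbar_act_simple[OF s(1) that] by simp
    qed
    have bv: "bar_basis ?v = (- ((- 1) ^ l w)) \<cdot>\<^sub>A Tbar_act w (Ti ?s (av ?v))"
      unfolding bar_basis_def lv K2[OF wM(2)] by simp
    have "av w = u \<cdot>\<^sub>A Ti ?s (av w) + (u + 1) \<cdot>\<^sub>A Ti ?s (av ?v)"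
      using T_of unfolding T linD[OF lin_Ti] by simp
    \<comment> \<open>The factor \<open>u^-1\<close> turns the coefficients \<open>u\<close> and
      \<open>u + 1\<close> into 1 and \<open>1 + u^-1\<close>, the bar of
      \<open>u + 1\<close>.\<close>
    hence "upow (-1) \<cdot>\<^sub>A Tbar_act w (av w) =
        upow (-1) \<cdot>\<^sub>A Tbar_act w (u \<cdot>\<^sub>A Ti ?s (av w) + (u + 1) \<cdot>\<^sub>A Ti ?s (av ?v))" by simp
    hence e: "upow (-1) \<cdot>\<^sub>A Tbar_act w (av w) = Tbar_act w (Ti ?s (av w)) + (1 + upow (-1)) \<cdot>\<^sub>A Tbar_act w (Ti ?s (av ?v))"
      unfolding linD[OF lin_Tbar_act] by (simp add: smul.scale_right_distrib distrib_left)
    have "Tbar_act w (Ti ?s (av w)) = Ti ?s (Tbar_act w (av w))" using K2[OF wM(1)] K1[OF wM(1)] unfolding v by simp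
    moreover have "mbar (T ?s (av w)) = upow (-1) \<cdot>\<^sub>A bar_basis w + (upow (-1) + 1) \<cdot>\<^sub>A bar_basis ?v"
      unfolding T mbar_add mbar_smul mbar_basis by (simp add: cbar_add)
    moreover have "\<dots> = ((- 1) ^ l w) \<cdot>\<^sub>A
        (upow (-1) \<cdot>\<^sub>A Tbar_act w (av w) - (1 + upow (-1)) \<cdot>\<^sub>A Tbar_act w (Ti ?s (av ?v)))"
      unfolding bv unfolding bar_basis_def by (rule poly_mapping_eqI) (simp add: lookup_add lookup_minus algebra_simps)
    ultimately show ?thesis unfolding e mbar_basis bar_basis_def linD[OF lin_Ti] by simp
  next
    case False
    have v: "?v = ?s \<circ> w \<circ> ?s" unfolding star_def using False by (rule if_not_P)
    have lv: "l ?v = l w + 2" using len_star[OF w \<alpha> p] False by (simp only: if_False)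
    have T: "T ?s (av w) = av ?v" using T_up[OF w \<alpha> p] False by (simp only: if_False)
    have l2: "l (?s \<circ> w \<circ> ?s) = l (?s \<circ> w) + l ?s"
      using lv lw len_simple_eq[OF \<alpha>] unfolding v by simp
    have "Tbar_act ?v (av ?v) = Tbar_act (?s \<circ> w) (Tbar_act ?s (av ?v))"
      using Tbar_act_mul[OF comp_in_W[OF s(2) W(1)] s(2) l2 wM(2)] unfolding v .
    also have "Tbar_act ?s (av ?v) = av w" using Tbar_act_simple[OF s(1) wM(2)] T_of unfolding T by simp
    also have "Tbar_act (?s \<circ> w) (av w) = Ti ?s (Tbar_act w (av w))" by (rule K1[OF wM(1)])
    finally have "Tbar_act ?v (av ?v) = Ti ?s (Tbar_act w (av w))" .
    thus ?thesis unfolding T mbar_basis bar_basis_def lv linD[OF lin_Ti] by simp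
  qed
qed

text \<open>Only ascending \<open>w\<close> need a computation. At \<open>T s x\<close> the claim is
  the quadratic relation for \<open>Ti s\<close>, which is the bar image of the one for
  \<open>T s\<close>.\<close>

lemma mbar_T:
  assumes s: "s \<in> S" and v: "v \<in> M"
  shows "mbar (T s v) = Ti s (mbar v)"
proof -
  obtain \<alpha> where \<alpha>: "\<alpha> \<in> \<Delta>" "s = refl \<alpha>" using s simple_refls_E by blast
  note L = linD[OF lin_T] linD[OF lin_Ti] mbar_add mbar_smul
  have "v \<in> {v. mbar (T s v) = Ti s (mbar v)}"
  proof (rule M_generated[of _ "{\<alpha>}"])
    show "smul.subspace {v. mbar (T s v) = Ti s (mbar v)}"
      by (rule smul.subspaceI) (simp_all add: L)
    show "av w \<in> {v. mbar (T s v) = Ti s (mbar v)}" if "w \<in> I" "\<not> (\<exists>\<alpha>\<in>{\<alpha>}. \<not> pos (w \<alpha>))" for w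
      using mbar_T_up[OF that(1) \<alpha>(1)] that(2) \<alpha>(2) by simp
    show "T (refl \<beta>) x \<in> {v. mbar (T s v) = Ti s (mbar v)}"
      if "\<beta> \<in> {\<alpha>}" "x \<in> M" "x \<in> {v. mbar (T s v) = Ti s (mbar v)}" for \<beta> x
    proof -
      let ?y = "mbar x"
      have x: "mbar (T s x) = Ti s ?y" using that by simp
      have y: "?y \<in> M" using mbar_in_M that by blast
      have "Ti s (Ti s ?y) = upow (- 2) \<cdot>\<^sub>A T s (Ti s ?y) - (1 - upow (- 2)) \<cdot>\<^sub>A Ti s ?y"
        unfolding Ti_def[of s "Ti s ?y"] ..
      also have "\<dots> = (upow (-2) - 1) \<cdot>\<^sub>A Ti s ?y + upow (-2) \<cdot>\<^sub>A ?y"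
        unfolding T_Ti[OF s y] by (simp add: smul.scale_left_diff_distrib algebra_simps)
      also have "\<dots> = mbar (T s (T s x))"
        unfolding T_quadratic[OF s that(2)] mbar_add mbar_smul x by (simp add: cbar_diff)
      finally show ?thesis using that(1) \<alpha>(2) x by simp
    qed
    show "x \<in> {v. mbar (T s v) = Ti s (mbar v)}"
      if "(u + 1) \<cdot>\<^sub>A x \<in> {v. mbar (T s v) = Ti s (mbar v)}" for x
    proof -
      have "(upow (-1) + 1) \<cdot>\<^sub>A mbar (T s x) = (upow (-1) + 1) \<cdot>\<^sub>A Ti s (mbar x)"
        using that by (simp add: L cbar_add)
      thus ?thesis using smul_cancel[OF upow_plus_1_nonzero[of "-1"]] by simp
    qed
  qed (use \<alpha> v in auto)
  thus ?thesis by simp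
qed

lemma Ti_plus: "Ti s v + v = upow (- 2) \<cdot>\<^sub>A (T s v + v)"
  unfolding Ti_def by (simp add: smul.scale_left_diff_distrib smul.scale_right_distrib)

lemma inv_mod_bar_mbar: "inv_mod_bar \<Phi> \<Delta> mbar"
proof -
  have "bar_basis id = av id"
    unfolding bar_basis_def Tbar_act_def hbar_one act_basis using T_of_id[of "av id"] id_in_I by simp
  thus ?thesis
    unfolding inv_mod_bar_def Let_def
    by (auto simp: mbar_in_M mbar_add mbar_smul mbar_basis mbar_T Ti_plus)
qed

text \<open>With all simple roots allowed as directions in \<open>M_generated\<close>, the bottom
  consists of the identity alone, where a bar map is prescribed.\<close>

lemma I_all_pos: "w \<in> I \<Longrightarrow> \<not> (\<exists>\<alpha>\<in>\<Delta>. \<not> pos (w \<alpha>)) \<Longrightarrow> w = id"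
  using W_eq_id I_in_W by blast

lemma inv_mod_bar_unique:
  assumes b: "inv_mod_bar \<Phi> \<Delta> mbar'" and v: "v \<in> M"
  shows "mbar' v = mbar v"
proof -
  have M: "\<And>m. m \<in> M \<Longrightarrow> mbar' m \<in> M"
    and add: "\<And>m m'. m \<in> M \<Longrightarrow> m' \<in> M \<Longrightarrow> mbar' (m + m') = mbar' m + mbar' m'"
    and up: "\<And>m n. m \<in> M \<Longrightarrow> mbar' (upow n \<cdot>\<^sub>A m) = upow (- n) \<cdot>\<^sub>A mbar' m"
    and one: "mbar' (av id) = av id"
    and T: "\<And>m s. m \<in> M \<Longrightarrow> s \<in> S \<Longrightarrow> mbar' (T s m + m) = upow (- 2) \<cdot>\<^sub>A (T s (mbar' m) + mbar' m)"
    using b unfolding inv_mod_bar_def Let_def by blast+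
  have sc: "mbar' (c \<cdot>\<^sub>A m) = cbar c \<cdot>\<^sub>A mbar' m" if "m \<in> M" for c m
    by (rule semilinear_on[OF subspace_free_mod add up that])
  have "v \<in> {v \<in> M. mbar' v = mbar v}"
  proof (rule M_generated[OF _ _ order_refl _ _ v])
    have "mbar' 0 = 0" using sc[OF v, of 0] by simp
    thus "smul.subspace {v \<in> M. mbar' v = mbar v}"
      by (intro smul.subspaceI) (auto simp: add sc mbar_add mbar_smul)
    show "av w \<in> {v \<in> M. mbar' v = mbar v}" if "w \<in> I" "\<not> (\<exists>\<alpha>\<in>\<Delta>. \<not> pos (w \<alpha>))" for w
    proof -
      have w: "w = id" by (rule I_all_pos[OF that])
      have "mbar (av id) = av id" using inv_mod_bar_mbar unfolding inv_mod_bar_def Let_def by blast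
      thus ?thesis unfolding w using one id_in_I by simp
    qed
    show "T (refl \<alpha>) m \<in> {v \<in> M. mbar' v = mbar v}"
      if "\<alpha> \<in> \<Delta>" "m \<in> M" "m \<in> {v \<in> M. mbar' v = mbar v}" for \<alpha> m
    proof -
      have s: "refl \<alpha> \<in> S" using that by (auto simp: simple_refls_def)
      have "mbar' (T (refl \<alpha>) m) + mbar' m = Ti (refl \<alpha>) (mbar' m) + mbar' m"
        using T[OF that(2) s] add[OF T_in_M[OF s that(2)] that(2)] Ti_plus by simp
      hence "mbar' (T (refl \<alpha>) m) = mbar (T (refl \<alpha>) m)" using mbar_T[OF s that(2)] that(3) by simp
      thus ?thesis using T_in_M[OF s that(2)] by simp
    qed
    show "m \<in> {v \<in> M. mbar' v = mbar v}" if m: "m \<in> M" "(u + 1) \<cdot>\<^sub>A m \<in> {v \<in> M. mbar' v = mbar v}" for m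
    proof -
      have "(upow (-1) + 1) \<cdot>\<^sub>A mbar' m = (upow (-1) + 1) \<cdot>\<^sub>A mbar m"
        using m by (simp add: sc mbar_smul cbar_add)
      thus ?thesis using smul_cancel[OF upow_plus_1_nonzero[of "-1"]] m by simp
    qed
  qed
  thus ?thesis by simp
qed

lemma mbar_mbar: assumes v: "v \<in> M" shows "mbar (mbar v) = v"
proof -
  have "v \<in> {v \<in> M. mbar (mbar v) = v}"
  proof (rule M_generated[OF _ _ order_refl _ _ v])
    show "smul.subspace {v \<in> M. mbar (mbar v) = v}"
      by (rule smul.subspaceI) (auto simp: mbar_add mbar_smul)
    show "av w \<in> {v \<in> M. mbar (mbar v) = v}" if "w \<in> I" "\<not> (\<exists>\<alpha>\<in>\<Delta>. \<not> pos (w \<alpha>))" for w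
    proof -
      have w: "w = id" by (rule I_all_pos[OF that])
      have "mbar (av id) = av id" using inv_mod_bar_mbar unfolding inv_mod_bar_def Let_def by blast
      thus ?thesis unfolding w using id_in_I by simp
    qed
    show "T (refl \<alpha>) m \<in> {v \<in> M. mbar (mbar v) = v}"
      if "\<alpha> \<in> \<Delta>" "m \<in> M" "m \<in> {v \<in> M. mbar (mbar v) = v}" for \<alpha> m
    proof -
      have s: "refl \<alpha> \<in> S" using that by (auto simp: simple_refls_def)
      have "mbar (mbar (T (refl \<alpha>) m)) = mbar (Ti (refl \<alpha>) (mbar m))" using mbar_T[OF s that(2)] by simp
      \<comment> \<open>Semilinearity inverts the coefficients of \<open>Ti\<close>, and the result
        is the formula for \<open>T s\<close> in terms of its inverse.\<close>
      also have "\<dots> = upow 2 \<cdot>\<^sub>A Ti (refl \<alpha>) (mbar (mbar m)) - (1 - upow 2) \<cdot>\<^sub>A mbar (mbar m)"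
        unfolding Ti_def[of _ "mbar m"] mbar_diff mbar_smul mbar_T[OF s mbar_in_M[OF that(2)]]
        by (simp add: cbar_diff)
      also have "\<dots> = T (refl \<alpha>) m"
        using that(3) by (simp add: Ti_def smul.scale_right_diff_distrib right_diff_distrib
            smul.scale_left_diff_distrib)
      finally show ?thesis using T_in_M[OF s that(2)] by simp
    qed
    show "m \<in> {v \<in> M. mbar (mbar v) = v}" if m: "m \<in> M" "(u + 1) \<cdot>\<^sub>A m \<in> {v \<in> M. mbar (mbar v) = v}" for m
      using m smul_cancel[OF upow_plus_1_nonzero[of 1]] by (simp add: mbar_smul)
  qed
  thus ?thesis by simp
qed

lemma mbar_act:
  assumes h: "h \<in> H" and v: "v \<in> M"
  shows "mbar (act h v) = act (hbar h) (mbar v)"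
proof -
  have "h \<in> {h \<in> H. mbar (act h v) = act (hbar h) (mbar v)}"
  proof (rule free_mod_induct[OF h])
    have "hbar 0 = 0" using hbar_smul[OF h, of 0] by simp
    thus "smul.subspace {h \<in> H. mbar (act h v) = act (hbar h) (mbar v)}"
      by (intro smul.subspaceI)
        (auto simp: hbar_add hbar_smul mbar_add mbar_smul linD[OF lin_act_left])
    fix w assume w: "w \<in> W"
    hence "mbar (act (av w) v) = act (hbar (av w)) (mbar v)"
    proof (induction rule: W_left_induct)
      case id show ?case unfolding hbar_one act_basis using v mbar_in_M[OF v] by (simp add: T_of_id)
    next
      case (step w \<alpha>)
      have s: "refl \<alpha> \<in> S" using step by (auto simp: simple_refls_def)
      have wH: "av w \<in> H" using step by simp
      have "mbar (act (av (refl \<alpha> \<circ> w)) v) = Ti (refl \<alpha>) (mbar (act (av w) v))"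
        using T_of_step[OF step(1-3) v] mbar_T[OF s act_in_M[OF wH v]] by simp
      also have "\<dots> = act (hbar (av (refl \<alpha>))) (act (hbar (av w)) (mbar v))"
        unfolding step.IH
        using act_hbar_simple[OF s act_in_M[OF hbar_in_H[OF wH] mbar_in_M[OF v]]] by simp
      also have "\<dots> = act (hbar (av (refl \<alpha> \<circ> w))) (mbar v)"
        using act_mul[OF hbar_in_H[OF simple_in_H[OF s]] hbar_in_H[OF wH] mbar_in_M[OF v]]
          hbar_mul[OF simple_in_H[OF s] wH] mul_simple_up[OF step(1-3)] by simp
      finally show "mbar (act (av (refl \<alpha> \<circ> w)) v) = act (hbar (av (refl \<alpha> \<circ> w))) (mbar v)" .
    qed
    thus "av w \<in> {h \<in> H. mbar (act h v) = act (hbar h) (mbar v)}" using w by simp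
  qed
  thus ?thesis by simp
qed

section \<open>Triangularity for the Bruhat order\<close>

definition below :: "('a \<Rightarrow> 'a) \<Rightarrow> ('a \<Rightarrow> 'a) set" where
  "below w = {y \<in> I. bruhat_le \<Phi> \<Delta> y w}"

lemma T_below:
  assumes w: "w \<in> I" "\<alpha> \<in> \<Delta>" "\<not> pos (w \<alpha>)" and x: "x \<in> free_mod (below w)"
  shows "T (refl \<alpha>) x \<in> free_mod (below w)"
proof -
  have "x \<in> {x. T (refl \<alpha>) x \<in> free_mod (below w)}"
  proof (rule free_mod_induct[OF x])
    show "smul.subspace {x. T (refl \<alpha>) x \<in> free_mod (below w)}"
      by (rule smul.subspaceI) (auto simp: linD[OF lin_T])
    fix y assume y: "y \<in> below w"
    hence "y \<in> I" "star (refl \<alpha>) y \<in> below w"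
      using bruhat_le_star[OF w] star_in_I[OF _ w(2)] by (auto simp: below_def)
    thus "av y \<in> {x. T (refl \<alpha>) x \<in> free_mod (below w)}"
      using T_up[of y \<alpha>] T_down[of y \<alpha>] w(2) y by (cases "pos (y \<alpha>)") auto
  qed
  thus ?thesis by simp
qed

lemma below_mono: "bruhat_le \<Phi> \<Delta> v w \<Longrightarrow> free_mod (below v) \<subseteq> free_mod (below w)"
  using bruhat_le_trans unfolding below_def free_mod_def by blast

text \<open>\<open>star (refl \<alpha>)\<close> is injective on involutions, so among the indices
  below \<open>v\<close> only \<open>v\<close> is sent to \<open>w\<close>; and \<open>w\<close>,
  being longer than \<open>v\<close>, is not among them.\<close>

lemma T_below_lookup:
  assumes v: "v \<in> I" "\<alpha> \<in> \<Delta>" "pos (v \<alpha>)" and x: "x \<in> free_mod (below v)"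
  defines "w \<equiv> star (refl \<alpha>) v"
  shows "Poly_Mapping.lookup (T (refl \<alpha>) x) w =
    (if refl \<alpha> \<circ> v = v \<circ> refl \<alpha> then u + 1 else 1) * Poly_Mapping.lookup x v" (is "_ = ?\<kappa> * _")
    and "Poly_Mapping.lookup x w = 0"
proof -
  have lw: "l v < l w" unfolding w_def using len_star[OF v] by simp
  have nle: "\<not> bruhat_le \<Phi> \<Delta> w v" using bruhat_le_len lw by fastforce
  thus "Poly_Mapping.lookup x w = 0"
    using x by (auto simp: free_mod_def below_def in_keys_iff subset_iff)
  have "x \<in> {x. Poly_Mapping.lookup (T (refl \<alpha>) x) w = ?\<kappa> * Poly_Mapping.lookup x v}"
  proof (rule free_mod_induct[OF x])
    show "smul.subspace {x. Poly_Mapping.lookup (T (refl \<alpha>) x) w = ?\<kappa> * Poly_Mapping.lookup x v}"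
      by (rule smul.subspaceI) (auto simp: linD[OF lin_T] lookup_add algebra_simps)
    fix y assume "y \<in> below v"
    hence y: "y \<in> I" "bruhat_le \<Phi> \<Delta> y v" by (auto simp: below_def)
    have yw: "y \<noteq> w" using y nle by blast
    show "av y \<in> {x. Poly_Mapping.lookup (T (refl \<alpha>) x) w = ?\<kappa> * Poly_Mapping.lookup x v}"
    proof (cases "y = v")
      case True
      have vw: "v \<noteq> w" using lw by blast
      show ?thesis using T_up[OF v] vw unfolding True
        by (simp add: lookup_add lookup_basis_elt w_def)
    next
      case False
      have "star (refl \<alpha>) y \<noteq> w"
        using star_props(2)[OF y(1) v(2)] star_props(2)[OF v(1,2)] False unfolding w_def by metis
      thus ?thesis using T_up[OF y(1) v(2)] T_down[OF y(1) v(2)] yw False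
        by (cases "pos (y \<alpha>)") (simp_all add: lookup_add lookup_basis_elt)
    qed
  qed
  thus "Poly_Mapping.lookup (T (refl \<alpha>) x) w = ?\<kappa> * Poly_Mapping.lookup x v" by simp
qed

text \<open>A descent makes \<open>w\<close> the neighbour of a shorter \<open>v\<close>, and its
  bar is read off from \<open>Ti\<close> at the bar of \<open>v\<close>. The span of the indices
  below \<open>w\<close> is stable under \<open>T\<close> in a direction of descent.\<close>

lemma mbar_triangular:
  assumes "w \<in> I"
  shows "mbar (av w) \<in> free_mod (below w) \<and> Poly_Mapping.lookup (mbar (av w)) w = upow (- int (l w))"
  using assms
proof (induction "l w" arbitrary: w rule: less_induct)
  case less
  show ?case
  proof (cases "\<exists>\<alpha>\<in>\<Delta>. \<not> pos (w \<alpha>)")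
    case False
    have w: "w = id" using I_all_pos[OF less.prems] False by blast
    have "mbar (av id) = av id" using inv_mod_bar_mbar unfolding inv_mod_bar_def Let_def by blast
    thus ?thesis unfolding w using id_in_I by (simp add: below_def lookup_basis_elt)
  next
    case True
    then obtain \<alpha> where \<alpha>: "\<alpha> \<in> \<Delta>" "\<not> pos (w \<alpha>)" by blast
    let ?s = "refl \<alpha>" and ?v = "star (refl \<alpha>) w"
    let ?x = "mbar (av ?v)"
    note st = star_props[OF less.prems \<alpha>(1)] and vI = star_in_I[OF less.prems \<alpha>(1)]
    have s: "?s \<in> S" using \<alpha> by (auto simp: simple_refls_def)
    have p: "pos (?v \<alpha>)" using st \<alpha> by blast
    note len = len_star[OF vI \<alpha>(1) p, unfolded st(2)]
    have "l ?v < l w" using len by (simp split: if_splits)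
    hence ih: "?x \<in> free_mod (below ?v)" "Poly_Mapping.lookup ?x ?v = upow (- int (l ?v))"
      using less.hyps vI by blast+
    have "bruhat_le \<Phi> \<Delta> ?v w" using bruhat_le_star[OF less.prems \<alpha> bruhat_le_refl] .
    hence xw: "?x \<in> free_mod (below w)" using ih below_mono by blast
    have Tx: "Ti ?s ?x \<in> free_mod (below w)"
      unfolding Ti_def using T_below[OF less.prems \<alpha> xw] xw by simp
    note lk = T_below_lookup[OF vI \<alpha>(1) p ih(1), unfolded st(2)]
    have mT: "mbar (T ?s (av ?v)) = Ti ?s ?x" using mbar_T[OF s] vI by simp
    show ?thesis
    proof (cases "?s \<circ> ?v = ?v \<circ> ?s")
      case True
      have lw: "l w = l ?v + 1" using len True by (simp only: if_True simp_thms)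
      have T: "T ?s (av ?v) = u \<cdot>\<^sub>A av ?v + (u + 1) \<cdot>\<^sub>A av w"
        using T_up[OF vI \<alpha>(1) p, unfolded st(2)] True by (simp only: if_True simp_thms)
      have e: "(upow (-1) + 1) \<cdot>\<^sub>A mbar (av w) = Ti ?s ?x - upow (-1) \<cdot>\<^sub>A ?x"
        using mT unfolding T mbar_add mbar_smul by (simp add: cbar_add algebra_simps)
      hence "(upow (-1) + 1) \<cdot>\<^sub>A mbar (av w) \<in> free_mod (below w)" using Tx xw by simp
      hence 1: "mbar (av w) \<in> free_mod (below w)"
        using smul_free_mod_cancel[OF upow_plus_1_nonzero[of "-1"]] by simp
      have lkT: "Poly_Mapping.lookup (T ?s ?x) w = (u + 1) * upow (- int (l ?v))"
        using lk(1) True unfolding ih(2) by (simp only: if_True simp_thms)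
      have "(upow (-1) + 1) * Poly_Mapping.lookup (mbar (av w)) w =
          Poly_Mapping.lookup (Ti ?s ?x - upow (-1) \<cdot>\<^sub>A ?x) w"
        unfolding e[symmetric] by simp
      \<comment> \<open>Of \<open>Ti\<close> only the term \<open>u^-2 T s\<close> reaches
        \<open>w\<close>. A commuting step adds 1 to the length, in accordance with
        \<open>u^-2 (u + 1) = u^-1 (u^-1 + 1)\<close>.\<close>
      also have "\<dots> = upow (-2) * ((u + 1) * upow (- int (l ?v)))"
        by (simp only: Ti_def lookup_minus lookup_smul lkT lk(2)) simp
      also have "\<dots> = (upow (-1) + 1) * upow (- int (l w))"
        unfolding lw by (simp add: distrib_right distrib_left)
      finally have "Poly_Mapping.lookup (mbar (av w)) w = upow (- int (l w))"
        using upow_plus_1_nonzero[of "-1"] by simp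
      thus ?thesis using 1 by blast
    next
      case False
      have lw: "l w = l ?v + 2" using len False by (simp only: if_False)
      have T: "T ?s (av ?v) = av w"
        using T_up[OF vI \<alpha>(1) p, unfolded st(2)] False by (simp only: if_False)
      have mw: "mbar (av w) = Ti ?s ?x" using mT unfolding T .
      have lkT: "Poly_Mapping.lookup (T ?s ?x) w = upow (- int (l ?v))"
        using lk(1) False unfolding ih(2) by (simp only: if_False mult_1)
      have "Poly_Mapping.lookup (Ti ?s ?x) w = upow (-2) * upow (- int (l ?v))"
        by (simp only: Ti_def lookup_minus lookup_smul lkT lk(2)) simp
      also have "\<dots> = upow (- int (l w))" unfolding lw by simp
      finally show ?thesis unfolding mw using Tx by blast
    qed
  qed
qed

lemma mbar_expand:
  assumes "w \<in> I"
  shows "mbar (av w) = (\<Sum>y\<in>below w. Poly_Mapping.lookup (mbar (av w)) y \<cdot>\<^sub>A av y)"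
proof -
  have "below w \<subseteq> W" using I_in_W by (auto simp: below_def)
  hence fin: "finite (below w)" using finite_W finite_subset by blast
  have k: "Poly_Mapping.keys (mbar (av w)) \<subseteq> below w"
    using mbar_triangular[OF assms] by (simp add: free_mod_def)
  have "mbar (av w) = sext (\<lambda>c. c) av (mbar (av w))" unfolding sext_def by (rule basis_expand)
  also have "\<dots> = (\<Sum>y\<in>below w. Poly_Mapping.lookup (mbar (av w)) y \<cdot>\<^sub>A av y)"
    by (rule sext_eq[OF _ fin k]) simp
  finally show ?thesis .
qed

end

theorem theorem0p2:
  fixes \<Phi> \<Delta> :: "'a::euclidean_space set"
    and mul :: "(('a \<Rightarrow> 'a) \<Rightarrow>\<^sub>0 laurent) \<Rightarrow> (('a \<Rightarrow> 'a) \<Rightarrow>\<^sub>0 laurent) \<Rightarrow> (('a \<Rightarrow> 'a) \<Rightarrow>\<^sub>0 laurent)"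
    and hbar :: "(('a \<Rightarrow> 'a) \<Rightarrow>\<^sub>0 laurent) \<Rightarrow> (('a \<Rightarrow> 'a) \<Rightarrow>\<^sub>0 laurent)"
  assumes "root_system \<Phi>" and "root_base \<Phi> \<Delta>"
    and "hecke_product \<Phi> \<Delta> mul" and "hecke_bar \<Phi> mul hbar"
  shows
    "\<exists>act.
       \<comment> \<open>(a)\<close>
       hecke_module \<Phi> mul act \<and>
       (\<forall>s\<in>simple_refls \<Delta>. \<forall>m\<in>inv_mod \<Phi>. act (basis_elt s) m = Ts \<Phi> \<Delta> s m) \<and>
       (\<forall>act'. hecke_module \<Phi> mul act' \<longrightarrow>
          (\<forall>s\<in>simple_refls \<Delta>. \<forall>m\<in>inv_mod \<Phi>. act' (basis_elt s) m = Ts \<Phi> \<Delta> s m) \<longrightarrow>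
          (\<forall>h\<in>hecke_carrier \<Phi>. \<forall>m\<in>inv_mod \<Phi>. act' h m = act h m)) \<and>
       \<comment> \<open>(b)\<close>
       (\<exists>mbar.
          inv_mod_bar \<Phi> \<Delta> mbar \<and>
          (\<forall>mbar'. inv_mod_bar \<Phi> \<Delta> mbar' \<longrightarrow> (\<forall>m\<in>inv_mod \<Phi>. mbar' m = mbar m)) \<and>
          (\<exists>r :: ('a \<Rightarrow> 'a) \<Rightarrow> ('a \<Rightarrow> 'a) \<Rightarrow> laurent. \<forall>w\<in>involutions \<Phi>.
             mbar (basis_elt w) =
               (\<Sum>y\<in>{y \<in> involutions \<Phi>. bruhat_le \<Phi> \<Delta> y w}. r y w \<cdot>\<^sub>A basis_elt y) \<and>
             r w w = upow (- int (len \<Delta> w))) \<and>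
          (\<forall>h\<in>hecke_carrier \<Phi>. \<forall>m\<in>inv_mod \<Phi>. mbar (act h m) = act (hbar h) (mbar m)) \<and>
          (\<forall>m\<in>inv_mod \<Phi>. mbar (mbar m) = m))"
proof -
  interpret hecke_algebra \<Phi> \<Delta> mul hbar
    using assms by unfold_locales
  show ?thesis
  proof (intro exI[of _ act] exI[of _ mbar] conjI)
    show "hecke_module \<Phi> mul act" by (rule hecke_module_act)
    show "\<forall>s\<in>S. \<forall>m\<in>M. act (av s) m = T s m" by (auto simp: T_of_simple elim!: simple_refls_E)
    show "\<forall>act'. hecke_module \<Phi> mul act' \<longrightarrow> (\<forall>s\<in>S. \<forall>m\<in>M. act' (av s) m = T s m) \<longrightarrow>
      (\<forall>h\<in>H. \<forall>m\<in>M. act' h m = act h m)"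
      using hecke_module_unique by blast
    show "inv_mod_bar \<Phi> \<Delta> mbar" by (rule inv_mod_bar_mbar)
    show "\<forall>mbar'. inv_mod_bar \<Phi> \<Delta> mbar' \<longrightarrow> (\<forall>m\<in>M. mbar' m = mbar m)"
      using inv_mod_bar_unique by blast
    show "\<exists>r :: ('a \<Rightarrow> 'a) \<Rightarrow> ('a \<Rightarrow> 'a) \<Rightarrow> laurent. \<forall>w\<in>I.
      mbar (av w) = (\<Sum>y\<in>{y \<in> I. bruhat_le \<Phi> \<Delta> y w}. r y w \<cdot>\<^sub>A av y) \<and> r w w = upow (- int (l w))"
      using mbar_expand mbar_triangular unfolding below_def
      by (intro exI[of _ "\<lambda>y w. Poly_Mapping.lookup (mbar (av w)) y"]) blast
    show "\<forall>h\<in>H. \<forall>m\<in>M. mbar (act h m) = act (hbar h) (mbar m)" using mbar_act by blast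
    show "\<forall>m\<in>M. mbar (mbar m) = m" using mbar_mbar by blast
  qed
qed

end
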